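(* Assume that $q>2$ and $N\ge2$, and set $|a|=\frac{q-2}{q-1}$. Then the Cauchy problem $$u_t-\Delta u+|\nabla u|^q=0\ \text{ in }Q_{\mathbb{R}^N,\infty}=\mathbb{R}^N\times(0,\infty),\qquad u(x,0)=\tilde U(x)\ \text{ in }\mathbb{R}^N,$$ with initial data $$\tilde U(x)=\tilde C|x|^{|a|}\in C(\mathbb{R}^N),\qquad \tilde C=\frac{q-1}{q-2}\Bigl(\frac{(N-1)q-N}{q-1}\Bigr)^{\frac{1}{q-1}},$$ admits at least two weak solutions: the stationary solution $\tilde U$, and a radial self-similar solution of the form $$U_{\tilde C}(x,t)=t^{|a|/2}f(|x|/\sqrt t),$$ where $f$ is increasing on $[0,\infty)$, $f(0)>0$, and $\lim_{\eta\to\infty}\eta^{-|a|}f(\eta)=\tilde C$.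
   Context: In the paper $a=\frac{2-q}{q-1}$, which is negative for $q>2$. A nonnegative function $u$ is a weak solution of $u_t-\Delta u+|\nabla u|^q=0$ in $Q_{\mathbb{R}^N,\infty}$ if $u\in C((0,\infty);L^1_{loc}(\mathbb{R}^N))\cap L^1_{loc}((0,\infty);W^{1,1}_{loc}(\mathbb{R}^N))$, $|\nabla u|^q\in L^1_{loc}(Q_{\mathbb{R}^N,\infty})$, and $\int_0^\infty\int_{\mathbb{R}^N}(-u\varphi_t-u\Delta\varphi+|\nabla u|^q\varphi)\,dx\,dt=0$ for all $\varphi\in\mathcal{D}(Q_{\mathbb{R}^N,\infty})$. It is a weak solution of the Cauchy problem with initial data $u_0$ if moreover it has trace $u_0$: $\lim_{t\to0}\int_{\mathbb{R}^N}u(\cdot,t)\psi\,dx=\int_{\mathbb{R}^N}\psi u_0\,dx$ for all $\psi\in C_c(\mathbb{R}^N)$. *)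

theory Defs
  imports "HOL-Analysis.Analysis"
begin

section \<open>Test functions\<close>

definition partial :: "'a::euclidean_space \<Rightarrow> ('a \<Rightarrow> real) \<Rightarrow> 'a \<Rightarrow> real" where
  "partial b f x = frechet_derivative f (at x) b"

primrec C_k :: "nat \<Rightarrow> ('a::euclidean_space \<Rightarrow> real) \<Rightarrow> bool" where
  "C_k 0 f \<longleftrightarrow> continuous_on UNIV f"
| "C_k (Suc k) f \<longleftrightarrow> (\<forall>x. f differentiable (at x)) \<and> (\<forall>b\<in>Basis. C_k k (partial b f))"

definition smooth :: "('a::euclidean_space \<Rightarrow> real) \<Rightarrow> bool" where
  "smooth f \<longleftrightarrow> (\<forall>k. C_k k f)"

definition supp :: "('a::topological_space \<Rightarrow> real) \<Rightarrow> 'a set" where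
  "supp f = closure {x. f x \<noteq> 0}"

text \<open>\<open>\<D>(\<Omega>)\<close> for open \<open>\<Omega>\<close>; its elements are extended by zero to the whole space.\<close>

definition test_functions :: "'a::euclidean_space set \<Rightarrow> ('a \<Rightarrow> real) set" where
  "test_functions \<Omega> = {\<phi>. smooth \<phi> \<and> compact (supp \<phi>) \<and> supp \<phi> \<subseteq> \<Omega>}"

definition time_deriv :: "('a::euclidean_space \<times> real \<Rightarrow> real) \<Rightarrow> 'a \<times> real \<Rightarrow> real" where
  "time_deriv \<phi> = partial (0, 1) \<phi>"

definition space_laplacian :: "('a::euclidean_space \<times> real \<Rightarrow> real) \<Rightarrow> 'a \<times> real \<Rightarrow> real" where
  "space_laplacian \<phi> z = (\<Sum>b\<in>Basis. partial (b, 0) (partial (b, 0) \<phi>) z)"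

section \<open>Function spaces\<close>

definition locally_integrable_on ::
    "('a::euclidean_space \<Rightarrow> 'b::euclidean_space) \<Rightarrow> 'a set \<Rightarrow> bool" where
  "locally_integrable_on f \<Omega> \<longleftrightarrow> (\<forall>K. compact K \<and> K \<subseteq> \<Omega> \<longrightarrow> f absolutely_integrable_on K)"

text \<open>\<open>v \<in> W\<^sup>1\<^sup>,\<^sup>1\<^sub>l\<^sub>o\<^sub>c\<close> on the whole space, with distributional gradient \<open>g\<close>.\<close>

definition has_weak_gradient ::
    "('a::euclidean_space \<Rightarrow> real) \<Rightarrow> ('a \<Rightarrow> 'a) \<Rightarrow> bool" where
  "has_weak_gradient v g \<longleftrightarrow>
     locally_integrable_on v UNIV \<and> locally_integrable_on g UNIV \<and>
     (\<forall>\<psi>\<in>test_functions UNIV. \<forall>b\<in>Basis.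
        (LINT x|lebesgue. v x * partial b \<psi> x) = - (LINT x|lebesgue. (g x \<bullet> b) * \<psi> x))"

definition Q :: "('a::euclidean_space \<times> real) set" where
  "Q = UNIV \<times> {0<..}"

text \<open>\<open>u \<in> C((0,\<infinity>); L\<^sup>1\<^sub>l\<^sub>o\<^sub>c)\<close>, continuity being with respect to every seminorm
  \<open>\<parallel>\<cdot>\<parallel>\<close> of \<open>L\<^sup>1(K)\<close>, \<open>K\<close> compact.\<close>

definition continuous_L1_loc :: "('a::euclidean_space \<Rightarrow> real \<Rightarrow> real) \<Rightarrow> bool" where
  "continuous_L1_loc u \<longleftrightarrow>
     (\<forall>t>0. locally_integrable_on (\<lambda>x. u x t) UNIV) \<and>
     (\<forall>K. compact K \<longrightarrow>
        (\<forall>t>0. ((\<lambda>s. LINT x:K|lebesgue. \<bar>u x s - u x t\<bar>) \<longlongrightarrow> 0) (at t)))"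

text \<open>\<open>u \<in> L\<^sup>1\<^sub>l\<^sub>o\<^sub>c((0,\<infinity>); W\<^sup>1\<^sup>,\<^sup>1\<^sub>l\<^sub>o\<^sub>c)\<close> with spatial gradient \<open>g\<close>: by Fubini, integrability in
  time of the \<open>W\<^sup>1\<^sup>,\<^sup>1(K)\<close> norms is local integrability of \<open>u\<close> and \<open>g\<close> in space-time.\<close>

definition L1_loc_W11_loc ::
    "('a::euclidean_space \<Rightarrow> real \<Rightarrow> real) \<Rightarrow> ('a \<Rightarrow> real \<Rightarrow> 'a) \<Rightarrow> bool" where
  "L1_loc_W11_loc u g \<longleftrightarrow>
     (AE t in lebesgue. t > 0 \<longrightarrow> has_weak_gradient (\<lambda>x. u x t) (\<lambda>x. g x t)) \<and>
     locally_integrable_on (\<lambda>(x, t). u x t) Q \<and>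
     locally_integrable_on (\<lambda>(x, t). g x t) Q"

section \<open>Weak solutions\<close>

text \<open>The gradient \<open>g\<close> is determined by \<open>u\<close> up to a null set, so quantifying it
  existentially involves no choice.  Values \<open>u x t\<close> with \<open>t \<le> 0\<close> are irrelevant.\<close>

definition weak_solution ::
    "real \<Rightarrow> ('a::euclidean_space \<Rightarrow> real \<Rightarrow> real) \<Rightarrow> bool" where
  "weak_solution q u \<longleftrightarrow>
     (\<forall>x. \<forall>t>0. 0 \<le> u x t) \<and>
     continuous_L1_loc u \<and>
     (\<exists>g. L1_loc_W11_loc u g \<and>
        locally_integrable_on (\<lambda>(x, t). norm (g x t) powr q) Q \<and>
        (\<forall>\<phi>\<in>test_functions Q.
           (LINT t:{0<..}|lebesgue. (LINT x|lebesgue.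
              - u x t * time_deriv \<phi> (x, t) - u x t * space_laplacian \<phi> (x, t)
              + norm (g x t) powr q * \<phi> (x, t))) = 0))"

definition has_trace :: "('a::euclidean_space \<Rightarrow> real \<Rightarrow> real) \<Rightarrow> ('a \<Rightarrow> real) \<Rightarrow> bool" where
  "has_trace u u0 \<longleftrightarrow>
     locally_integrable_on u0 UNIV \<and>
     (\<forall>\<psi>. continuous_on UNIV \<psi> \<and> compact (supp \<psi>) \<longrightarrow>
        ((\<lambda>t. LINT x|lebesgue. u x t * \<psi> x) \<longlongrightarrow> (LINT x|lebesgue. \<psi> x * u0 x)) (at_right 0))"

definition cauchy_weak_solution ::
    "real \<Rightarrow> ('a::euclidean_space \<Rightarrow> real) \<Rightarrow> ('a \<Rightarrow> real \<Rightarrow> real) \<Rightarrow> bool" where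
  "cauchy_weak_solution q u0 u \<longleftrightarrow> weak_solution q u \<and> has_trace u u0"

section \<open>The stationary and the self-similar profiles\<close>

text \<open>\<open>|a|\<close> for \<open>a = (2 - q) / (q - 1)\<close> and \<open>q > 2\<close>.\<close>

definition abs_a :: "real \<Rightarrow> real" where
  "abs_a q = (q - 2) / (q - 1)"

definition C_tilde :: "nat \<Rightarrow> real \<Rightarrow> real" where
  "C_tilde N q =
     (q - 1) / (q - 2) * (((real N - 1) * q - real N) / (q - 1)) powr (1 / (q - 1))"

definition U_tilde :: "real \<Rightarrow> 'a::euclidean_space \<Rightarrow> real" where
  "U_tilde q x = C_tilde DIM('a) q * norm x powr abs_a q"

definition self_similar :: "real \<Rightarrow> (real \<Rightarrow> real) \<Rightarrow> 'a::euclidean_space \<Rightarrow> real \<Rightarrow> real" where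
  "self_similar q f x t = t powr (abs_a q / 2) * f (norm x / sqrt t)"

end

theory Submission
  imports Defs
begin

text \<open>
Put \<open>\<alpha> = abs_a q\<close>. A function \<open>u x t = t powr (\<alpha> / 2) * f (norm x / sqrt t)\<close> solves the equation
off the time axis exactly when the increasing profile \<open>f\<close> satisfies
\<open>f'' + ((N - 1) / \<eta> + \<eta> / 2) f' = \<alpha> / 2 f + f' powr q\<close> for \<open>\<eta> > 0\<close>. The stationary solution is the profile
\<open>U \<eta> = C_tilde N q * \<eta> powr \<alpha>\<close>, whose derivative \<open>V\<close> is infinite at \<open>0\<close>. A second solution with the same
trace comes from a profile with \<open>f 0 = A > 0\<close>, \<open>f' 0 = 0\<close> and \<open>U \<le> f \<le> U + A\<close>: this sandwich gives the
limit of \<open>\<eta> powr - \<alpha> * f \<eta>\<close>, and, after scaling, \<open>0 \<le> u x t - U (norm x) \<le> A * t powr (\<alpha> / 2)\<close>, so that the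
two solutions have the same initial trace.

Such a profile is found by shooting in \<open>A\<close> (\<open>connecting_profile_exists\<close>). The difference \<open>d = f - U\<close>
starts at \<open>A\<close> with slope \<open>-\<infinity>\<close> and, by the sign of the zeroth order term, cannot have a positive
interior maximum. So either \<open>d\<close> becomes negative while decreasing (small \<open>A\<close>), or \<open>d\<close> starts to
increase while positive (large \<open>A\<close>), or \<open>d\<close> stays positive and decreasing. The first two alternatives
are open in \<open>A\<close> and exclude each other, so connectedness of an interval yields an \<open>A\<close> of the third kind,
once tangential contact \<open>d = d' = 0\<close> is excluded (\<open>no_tangential_contact\<close>). As the nonlinearity is superlinear, the gradient
of a profile may blow up at a finite \<open>\<eta>\<close>; the shooting is therefore done for a truncated nonlinearity,
for which the solutions are global and Lipschitz in \<open>A\<close> (\<open>shooting_family_exists\<close>). The truncation is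
at the level of \<open>V\<close> except near \<open>0\<close>, hence inactive on the selected profile.

Both solutions are smooth off the time axis, with \<open>|grad u| \<le> V (norm x)\<close> and second derivatives
bounded by a multiple of \<open>norm x powr - (2 - \<alpha>)\<close>. As \<open>2 - \<alpha> < 2 \<le> N\<close>, these bounds are locally integrable
and the origin is invisible for integration by parts (\<open>integral_by_parts_singular\<close>). After
integrating by parts in space, the weak formulation reduces to the integral of the time derivative
of \<open>u * \<phi>\<close>, which vanishes (\<open>weak_equation\<close>).
\<close>

section \<open>Integration by parts across a point singularity\<close>

text \<open>On the dyadic shell with \<open>R / 2 ^ Suc k < norm x \<le> R / 2 ^ k\<close> the integrand is at most a constant times
\<open>2 powr (k * \<gamma>)\<close>, and the shell has measure at most a constant times \<open>2 powr - (k * DIM('a))\<close>; the resulting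
geometric series converges.\<close>
lemma integrable_norm_powr_cball:
  fixes \<gamma> R :: real
  assumes "0 \<le> \<gamma>" "\<gamma> < DIM('a::euclidean_space)"
  shows "integrable lborel (\<lambda>x::'a. indicator (cball 0 R) x * norm x powr - \<gamma>)"
proof (cases "R > 0")
  case False
  then have "(\<lambda>x::'a. indicator (cball 0 R) x * norm x powr - \<gamma>) = (\<lambda>x. 0)"
    by (auto simp: fun_eq_iff indicator_def)
      (metis norm_ge_zero norm_le_zero_iff not_less order_trans)
  then show ?thesis by simp
next
  case True
  define N where "N = DIM('a)"
  define c where "c = unit_ball_vol (real N)"
  define a where "a k = (R / 2 ^ Suc k) powr - \<gamma>" for k
  define B where "B k = cball (0::'a) (R / 2 ^ k)" for k
  define \<rho> where "\<rho> = (1/2) powr (real N - \<gamma>)"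
  have \<rho>: "0 < \<rho>" "\<rho> < 1"
    using assms powr_less_mono'[of "1/2" 0 "real N - \<gamma>"] by (auto simp: \<rho>_def N_def)
  have a_eq: "a k * (c * (R / 2 ^ k) ^ N) = ((R/2) powr - \<gamma> * c * R ^ N) * \<rho> ^ k" for k
  proof -
    have "a k = (R / 2) powr - \<gamma> * ((1/2) ^ k) powr - \<gamma>"
      unfolding a_def using True by (subst powr_mult[symmetric]) (auto simp: field_simps)
    also have "((1/2::real) ^ k) powr - \<gamma> = ((1/2) powr - \<gamma>) ^ k"
      by (simp add: powr_realpow[symmetric] powr_powr powr_power mult.commute)
    finally have 1: "a k = (R / 2) powr - \<gamma> * ((1/2) powr - \<gamma>) ^ k" .
    have "(R / 2 ^ k) ^ N = R ^ N * ((1/2) ^ N) ^ k"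
      by (simp add: power_divide field_simps power_mult[symmetric] mult.commute)
    moreover have "(1/2::real) ^ N = (1/2) powr real N" by (simp add: powr_realpow)
    moreover have "((1/2::real) powr - \<gamma>) ^ k * ((1/2) powr real N) ^ k = \<rho> ^ k"
      unfolding \<rho>_def by (simp add: power_mult_distrib[symmetric] powr_add[symmetric])
    ultimately show ?thesis unfolding 1 by (simp add: mult_ac)
  qed
  have "(\<integral>\<^sup>+x. ennreal (norm (indicator (cball (0::'a) R) x * norm x powr - \<gamma>)) \<partial>lborel)
     \<le> (\<integral>\<^sup>+x. (\<Sum>k. ennreal (a k) * indicator (B k) x) \<partial>lborel)"
  proof (rule nn_integral_mono)
    fix x :: 'a
    show "ennreal (norm (indicator (cball 0 R) x * norm x powr - \<gamma>)) \<le> (\<Sum>k. ennreal (a k) * indicator (B k) x)"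
    proof (cases "x \<noteq> 0 \<and> norm x \<le> R")
      case x: True
      have "\<exists>k. R / 2 ^ Suc k < norm x"
      proof -
        obtain k where "(1/2::real) ^ k < norm x / R"
          using real_arch_pow_inv[of "norm x / R" "1/2"] x True by auto
        then have "R / 2 ^ k < norm x" using True by (simp add: field_simps)
        moreover have "R / 2 ^ Suc k \<le> R / 2 ^ k" using True by (simp add: field_simps)
        ultimately show ?thesis by (intro exI[of _ k]) linarith
      qed
      then obtain k where k: "R / 2 ^ Suc k < norm x" and kl: "\<And>j. j < k \<Longrightarrow> \<not> R / 2 ^ Suc j < norm x"
        using exists_least_iff[of "\<lambda>k. R / 2 ^ Suc k < norm x"] by auto
      have xB: "norm x \<le> R / 2 ^ k"
      proof (cases k)
        case 0 then show ?thesis using x by simp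
      next
        case (Suc j) then show ?thesis using kl[of j] by simp
      qed
      have "norm x powr - \<gamma> \<le> a k"
        unfolding a_def using k True assms by (intro powr_mono2') auto
      then have "ennreal (norm (indicator (cball 0 R) x * norm x powr - \<gamma>)) \<le> ennreal (a k) * indicator (B k) x"
        using x xB by (auto simp: B_def indicator_def intro!: ennreal_leI)
      also have "\<dots> \<le> (\<Sum>k. ennreal (a k) * indicator (B k) x)"
      proof -
        define G where "G j = (ennreal (a j) * indicator (B j) x :: ennreal)" for j
        have "sum G {k} \<le> suminf G" by (rule sum_le_suminf) auto
        then have "G k \<le> suminf G" by simp
        then show ?thesis unfolding G_def .
      qed
      finally show ?thesis .
    qed (auto simp: indicator_def)
  qed
  also have "\<dots> = (\<Sum>k. ennreal (a k) * emeasure lborel (B k))"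
  proof -
    have [measurable]: "B k \<in> sets lborel" for k by (simp add: B_def)
    show ?thesis
      by (rule trans[OF nn_integral_suminf]) (measurable, intro suminf_cong nn_integral_cmult_indicator, measurable)
  qed
  also have "\<dots> = (\<Sum>k. ennreal (((R/2) powr - \<gamma> * c * R ^ N) * \<rho> ^ k))"
    unfolding a_eq[symmetric] using True
    by (intro suminf_cong)
      (simp add: B_def emeasure_cball c_def N_def a_def ennreal_mult)
  also have "\<dots> = ennreal (\<Sum>k. ((R/2) powr - \<gamma> * c * R ^ N) * \<rho> ^ k)"
    using \<rho> True by (intro suminf_ennreal2) (auto simp: c_def intro!: summable_mult)
  also have "\<dots> < \<infinity>" by simp
  finally have fin: "(\<integral>\<^sup>+x. ennreal (norm (indicator (cball (0::'a) R) x * norm x powr - \<gamma>)) \<partial>lborel) < \<infinity>" .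
  have [measurable]: "cball (0::'a) R \<in> sets lborel" by simp
  show ?thesis by (rule integrableI_bounded[OF _ fin]) measurable
qed

text \<open>Translation invariance of Lebesgue measure makes the integral of every difference quotient zero;
dominated convergence, with the Lipschitz constant as bound, passes to the limit. This replaces the
divergence theorem.\<close>
lemma integral_directional_derivative_eq_0:
  fixes F D :: "'a::euclidean_space \<Rightarrow> real" and b :: 'a
  assumes F: "F \<in> borel_measurable borel"
    and bd: "\<And>x. \<bar>F x\<bar> \<le> M" and lip: "\<And>x h. \<bar>F (x + h *\<^sub>R b) - F x\<bar> \<le> L * \<bar>h\<bar>"
    and supp: "\<And>x. norm x > R \<Longrightarrow> F x = 0"
    and D: "\<And>x. ((\<lambda>h. F (x + h *\<^sub>R b)) has_real_derivative D x) (at 0)"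
  shows "(LINT x|lborel. D x) = 0"
proof -
  define h where "h n = 1 / real (Suc n)" for n
  have h: "h n > 0" "h n \<le> 1" for n by (auto simp: h_def)
  have h0: "h \<longlonglongrightarrow> 0" unfolding h_def using LIMSEQ_inverse_real_of_nat by (simp add: inverse_eq_divide)
  have F[measurable]: "F \<in> borel_measurable lborel" using F by simp
  have ball: "integrable lborel (\<lambda>x::'a. indicator (cball 0 r) x :: real)" for r
    using emeasure_bounded_finite[of "cball (0::'a) r"]
    by (subst integrable_indicator_iff) auto
  have int: "integrable lborel F"
  proof (rule Bochner_Integration.integrable_bound)
    show "integrable lborel (\<lambda>x::'a. M * indicator (cball 0 R) x :: real)"
      using ball by simp
    have M: "M \<ge> 0" using bd[of 0] by linarith
    show "AE x in lborel. norm (F x) \<le> norm (M * indicator (cball 0 R) x :: real)"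
    proof (rule AE_I2)
      fix x :: 'a
      show "norm (F x) \<le> norm (M * indicator (cball 0 R) x :: real)"
        using bd[of x] supp[of x] M by (cases "norm x \<le> R") (auto simp: indicator_def)
    qed
  qed simp
  have shift: "integrable lborel (\<lambda>x. F (x + a))" "(LINT x|lborel. F (x + a)) = (LINT x|lborel. F x)" for a
  proof -
    have "integrable (distr lborel borel ((+) a)) F" using int by (simp add: lborel_distr_plus)
    then show "integrable lborel (\<lambda>x. F (x + a))"
      by (subst (asm) integrable_distr_eq) (auto simp: add.commute)
    have "(LINT x|lborel. F x) = (LINT x|distr lborel borel ((+) a). F x)" by (simp add: lborel_distr_plus)
    also have "\<dots> = (LINT x|lborel. F (a + x))" by (subst integral_distr) auto
    finally show "(LINT x|lborel. F (x + a)) = (LINT x|lborel. F x)" by (simp add: add.commute)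
  qed
  define s where "s n x = (F (x + h n *\<^sub>R b) - F x) / h n" for n x
  have s0: "(LINT x|lborel. s n x) = 0" for n
    unfolding s_def using shift int by simp
  have sD: "(\<lambda>n. s n x) \<longlonglongrightarrow> D x" for x
  proof -
    have "((\<lambda>h. (F (x + h *\<^sub>R b) - F x) / h) \<longlongrightarrow> D x) (at 0)"
      using D[of x] unfolding DERIV_def by simp
    then show ?thesis unfolding s_def
      by (rule filterlim_compose) (use h h0 in \<open>auto simp: filterlim_at intro!: always_eventually less_imp_neq[symmetric]\<close>)
  qed
  have sm[measurable]: "s n \<in> borel_measurable lborel" for n unfolding s_def by measurable
  have Dm: "D \<in> borel_measurable lborel"
    using sD by (rule borel_measurable_LIMSEQ_real) simp
  have L: "L \<ge> 0" using lip[of 0 1] by simp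
  have "(\<lambda>n. LINT x|lborel. s n x) \<longlonglongrightarrow> (LINT x|lborel. D x)"
  proof (rule integral_dominated_convergence)
    show "integrable lborel (\<lambda>x::'a. L * indicator (cball 0 (R + norm b)) x :: real)"
      using ball by simp
    show "AE x in lborel. (\<lambda>n. s n x) \<longlonglongrightarrow> D x" using sD by simp
    show "AE x in lborel. norm (s n x) \<le> L * indicator (cball 0 (R + norm b)) x" for n
    proof (rule AE_I2)
      fix x
      show "norm (s n x) \<le> L * indicator (cball 0 (R + norm b)) x"
      proof (cases "norm x \<le> R + norm b")
        case True
        then show ?thesis using lip[of x "h n"] h[of n] L
          by (auto simp: s_def indicator_def field_simps)
      next
        case False
        have "norm (h n *\<^sub>R b) \<le> norm b" using h[of n] by (auto intro: mult_left_le_one_le)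
        then have "norm x \<le> norm (x + h n *\<^sub>R b) + norm b"
          using norm_triangle_ineq4[of "x + h n *\<^sub>R b" "h n *\<^sub>R b"] by simp
        then have "norm (x + h n *\<^sub>R b) > R" using False by linarith
        moreover have "norm x > R" using False norm_ge_zero[of b] by linarith
        ultimately show ?thesis using supp L by (simp add: s_def)
      qed
    qed
  qed (use Dm in simp_all)
  then show ?thesis using s0 LIMSEQ_unique[of "\<lambda>n. 0::real"] by auto
qed

lemma has_real_derivative_pos_part_square:
  "((\<lambda>y::real. (max 0 y)\<^sup>2) has_real_derivative 2 * max 0 y) (at y)"
proof -
  consider "y > 0" | "y < 0" | "y = 0" by linarith
  then show ?thesis
  proof cases
    case 1
    have "((\<lambda>y::real. y\<^sup>2) has_real_derivative 2 * max 0 y) (at y)"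
      using 1 by (auto intro!: derivative_eq_intros)
    then show ?thesis
      by (rule has_field_derivative_transform_within_open[where S="{0<..}"]) (use 1 in auto)
  next
    case 2
    have "((\<lambda>y::real. 0) has_real_derivative 2 * max 0 y) (at y)"
      using 2 by (auto intro!: derivative_eq_intros)
    then show ?thesis
      by (rule has_field_derivative_transform_within_open[where S="{..<0}"]) (use 2 in auto)
  next
    case 3
    have "((\<lambda>h::real. (max 0 h)\<^sup>2 / h) \<longlongrightarrow> 0) (at 0)"
    proof (rule Lim_null_comparison)
      show "\<forall>\<^sub>F h in at (0::real). norm ((max 0 h)\<^sup>2 / h) \<le> \<bar>h\<bar>"
        by (intro always_eventually) (auto simp: max_def power2_eq_square)
      show "((\<lambda>h::real. \<bar>h\<bar>) \<longlongrightarrow> 0) (at 0)" by (intro tendsto_rabs_zero tendsto_ident_at)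
    qed
    then show ?thesis using 3 by (simp add: DERIV_def)
  qed
qed

lemma norm_has_line_derivative:
  fixes x b :: "'a::euclidean_space"
  assumes "x \<noteq> 0"
  shows "((\<lambda>h. norm (x + h *\<^sub>R b)) has_real_derivative (x \<bullet> b) / norm x) (at 0)"
proof -
  have pos: "x \<bullet> x > 0" using assms by simp
  have "((\<lambda>h. sqrt (x \<bullet> x + 2 * h * (x \<bullet> b) + h\<^sup>2 * (b \<bullet> b))) has_real_derivative (x \<bullet> b) / norm x) (at 0)"
    using pos by (auto intro!: derivative_eq_intros simp: norm_eq_sqrt_inner field_simps simp del: inner_gt_zero_iff)
  moreover have "norm (x + h *\<^sub>R b) = sqrt (x \<bullet> x + 2 * h * (x \<bullet> b) + h\<^sup>2 * (b \<bullet> b))" for h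
    by (simp add: norm_eq_sqrt_inner inner_add_left inner_add_right inner_commute algebra_simps power2_eq_square)
  ultimately show ?thesis by simp
qed

text \<open>Supplies the Lipschitz hypothesis of \<open>integral_directional_derivative_eq_0\<close>.\<close>
lemma line_derivative_imp_lipschitz:
  fixes F D :: "'a::euclidean_space \<Rightarrow> real"
  assumes D: "\<And>x. ((\<lambda>h. F (x + h *\<^sub>R b)) has_real_derivative D x) (at 0)"
    and L: "\<And>x. \<bar>D x\<bar> \<le> L"
  shows "\<bar>F (x + h *\<^sub>R b) - F x\<bar> \<le> L * \<bar>h\<bar>"
proof -
  have "((\<lambda>h. F (x + h *\<^sub>R b)) has_real_derivative D (x + s *\<^sub>R b)) (at s)" for s
    using D[of "x + s *\<^sub>R b"] DERIV_shift[of "\<lambda>h. F (x + h *\<^sub>R b)" "D (x + s *\<^sub>R b)" 0 s]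
    by (simp add: algebra_simps)
  then have "norm (F (x + h *\<^sub>R b) - F (x + 0 *\<^sub>R b)) \<le> L * norm (h - 0)"
    using L by (intro field_differentiable_bound[of UNIV _ "\<lambda>s. D (x + s *\<^sub>R b)"])
      (auto)
  then show ?thesis by simp
qed

lemma line_derivative_vanish:
  fixes \<psi> :: "'a::euclidean_space \<Rightarrow> real"
  assumes "\<And>x. norm x > R \<Longrightarrow> \<psi> x = 0" "norm x > R"
    and "((\<lambda>h. \<psi> (x + h *\<^sub>R b)) has_real_derivative D) (at 0)"
  shows "D = 0"
proof -
  have "((\<lambda>h. 0) has_real_derivative D) (at 0)"
  proof (rule has_field_derivative_transform_within_open[OF assms(3), where S="{h. norm (x + h *\<^sub>R b) > R}"])
    show "open {h. norm (x + h *\<^sub>R b) > R}" by (intro open_Collect_less continuous_intros)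
  qed (use assms in auto)
  then show ?thesis using DERIV_unique[OF _ DERIV_const[of 0]] by blast
qed

text \<open>The product \<open>v * \<psi>\<close> is multiplied by the cutoff \<open>(max 0 (1 - \<epsilon> / norm x))\<^sup>2\<close>, which is continuously
differentiable and vanishes near \<open>0\<close>. The gradient of the cutoff is at most \<open>2 / norm x\<close> for every \<open>\<epsilon>\<close>
and tends to \<open>0\<close> pointwise, so the error term is dominated by a multiple of the integrable function
\<open>norm x powr - \<gamma>\<close> and disappears as \<open>\<epsilon>\<close> tends to \<open>0\<close>.\<close>
lemma integral_by_parts_singular:
  fixes v dv \<psi> d\<psi> :: "'a::euclidean_space \<Rightarrow> real" and b :: 'a and \<gamma> R C :: real
  assumes \<gamma>: "1 \<le> \<gamma>" "\<gamma> < DIM('a)" and b: "norm b \<le> 1"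
    and cont: "continuous_on (-{0}) v" "continuous_on (-{0}) dv" "continuous_on UNIV \<psi>" "continuous_on UNIV d\<psi>"
    and dv: "\<And>x. x \<noteq> 0 \<Longrightarrow> ((\<lambda>h. v (x + h *\<^sub>R b)) has_real_derivative dv x) (at 0)"
    and d\<psi>: "\<And>x. ((\<lambda>h. \<psi> (x + h *\<^sub>R b)) has_real_derivative d\<psi> x) (at 0)"
    and vb: "\<And>x. x \<noteq> 0 \<Longrightarrow> norm x \<le> R \<Longrightarrow> \<bar>v x\<bar> \<le> C * norm x powr (1 - \<gamma>)"
    and dvb: "\<And>x. x \<noteq> 0 \<Longrightarrow> norm x \<le> R \<Longrightarrow> \<bar>dv x\<bar> \<le> C * norm x powr - \<gamma>"
    and supp: "\<And>x. norm x > R \<Longrightarrow> \<psi> x = 0"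
  shows "integrable lborel (\<lambda>x. v x * d\<psi> x)" "integrable lborel (\<lambda>x. dv x * \<psi> x)"
    "(LINT x|lborel. v x * d\<psi> x) = - (LINT x|lborel. dv x * \<psi> x)"
proof -
  have supp': "d\<psi> x = 0" if "norm x > R" for x
    using line_derivative_vanish[OF supp that d\<psi>] .
  obtain P where P: "\<And>x. \<bar>\<psi> x\<bar> \<le> P" "\<And>x. \<bar>d\<psi> x\<bar> \<le> P" "P \<ge> 0"
  proof -
    have "compact (\<psi> ` cball 0 R)" "compact (d\<psi> ` cball 0 R)"
      using cont by (auto intro!: compact_continuous_image intro: continuous_on_subset)
    then have "bounded (\<psi> ` cball 0 R)" "bounded (d\<psi> ` cball 0 R)" by (auto intro: compact_imp_bounded)
    then obtain P1 P2 where p: "P1 > 0" "P2 > 0" "\<And>x. norm x \<le> R \<Longrightarrow> \<bar>\<psi> x\<bar> \<le> P1" "\<And>x. norm x \<le> R \<Longrightarrow> \<bar>d\<psi> x\<bar> \<le> P2"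
      by (auto simp: bounded_pos)
    show ?thesis
    proof (rule that[of "max P1 P2"])
      show "\<bar>\<psi> x\<bar> \<le> max P1 P2" for x using p(1,2) p(3)[of x] supp[of x] by (cases "norm x \<le> R") auto
      show "\<bar>d\<psi> x\<bar> \<le> max P1 P2" for x using p(1,2) p(4)[of x] supp'[of x] by (cases "norm x \<le> R") auto
    qed (use p in auto)
  qed
  define C' where "C' = max C 0"
  have C': "C' \<ge> 0" by (simp add: C'_def)
  have vb': "\<bar>v x\<bar> \<le> C' * norm x powr (1 - \<gamma>)" if "x \<noteq> 0" "norm x \<le> R" for x
    by (rule order_trans[OF vb[OF that]]) (auto simp: C'_def intro!: mult_right_mono)
  have dvb': "\<bar>dv x\<bar> \<le> C' * norm x powr - \<gamma>" if "x \<noteq> 0" "norm x \<le> R" for x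
    by (rule order_trans[OF dvb[OF that]]) (auto simp: C'_def intro!: mult_right_mono)
  have pw: "norm x powr (1 - \<gamma>) = norm x * norm x powr - \<gamma>" if "x \<noteq> 0" for x :: 'a
    using that by (simp add: powr_diff powr_minus divide_inverse)
  define bnd where "bnd x = indicator (cball 0 R) x * norm x powr - \<gamma>" for x :: 'a
  have bnd: "integrable lborel bnd" "\<And>x. bnd x \<ge> 0"
    using integrable_norm_powr_cball[where 'a='a, of \<gamma> R] \<gamma> by (auto simp: bnd_def[abs_def])
  have b1: "\<bar>v x * d\<psi> x\<bar> \<le> (C' * P * max R 0) * bnd x" if "x \<noteq> 0" for x
  proof (cases "norm x \<le> R")
    case True
    have "\<bar>v x * d\<psi> x\<bar> \<le> (C' * norm x powr (1 - \<gamma>)) * P"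
      unfolding abs_mult using vb' P that True C' by (intro mult_mono) auto
    also have "\<dots> = C' * P * norm x powr - \<gamma> * norm x" using pw[OF that] by simp
    also have "\<dots> \<le> C' * P * norm x powr - \<gamma> * max R 0"
      using True C' P by (intro mult_left_mono) auto
    finally show ?thesis using True by (simp add: bnd_def mult_ac)
  next
    case False then show ?thesis using supp'[of x] C' P bnd by simp
  qed
  have b2: "\<bar>dv x * \<psi> x\<bar> \<le> (C' * P) * bnd x" if "x \<noteq> 0" for x
  proof (cases "norm x \<le> R")
    case True
    have "\<bar>dv x * \<psi> x\<bar> \<le> (C' * norm x powr - \<gamma>) * P"
      unfolding abs_mult using dvb' P that True C' by (intro mult_mono) auto
    then show ?thesis using True by (simp add: bnd_def mult_ac)
  next
    case False then show ?thesis using supp[of x] C' P bnd by simp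
  qed
  have b3: "\<bar>v x * \<psi> x\<bar> \<le> (C' * P) * (norm x * bnd x)" if "x \<noteq> 0" for x
  proof (cases "norm x \<le> R")
    case True
    have "\<bar>v x * \<psi> x\<bar> \<le> (C' * norm x powr (1 - \<gamma>)) * P"
      unfolding abs_mult using vb' P that True C' by (intro mult_mono) auto
    then show ?thesis using True pw[OF that] by (simp add: bnd_def mult_ac)
  next
    case False then show ?thesis using supp[of x] C' P bnd by simp
  qed
  have meas[measurable]: "v \<in> borel_measurable borel" "dv \<in> borel_measurable borel"
    "\<psi> \<in> borel_measurable borel" "d\<psi> \<in> borel_measurable borel"
    using cont by (auto intro: borel_measurable_continuous_countable_exceptions[of "{0}"] borel_measurable_continuous_onI)
  have ae: "AE x::'a in lborel. x \<noteq> 0"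
    by (rule AE_lborel_singleton)
  show i1: "integrable lborel (\<lambda>x. v x * d\<psi> x)"
  proof (rule Bochner_Integration.integrable_bound)
    show "integrable lborel (\<lambda>x. (C' * P * max R 0) * bnd x)" using bnd by simp
    show "AE x in lborel. norm (v x * d\<psi> x) \<le> norm ((C' * P * max R 0) * bnd x)"
      using ae by eventually_elim (use b1 in \<open>fastforce intro: order_trans\<close>)
  qed measurable
  show i2: "integrable lborel (\<lambda>x. dv x * \<psi> x)"
  proof (rule Bochner_Integration.integrable_bound)
    show "integrable lborel (\<lambda>x. (C' * P) * bnd x)" using bnd by simp
    show "AE x in lborel. norm (dv x * \<psi> x) \<le> norm ((C' * P) * bnd x)"
      using ae by eventually_elim (use b2 in \<open>fastforce intro: order_trans\<close>)
  qed measurable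
  define cut where "cut e x = (max 0 (1 - e / norm x))\<^sup>2" for e :: real and x :: 'a
  define dcut where "dcut e x = 2 * max 0 (1 - e / norm x) * (e * ((x \<bullet> b) / norm x) / (norm x)\<^sup>2)" for e and x :: 'a
  define D where "D e x = (if x = 0 then 0 else dcut e x * (v x * \<psi> x) + cut e x * (dv x * \<psi> x + v x * d\<psi> x))" for e x
  define F where "F e x = (if x = 0 then 0 else cut e x * v x * \<psi> x)" for e x
  define K where "K = C' * P * (3 + max R 0)"
  have cut0: "cut e x = 0" "dcut e x = 0" if "norm x \<le> e" "x \<noteq> 0" for e x
    using that by (auto simp: cut_def dcut_def max_def field_simps)
  have cut1: "0 \<le> cut e x" "cut e x \<le> 1" if "0 < e" for e x
    using that by (auto simp: cut_def max_def intro!: power_le_one)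
  \<comment> \<open>Where the cutoff is positive, \<open>e < norm x\<close>, so \<open>e / (norm x)\<^sup>2 \<le> 1 / norm x\<close>.\<close>
  have dcut1: "\<bar>dcut e x\<bar> * norm x \<le> 2" if "0 < e" "x \<noteq> 0" for e x
  proof (cases "norm x \<le> e")
    case True then show ?thesis using cut0 that by simp
  next
    case False
    have "\<bar>x \<bullet> b\<bar> \<le> norm x" using Cauchy_Schwarz_ineq2[of x b] b
      by (meson mult_left_le norm_ge_zero order_trans)
    then have q: "\<bar>(x \<bullet> b) / norm x\<bar> \<le> 1" using that by (simp add: abs_divide)
    have m: "\<bar>2 * max 0 (1 - e / norm x)\<bar> \<le> 2"
    proof -
      have "0 \<le> e / norm x" using that by simp
      then have "0 \<le> max 0 (1 - e / norm x)" "max 0 (1 - e / norm x) \<le> 1" by auto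
      then show ?thesis by (simp del: max.bounded_iff)
    qed
    have "\<bar>dcut e x\<bar> * norm x = \<bar>2 * max 0 (1 - e / norm x)\<bar> * (\<bar>(x \<bullet> b) / norm x\<bar> * (e / norm x))"
      using that unfolding dcut_def abs_mult abs_divide by (simp add: power2_eq_square)
    also have "\<dots> \<le> 2 * (1 * 1)"
      using q m that False by (intro mult_mono) auto
    finally show ?thesis by simp
  qed
  have Db: "\<bar>D e x\<bar> \<le> K * bnd x" if "0 < e" for e x
  proof (cases "x = 0")
    case True then show ?thesis using C' P bnd by (simp add: D_def K_def)
  next
    case False
    have "\<bar>dcut e x * (v x * \<psi> x)\<bar> \<le> \<bar>dcut e x\<bar> * ((C' * P) * (norm x * bnd x))"
      unfolding abs_mult[of "dcut e x"] using b3[OF False] by (intro mult_left_mono) auto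
    also have "\<dots> = (\<bar>dcut e x\<bar> * norm x) * (C' * P * bnd x)" by simp
    also have "\<dots> \<le> 2 * (C' * P * bnd x)"
      using dcut1[OF that False] C' P bnd by (intro mult_right_mono) auto
    finally have 1: "\<bar>dcut e x * (v x * \<psi> x)\<bar> \<le> 2 * (C' * P * bnd x)" .
    have "\<bar>cut e x * (dv x * \<psi> x + v x * d\<psi> x)\<bar> \<le> 1 * (C' * P * bnd x + C' * P * max R 0 * bnd x)"
      unfolding abs_mult[of "cut e x"] using cut1[OF that, of x] b1[OF False] b2[OF False]
      by (intro mult_mono) (auto intro!: order_trans[OF abs_triangle_ineq])
    then show ?thesis using False 1 unfolding D_def K_def
      by (auto intro!: order_trans[OF abs_triangle_ineq] simp: algebra_simps)
  qed
  have int0: "(LINT x|lborel. D e x) = 0" if e: "0 < e" for e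
  proof (rule integral_directional_derivative_eq_0[where F="F e" and b=b and R=R])
    show "F e \<in> borel_measurable borel" unfolding F_def[abs_def] cut_def by measurable
    show "norm x > R \<Longrightarrow> F e x = 0" for x using supp by (simp add: F_def)
    show Dd: "((\<lambda>h. F e (x + h *\<^sub>R b)) has_real_derivative D e x) (at 0)" for x
    proof (cases "x = 0")
      case True
      have "((\<lambda>h. 0) has_real_derivative D e x) (at 0)" using True by (simp add: D_def)
      then show ?thesis
      proof (rule has_field_derivative_transform_within_open[where S="{h. norm (x + h *\<^sub>R b) < e}"])
        show "open {h. norm (x + h *\<^sub>R b) < e}" by (intro open_Collect_less continuous_intros)
      next
        fix h assume "h \<in> {h. norm (x + h *\<^sub>R b) < e}"
        then show "0 = F e (x + h *\<^sub>R b)" using cut0(1)[of "x + h *\<^sub>R b" e] by (auto simp: F_def)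
      qed (use True e in auto)
    next
      case False
      have "((\<lambda>h. 1 - e / norm (x + h *\<^sub>R b)) has_real_derivative (e * ((x \<bullet> b) / norm x) / (norm x)\<^sup>2)) (at 0)"
        using False norm_has_line_derivative[OF False, of b]
        by (auto intro!: derivative_eq_intros simp: power2_eq_square)
      from DERIV_chain2[OF has_real_derivative_pos_part_square this]
      have "((\<lambda>h. cut e (x + h *\<^sub>R b)) has_real_derivative dcut e x) (at 0)"
        unfolding cut_def dcut_def by simp
      then have "((\<lambda>h. cut e (x + h *\<^sub>R b) * v (x + h *\<^sub>R b) * \<psi> (x + h *\<^sub>R b)) has_real_derivative D e x) (at 0)"
        using dv[OF False] d\<psi>[of x] False
        by (auto intro!: derivative_eq_intros simp: D_def algebra_simps)
      then show ?thesis
      proof (rule has_field_derivative_transform_within_open[where S="{h. x + h *\<^sub>R b \<noteq> 0}"])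
        show "open {h. x + h *\<^sub>R b \<noteq> 0}" by (intro open_Collect_neq continuous_intros)
      qed (use False in \<open>auto simp: F_def\<close>)
    qed
    have Dl: "\<bar>D e x\<bar> \<le> K * e powr - \<gamma>" for x
    proof (cases "norm x \<le> e")
      case True then show ?thesis using cut0[OF True] C' P by (simp add: D_def K_def)
    next
      case False
      have "bnd x \<le> e powr - \<gamma>"
        using False e \<gamma> powr_mono2'[of "- \<gamma>" e "norm x"] by (auto simp: bnd_def indicator_def)
      then have "K * bnd x \<le> K * e powr - \<gamma>" using C' P by (intro mult_left_mono) (auto simp: K_def)
      then show ?thesis using Db[OF e, of x] by linarith
    qed
    show "\<bar>F e (x + h *\<^sub>R b) - F e x\<bar> \<le> K * e powr - \<gamma> * \<bar>h\<bar>" for x h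
      by (rule line_derivative_imp_lipschitz[where F="F e", OF Dd Dl])
    show "\<bar>F e x\<bar> \<le> C' * P * e powr (1 - \<gamma>)" for x
    proof (cases "norm x \<le> e \<or> norm x > R")
      case True then show ?thesis using cut0[of x e] C' P supp[of x] by (auto simp: F_def)
    next
      case False
      then have "x \<noteq> 0" using e by auto
      have "\<bar>v x * \<psi> x\<bar> \<le> (C' * norm x powr (1 - \<gamma>)) * P"
        unfolding abs_mult using vb' P C' \<open>x \<noteq> 0\<close> False by (intro mult_mono) auto
      also have "\<dots> \<le> (C' * e powr (1 - \<gamma>)) * P"
        using False e \<gamma> C' P by (intro mult_right_mono mult_left_mono powr_mono2') auto
      finally have "\<bar>cut e x\<bar> * \<bar>v x * \<psi> x\<bar> \<le> 1 * (C' * P * e powr (1 - \<gamma>))"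
        using cut1[OF e, of x] by (intro mult_mono) (auto simp: mult_ac)
      then show ?thesis using \<open>x \<noteq> 0\<close> by (simp add: F_def abs_mult mult_ac)
    qed
  qed
  define en where "en n = 1 / real (Suc n)" for n
  have "(\<lambda>n. LINT x|lborel. D (en n) x) \<longlonglongrightarrow> (LINT x|lborel. dv x * \<psi> x + v x * d\<psi> x)"
  proof (rule integral_dominated_convergence)
    show "integrable lborel (\<lambda>x. K * bnd x)" using bnd by simp
    show "AE x in lborel. norm (D (en n) x) \<le> K * bnd x" for n
      using Db[of "en n"] by (simp add: en_def)
    show "AE x in lborel. (\<lambda>n. D (en n) x) \<longlonglongrightarrow> dv x * \<psi> x + v x * d\<psi> x"
      using ae
    proof eventually_elim
      fix x :: 'a assume x: "x \<noteq> 0"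
      have n0: "en \<longlonglongrightarrow> 0" unfolding en_def
        using LIMSEQ_inverse_real_of_nat by (simp add: inverse_eq_divide)
      have m: "(\<lambda>n. max 0 (1 - en n / norm x)) \<longlonglongrightarrow> max 0 (1 - 0 / norm x)"
        using x by (intro tendsto_intros n0) auto
      then have "(\<lambda>n. cut (en n) x) \<longlonglongrightarrow> (max 0 (1 - 0 / norm x))\<^sup>2" unfolding cut_def by (rule tendsto_power)
      moreover have "(\<lambda>n. dcut (en n) x) \<longlonglongrightarrow> 2 * max 0 (1 - 0 / norm x) * (0 * ((x \<bullet> b) / norm x) / (norm x)\<^sup>2)"
        unfolding dcut_def using x by (intro tendsto_intros m n0) auto
      ultimately have "(\<lambda>n. dcut (en n) x * (v x * \<psi> x) + cut (en n) x * (dv x * \<psi> x + v x * d\<psi> x))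
          \<longlonglongrightarrow> 0 * (v x * \<psi> x) + 1 * (dv x * \<psi> x + v x * d\<psi> x)"
        by (intro tendsto_intros) simp_all
      then show "(\<lambda>n. D (en n) x) \<longlonglongrightarrow> dv x * \<psi> x + v x * d\<psi> x"
        using x by (simp add: D_def)
    qed
    show "D (en n) \<in> borel_measurable lborel" for n unfolding D_def[abs_def] cut_def dcut_def by measurable
  qed measurable
  then have "(LINT x|lborel. dv x * \<psi> x + v x * d\<psi> x) = 0"
    using int0[of "en n" for n] LIMSEQ_unique[of "\<lambda>n. 0::real"] by (auto simp: en_def)
  then show "(LINT x|lborel. v x * d\<psi> x) = - (LINT x|lborel. dv x * \<psi> x)"
    using i1 i2 by simp
qed

section \<open>The profile equation and its truncation\<close>

lemma powr_lipschitz: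
  fixes q M :: real
  assumes "1 \<le> q" "0 \<le> a" "a \<le> M" "0 \<le> b" "b \<le> M"
  shows "\<bar>a powr q - b powr q\<bar> \<le> q * M powr (q - 1) * \<bar>a - b\<bar>"
proof -
  have *: "\<bar>a powr q - b powr q\<bar> \<le> q * M powr (q - 1) * \<bar>a - b\<bar>" if "a < b" "0 \<le> a" "b \<le> M" for a b
  proof -
    have "\<exists>l z. a < z \<and> z < b \<and> ((\<lambda>t. t powr q) has_real_derivative l) (at z) \<and> b powr q - a powr q = (b - a) * l"
    proof (rule MVT)
      show "continuous_on {a..b} (\<lambda>t. t powr q)" using that assms by (intro continuous_intros continuous_on_powr') auto
      show "(\<lambda>t. t powr q) differentiable (at x)" if "a < x" "x < b" for x
        using that \<open>0 \<le> a\<close> by (intro differentiableI[where f'="\<lambda>h. h * (q * x powr (q - 1))"])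
          (auto simp: has_field_derivative_def[symmetric] mult.commute[of _ "_ * _"] intro!: derivative_eq_intros)
    qed fact
    then obtain l z where z: "a < z" "z < b" "((\<lambda>t. t powr q) has_real_derivative l) (at z)" "b powr q - a powr q = (b - a) * l" by blast
    have "((\<lambda>t. t powr q) has_real_derivative q * z powr (q - 1)) (at z)"
      using z(1) that by (auto intro!: derivative_eq_intros)
    then have l: "l = q * z powr (q - 1)" using z(3) DERIV_unique by blast
    have "z powr (q - 1) \<le> M powr (q - 1)" using z that assms by (intro powr_mono2) auto
    then have "0 \<le> l" "l \<le> q * M powr (q - 1)" using l assms by (auto intro!: mult_left_mono)
    then have "\<bar>(b - a) * l\<bar> \<le> (b - a) * (q * M powr (q - 1))" using that by (auto simp: abs_mult intro!: mult_left_mono)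
    then show ?thesis using z(4) that by (simp add: abs_minus_commute mult_ac)
  qed
  show ?thesis using *[of a b] *[of b a] assms by (cases a b rule: linorder_cases) (auto simp: abs_minus_commute)
qed

lemma continuous_on_integral_upto_pos_part:
  fixes F :: "real \<Rightarrow> real"
  assumes "continuous_on UNIV F"
  shows "continuous_on UNIV (\<lambda>s. integral {0..max 0 s} F)"
proof -
  have "continuous_on {..<b} (\<lambda>s. integral {0..max 0 s} F)" for b
  proof -
    have "continuous_on {0..max 0 b} (\<lambda>s. integral {0..s} F)"
      by (intro indefinite_integral_continuous_1 integrable_continuous_interval continuous_on_subset[OF assms]) auto
    then show ?thesis by (rule continuous_on_compose2) (auto intro!: continuous_intros)
  qed
  from this[of "s+1" for s] have "isCont (\<lambda>s. integral {0..max 0 s} F) s" for s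
    using continuous_on_eq_continuous_at[OF open_lessThan, of "s+1" "\<lambda>s. integral {0..max 0 s} F"] by auto
  then show ?thesis by (simp add: continuous_on_eq_continuous_at)
qed

lemma integral_upto_has_derivative:
  fixes F :: "real \<Rightarrow> real"
  assumes "continuous_on UNIV F" "0 < s"
  shows "((\<lambda>s. integral {0..s} F) has_real_derivative F s) (at s)"
proof -
  have "((\<lambda>s. integral {0..s} F) has_real_derivative F s) (at s within {0..s+1})"
    by (rule integral_has_real_derivative) (use assms in \<open>auto intro: continuous_on_subset\<close>)
  then show ?thesis using assms by (simp add: at_within_Icc_at)
qed

lemma integral_exp_mult_le:
  fixes l s :: real
  assumes "l > 0" "0 \<le> s"
  shows "integral {0..s} (\<lambda>r. B * exp (l * r)) = B / l * (exp (l * s) - 1)"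
proof -
  have "((\<lambda>r. B * exp (l * r)) has_integral (B / l * exp (l * s) - B / l * exp (l * 0))) {0..s}"
    using assms by (intro fundamental_theorem_of_calculus)
      (auto simp: has_real_derivative_iff_has_vector_derivative[symmetric] intro!: derivative_eq_intros)
  from integral_unique[OF this] show ?thesis by (simp only: right_diff_distrib) simp
qed

text \<open>Within this locale \<open>U\<close> is the stationary profile and \<open>V\<close> its derivative. The constant \<open>\<kappa>\<close> is tuned so that
\<open>\<kappa> powr (q - 1) = N - 2 + \<alpha>\<close>, which is what makes \<open>U\<close> a solution of the profile equation.\<close>
locale profile_equation =
  fixes q :: real and N :: nat
  assumes q: "q > 2" and N: "N \<ge> 2"
begin

definition \<alpha> :: real where "\<alpha> = abs_a q"
definition \<kappa> :: real where "\<kappa> = \<alpha> * C_tilde N q"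
definition U :: "real \<Rightarrow> real" where "U r = C_tilde N q * r powr \<alpha>"
definition V :: "real \<Rightarrow> real" where "V r = \<kappa> * r powr (\<alpha> - 1)"

lemma \<alpha>: "0 < \<alpha>" "\<alpha> < 1" "(\<alpha> - 1) * (q - 1) = - 1" "(\<alpha> - 1) * q = \<alpha> - 2"
  using q by (auto simp: \<alpha>_def abs_a_def field_simps)

lemma \<kappa>: "0 < \<kappa>" "\<kappa> powr (q - 1) = real N - 2 + \<alpha>" "C_tilde N q = \<kappa> / \<alpha>"
proof -
  have e: "((real N - 1) * q - real N) / (q - 1) = real N - 2 + \<alpha>"
    using q by (simp add: \<alpha>_def abs_a_def field_simps)
  have p: "real N - 2 + \<alpha> > 0" using N \<alpha> by linarith
  have k: "\<kappa> = (real N - 2 + \<alpha>) powr (1 / (q - 1))"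
    unfolding \<kappa>_def C_tilde_def e using q by (simp add: \<alpha>_def abs_a_def)
  show "0 < \<kappa>" using p k by simp
  show "\<kappa> powr (q - 1) = real N - 2 + \<alpha>" unfolding k powr_powr using q p by simp
  show "C_tilde N q = \<kappa> / \<alpha>" using \<alpha> by (simp add: \<kappa>_def)
qed

lemma C_tilde_pos: "0 < C_tilde N q"
  using \<alpha> \<kappa> by simp

lemma V_pos: "0 < r \<Longrightarrow> 0 < V r" and U_nonneg: "0 \<le> U r"
  using \<kappa>(1) less_imp_le[OF C_tilde_pos] by (simp_all add: V_def U_def)

lemma V_powr: "0 < r \<Longrightarrow> V r powr (q - 1) = (real N - 2 + \<alpha>) / r"
  using \<kappa> \<alpha>(3) by (simp add: V_def powr_mult powr_powr powr_minus_divide)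

lemma V_powr_q: "0 < r \<Longrightarrow> V r powr q = \<kappa> powr q * r powr (\<alpha> - 2)"
  using \<kappa> \<alpha>(4) by (simp add: V_def powr_mult powr_powr)

lemma U_has_derivative: "0 < r \<Longrightarrow> (U has_real_derivative V r) (at r)"
  unfolding U_def[abs_def] V_def using \<alpha> \<kappa> by (auto intro!: derivative_eq_intros simp: \<kappa>(3))

lemma V_has_derivative:
  assumes "0 < r"
  shows "(V has_real_derivative \<alpha> / 2 * U r + V r powr q - ((real N - 1) / r + r / 2) * V r) (at r)"
proof -
  have "(V has_real_derivative \<kappa> * ((\<alpha> - 1) * r powr (\<alpha> - 2))) (at r)"
    unfolding V_def[abs_def] using assms by (auto intro!: derivative_eq_intros)
  moreover have "\<kappa> * ((\<alpha> - 1) * r powr (\<alpha> - 2)) = \<alpha> / 2 * U r + V r powr q - ((real N - 1) / r + r / 2) * V r"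
  proof -
    have 1: "r powr (\<alpha> - 1) = r * r powr (\<alpha> - 2)" "r powr \<alpha> = r * (r * r powr (\<alpha> - 2))"
      using assms powr_add[of r 1 "\<alpha> - 2"] powr_add[of r 2 "\<alpha> - 2"] by (auto simp: power2_eq_square powr_numeral)
    have "V r powr q = \<kappa> powr (q - 1 + 1) * r powr (\<alpha> - 2)" using V_powr_q assms by simp
    also have "\<dots> = \<kappa> * (real N - 2 + \<alpha>) * r powr (\<alpha> - 2)"
      unfolding powr_add using \<kappa> by simp
    finally have 2: "V r powr q = \<kappa> * (real N - 2 + \<alpha>) * r powr (\<alpha> - 2)" .
    show ?thesis unfolding 2 unfolding U_def V_def \<kappa>(3) 1 using assms \<alpha> by (simp add: field_simps)
  qed
  ultimately show ?thesis by simp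
qed

text \<open>On \<open>{\<rho>..}\<close> the cap is \<open>V\<close>, which the profile that is sought respects. Freezing the cap on \<open>{0..\<rho>}\<close> keeps it bounded, so that the capped power \<open>g \<rho>\<close> is
globally Lipschitz in the slope.\<close>
definition cap :: "real \<Rightarrow> real \<Rightarrow> real" where
  "cap \<rho> s = \<kappa> * max s \<rho> powr (\<alpha> - 1)"

definition g :: "real \<Rightarrow> real \<Rightarrow> real \<Rightarrow> real" where
  "g \<rho> s y = min (max 0 y) (cap \<rho> s) powr q"

text \<open>The integrating factor of the linear part \<open>w' + ((N - 1) / \<eta> + \<eta> / 2) w\<close>.\<close>
definition P :: "real \<Rightarrow> real" where "P s = s ^ (N - 1) * exp (s\<^sup>2 / 4)"

text \<open>Right-hand side of the first order equation for \<open>w = f'\<close>, the value \<open>f\<close> being recovered as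
\<open>A\<close> plus the integral of \<open>w\<close>. Taking the positive part of \<open>w\<close> makes the source nonnegative for
\<open>A \<ge> 0\<close>, whence so are the solutions. Arguments below \<open>0\<close> are treated as \<open>0\<close>, which makes all functions
continuous on the whole line.\<close>
definition source :: "real \<Rightarrow> real \<Rightarrow> (real \<Rightarrow> real) \<Rightarrow> real \<Rightarrow> real" where
  "source \<rho> A w s = \<alpha> / 2 * (A + integral {0..max 0 s} (\<lambda>r. max 0 (w r))) + g \<rho> s (w s)"

text \<open>The variation of constants formula; its fixed points are the slopes of the truncated equation. At
\<open>\<eta> = 0\<close> the quotient is \<open>0 / 0 = 0\<close>, which is the initial condition \<open>w 0 = 0\<close>.\<close>
definition T :: "real \<Rightarrow> real \<Rightarrow> (real \<Rightarrow> real) \<Rightarrow> real \<Rightarrow> real" where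
  "T \<rho> A w \<eta> = integral {0..max 0 \<eta>} (\<lambda>s. P s * source \<rho> A w s) / P \<eta>"

lemma cap: assumes "0 < \<rho>"
  shows "0 < cap \<rho> s" "cap \<rho> s \<le> cap \<rho> \<rho>" "0 < s \<Longrightarrow> cap \<rho> s \<le> V s" "\<rho> \<le> s \<Longrightarrow> cap \<rho> s = V s"
    "continuous_on UNIV (cap \<rho>)"
  using assms \<kappa> \<alpha> by (auto simp: cap_def[abs_def] V_def intro!: powr_mono2' mult_left_mono continuous_intros)

lemma g_nonneg: "0 \<le> g \<rho> s y" by (simp add: g_def)

lemma g_lipschitz:
  assumes "0 < \<rho>"
  shows "\<bar>g \<rho> s y - g \<rho> s z\<bar> \<le> q * cap \<rho> \<rho> powr (q - 1) * \<bar>y - z\<bar>"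
proof -
  have "\<bar>g \<rho> s y - g \<rho> s z\<bar> \<le> q * cap \<rho> \<rho> powr (q - 1) * \<bar>min (max 0 y) (cap \<rho> s) - min (max 0 z) (cap \<rho> s)\<bar>"
    unfolding g_def using cap(1,2)[OF assms, of s] q by (intro powr_lipschitz) auto
  also have "\<dots> \<le> q * cap \<rho> \<rho> powr (q - 1) * \<bar>y - z\<bar>"
    using q by (intro mult_left_mono) auto
  finally show ?thesis .
qed

lemma source_continuous:
  assumes "0 < \<rho>" "continuous_on UNIV w"
  shows "continuous_on UNIV (source \<rho> A w)"
proof -
  have "continuous_on UNIV (\<lambda>s. g \<rho> s (w s))"
    unfolding g_def using q less_imp_le[OF cap(1)[OF assms(1)]]
    by (intro continuous_on_powr' continuous_on_min continuous_on_max continuous_on_const assms cap(5)[OF assms(1)]) auto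
  then show ?thesis
    unfolding source_def[abs_def] using assms(2)
    by (intro continuous_intros continuous_on_integral_upto_pos_part)
qed

lemma P: "continuous_on UNIV P" "0 \<le> s \<Longrightarrow> 0 \<le> P s" "0 < s \<Longrightarrow> 0 < P s" "P 0 = 0"
  "0 \<le> s \<Longrightarrow> s \<le> r \<Longrightarrow> P s \<le> P r"
  "0 < s \<Longrightarrow> (P has_real_derivative ((real N - 1) / s + s / 2) * P s) (at s)"
proof -
  show "0 < s \<Longrightarrow> (P has_real_derivative ((real N - 1) / s + s / 2) * P s) (at s)"
  proof -
    assume s: "0 < s"
    obtain n where n: "N = Suc (Suc n)" using N by (metis add_2_eq_Suc le_Suc_ex)
    have "((\<lambda>s. s ^ Suc n) has_real_derivative (1 + real n) * s ^ n) (at s)"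
      using DERIV_pow[of "Suc n" s] by simp
    moreover have "((\<lambda>s. exp (s\<^sup>2 / 4)) has_real_derivative s / 2 * exp (s\<^sup>2 / 4)) (at s)"
      by (auto intro!: derivative_eq_intros)
    ultimately have "((\<lambda>s. s ^ Suc n * exp (s\<^sup>2 / 4)) has_real_derivative
        (1 + real n) * s ^ n * exp (s\<^sup>2 / 4) + s / 2 * exp (s\<^sup>2 / 4) * s ^ Suc n) (at s)"
      by (rule DERIV_mult)
    moreover have "N - 1 = Suc n" "real N - 1 = 1 + real n" using n by auto
    ultimately show ?thesis unfolding P_def[abs_def]
      by (simp only:) (erule DERIV_cong, use s in \<open>simp add: field_simps\<close>)
  qed
qed (use N in \<open>auto simp: P_def[abs_def] intro!: continuous_intros mult_mono power_mono\<close>)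

text \<open>Since \<open>P\<close> is increasing, the kernel \<open>P s / P \<eta>\<close> is at most \<open>1\<close>, and integrating an exponential weight
gains the factor \<open>1 / l\<close> that yields the contraction.\<close>
lemma kernel_bound:
  assumes "continuous_on UNIV H" "0 < l" "0 \<le> \<eta>" "0 \<le> B"
    and H: "\<And>s. 0 \<le> s \<Longrightarrow> s \<le> \<eta> \<Longrightarrow> \<bar>H s\<bar> \<le> B * exp (l * s)"
  shows "\<bar>integral {0..\<eta>} (\<lambda>s. P s * H s) / P \<eta>\<bar> \<le> B / l * exp (l * \<eta>)"
proof (cases "\<eta> = 0")
  case True then show ?thesis using assms by simp
next
  case False
  then have \<eta>: "0 < \<eta>" using assms by simp
  have "norm (integral {0..\<eta>} (\<lambda>s. P s * H s)) \<le> integral {0..\<eta>} (\<lambda>s. P \<eta> * B * exp (l * s))"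
  proof (rule integral_norm_bound_integral)
    show "norm (P s * H s) \<le> P \<eta> * B * exp (l * s)" if "s \<in> {0..\<eta>}" for s
    proof -
      have "\<bar>P s\<bar> * \<bar>H s\<bar> \<le> P \<eta> * (B * exp (l * s))"
        using that P(2,5) H by (intro mult_mono) auto
      then show ?thesis by (simp add: abs_mult mult_ac)
    qed
  qed (auto intro!: integrable_continuous_interval continuous_intros continuous_on_subset[OF P(1)] continuous_on_subset[OF assms(1)])
  also have "\<dots> = P \<eta> * B / l * (exp (l * \<eta>) - 1)" using assms by (intro integral_exp_mult_le) auto
  also have "\<dots> \<le> P \<eta> * (B / l * exp (l * \<eta>))" using assms P(2) by (simp add: field_simps)
  finally show ?thesis using P(3)[OF \<eta>] by (simp add: abs_divide pos_divide_le_eq mult_ac)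
qed

lemma T_has_derivative:
  assumes "0 < \<rho>" "continuous_on UNIV w" "0 < \<eta>"
  shows "(T \<rho> A w has_real_derivative source \<rho> A w \<eta> - ((real N - 1) / \<eta> + \<eta> / 2) * T \<rho> A w \<eta>) (at \<eta>)"
proof -
  let ?I = "\<lambda>\<eta>. integral {0..\<eta>} (\<lambda>s. P s * source \<rho> A w s)"
  have "(?I has_real_derivative P \<eta> * source \<rho> A w \<eta>) (at \<eta>)"
    using assms by (intro integral_upto_has_derivative continuous_intros P source_continuous)
  then have "((\<lambda>\<eta>. ?I \<eta> / P \<eta>) has_real_derivative source \<rho> A w \<eta> - ((real N - 1) / \<eta> + \<eta> / 2) * (?I \<eta> / P \<eta>)) (at \<eta>)"
    using P(6)[OF assms(3)] P(3)[OF assms(3)]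
    by (auto intro!: derivative_eq_intros simp: field_simps)
  moreover have "T \<rho> A w \<eta> = ?I \<eta> / P \<eta>" using assms by (simp add: T_def)
  ultimately show ?thesis using assms(3)
    by (auto intro: has_field_derivative_transform_within_open[where S="{0<..}"] simp: T_def)
qed

text \<open>At \<open>0\<close> the quotient is controlled by \<open>\<eta>\<close> times a bound for the source, because \<open>P s \<le> P \<eta>\<close>.\<close>
lemma T_continuous:
  assumes "0 < \<rho>" "continuous_on UNIV w"
  shows "continuous_on UNIV (T \<rho> A w)"
proof -
  have neg: "T \<rho> A w \<eta> = 0" if "\<eta> \<le> 0" for \<eta> using that by (simp add: T_def)
  have "isCont (T \<rho> A w) \<eta>" for \<eta>
  proof -
    consider "\<eta> > 0" | "\<eta> < 0" | "\<eta> = 0" by linarith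
    then show ?thesis
    proof cases
      case 1 then show ?thesis using T_has_derivative[OF assms] DERIV_isCont by blast
    next
      case 2
      have "continuous_on {..<0} (T \<rho> A w)" using neg by (subst continuous_on_cong[OF refl, of _ _ "\<lambda>_. 0"]) auto
      then show ?thesis using 2 continuous_on_eq_continuous_at[OF open_lessThan[of "0::real"]] by auto
    next
      case 3
      have "compact (source \<rho> A w ` {0..1})"
        using source_continuous[OF assms] by (intro compact_continuous_image continuous_on_subset[OF source_continuous[OF assms]]) auto
      then obtain B where B: "0 < B" "\<And>s. 0 \<le> s \<Longrightarrow> s \<le> 1 \<Longrightarrow> \<bar>source \<rho> A w s\<bar> \<le> B"
        using compact_imp_bounded[of "source \<rho> A w ` {0..1}"] by (auto simp: bounded_pos)
      have bd: "\<bar>T \<rho> A w \<eta>\<bar> \<le> B * \<bar>\<eta>\<bar>" if "\<eta> < 1" for \<eta>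
      proof (cases "0 < \<eta>")
        case True
        have "norm (integral {0..\<eta>} (\<lambda>s. P s * source \<rho> A w s)) \<le> (P \<eta> * B) * (\<eta> - 0)"
        proof (rule integral_bound)
          show "norm (P s * source \<rho> A w s) \<le> P \<eta> * B" if "s \<in> {0..\<eta>}" for s
            unfolding norm_mult using that P(2,5) B \<open>\<eta> < 1\<close> by (intro mult_mono) auto
        qed (use True in \<open>auto intro!: continuous_intros continuous_on_subset[OF P(1)] continuous_on_subset[OF source_continuous[OF assms]]\<close>)
        then show ?thesis using True P(3)[OF True] by (simp add: T_def abs_divide pos_divide_le_eq mult_ac)
      next
        case False then show ?thesis using neg[of \<eta>] B(1) by (simp add: mult_le_0_iff)
      qed
      have "(T \<rho> A w \<longlongrightarrow> 0) (at 0)"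
      proof (rule Lim_null_comparison)
        show "\<forall>\<^sub>F \<eta> in at 0. norm (T \<rho> A w \<eta>) \<le> B * \<bar>\<eta>\<bar>"
          using bd unfolding eventually_at by (intro exI[of _ 1]) (auto simp: dist_real_def)
        show "((\<lambda>\<eta>::real. B * \<bar>\<eta>\<bar>) \<longlongrightarrow> 0) (at 0)"
          by (intro tendsto_mult_right_zero tendsto_rabs_zero tendsto_ident_at)
      qed
      then show ?thesis using 3 neg by (simp add: isCont_def)
    qed
  qed
  then show ?thesis by (simp add: continuous_on_eq_continuous_at)
qed

section \<open>The shooting family\<close>

text \<open>Exponential weight, twice a Lipschitz constant of the source, so that the fixed point map contracts by
\<open>1 / 2\<close> in the norm with weight \<open>exp (- lam \<rho> * \<eta>)\<close>.\<close>
definition lam :: "real \<Rightarrow> real" where "lam \<rho> = 2 * (1 + q * cap \<rho> \<rho> powr (q - 1))"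

lemma lam: "2 \<le> lam \<rho>" using q by (simp add: lam_def)

lemma source_diff_le:
  assumes "0 < \<rho>" "0 \<le> s" "0 \<le> D" and w: "continuous_on UNIV w1" "continuous_on UNIV w2"
    and d: "\<And>r. 0 \<le> r \<Longrightarrow> \<bar>w1 r - w2 r\<bar> \<le> D * exp (lam \<rho> * r)"
  shows "\<bar>source \<rho> A w1 s - source \<rho> B w2 s\<bar> \<le> (\<bar>A - B\<bar> + D * lam \<rho>) / 2 * exp (lam \<rho> * s)"
proof -
  let ?J = "\<lambda>w. integral {0..s} (\<lambda>r. max 0 (w r))" and ?L = "q * cap \<rho> \<rho> powr (q - 1)"
  let ?E = "exp (lam \<rho> * s)"
  have i: "(\<lambda>r. max 0 (w r)) integrable_on {0..s}" if "continuous_on UNIV w" for w :: "real \<Rightarrow> real"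
    by (intro integrable_continuous_interval continuous_intros continuous_on_subset[OF that]) auto
  have "norm (integral {0..s} (\<lambda>r. max 0 (w1 r) - max 0 (w2 r))) \<le> integral {0..s} (\<lambda>r. D * exp (lam \<rho> * r))"
  proof (rule integral_norm_bound_integral)
    show "norm (max 0 (w1 r) - max 0 (w2 r)) \<le> D * exp (lam \<rho> * r)" if "r \<in> {0..s}" for r
      using d[of r] that by auto
  qed (intro integrable_diff i w integrable_continuous_interval continuous_intros)+
  also have "\<dots> = D / lam \<rho> * (?E - 1)" using lam[of \<rho>] assms by (intro integral_exp_mult_le) auto
  also have "\<dots> \<le> D * ?E"
  proof -
    have "D / lam \<rho> \<le> D" using lam[of \<rho>] assms mult_left_mono[of 1 "lam \<rho>" D] by (simp add: divide_le_eq)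
    then show ?thesis using assms lam[of \<rho>] by (intro mult_mono) auto
  qed
  finally have J: "\<bar>?J w1 - ?J w2\<bar> \<le> D * ?E" using i w by (simp add: integral_diff)
  have E1: "1 \<le> ?E" using lam[of \<rho>] assms by simp
  have "\<bar>source \<rho> A w1 s - source \<rho> B w2 s\<bar> = \<bar>\<alpha> / 2 * ((A - B) + (?J w1 - ?J w2)) + (g \<rho> s (w1 s) - g \<rho> s (w2 s))\<bar>"
    using assms by (simp add: source_def algebra_simps max_absorb2)
  also have "\<dots> \<le> \<alpha> / 2 * (\<bar>A - B\<bar> + \<bar>?J w1 - ?J w2\<bar>) + \<bar>g \<rho> s (w1 s) - g \<rho> s (w2 s)\<bar>"
    using \<alpha> by (intro order_trans[OF abs_triangle_ineq] add_mono) (auto simp: abs_mult intro!: mult_left_mono)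
  also have "\<dots> \<le> 1 / 2 * (\<bar>A - B\<bar> * ?E + D * ?E) + ?L * (D * ?E)"
  proof (intro add_mono mult_mono J)
    show "\<bar>A - B\<bar> \<le> \<bar>A - B\<bar> * ?E" using E1 by (simp add: mult_le_cancel_left1)
    show "\<bar>g \<rho> s (w1 s) - g \<rho> s (w2 s)\<bar> \<le> ?L * (D * ?E)"
      using g_lipschitz[OF assms(1), of s "w1 s" "w2 s"] d[OF assms(2)] q
      by (intro order_trans[OF g_lipschitz[OF assms(1)]] mult_left_mono) auto
  qed (use \<alpha> in auto)
  also have "\<dots> \<le> (\<bar>A - B\<bar> + D * lam \<rho>) / 2 * ?E"
    using assms by (simp add: lam_def algebra_simps)
  finally show ?thesis .
qed

lemma T_diff_le:
  assumes "0 < \<rho>" "0 \<le> \<eta>" "0 \<le> D" and w: "continuous_on UNIV w1" "continuous_on UNIV w2"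
    and d: "\<And>r. 0 \<le> r \<Longrightarrow> \<bar>w1 r - w2 r\<bar> \<le> D * exp (lam \<rho> * r)"
  shows "\<bar>T \<rho> A w1 \<eta> - T \<rho> B w2 \<eta>\<bar> \<le> (\<bar>A - B\<bar> + D) / 2 * exp (lam \<rho> * \<eta>)"
proof -
  have c: "continuous_on UNIV (source \<rho> A w1)" "continuous_on UNIV (source \<rho> B w2)"
    using source_continuous assms by auto
  have i: "(\<lambda>s. P s * source \<rho> A w1 s) integrable_on {0..\<eta>}" "(\<lambda>s. P s * source \<rho> B w2 s) integrable_on {0..\<eta>}"
    by (intro integrable_continuous_interval continuous_intros continuous_on_subset[OF P(1)] continuous_on_subset[OF c(1)] continuous_on_subset[OF c(2)]; simp)+
  have "T \<rho> A w1 \<eta> - T \<rho> B w2 \<eta> = integral {0..\<eta>} (\<lambda>s. P s * (source \<rho> A w1 s - source \<rho> B w2 s)) / P \<eta>"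
    using assms i by (simp add: T_def max_absorb2 right_diff_distrib integral_diff diff_divide_distrib)
  also have "\<bar>\<dots>\<bar> \<le> (\<bar>A - B\<bar> + D * lam \<rho>) / 2 / lam \<rho> * exp (lam \<rho> * \<eta>)"
    using source_diff_le[OF assms(1) _ assms(3) w d] lam[of \<rho>] assms
    by (intro kernel_bound continuous_intros c) auto
  also have "\<dots> \<le> (\<bar>A - B\<bar> + D) / 2 * exp (lam \<rho> * \<eta>)"
  proof (intro mult_right_mono)
    have "\<bar>A - B\<bar> / lam \<rho> \<le> \<bar>A - B\<bar> / 1" using lam[of \<rho>] by (intro divide_left_mono) auto
    then show "(\<bar>A - B\<bar> + D * lam \<rho>) / 2 / lam \<rho> \<le> (\<bar>A - B\<bar> + D) / 2"
      using lam[of \<rho>] by (simp add: add_divide_distrib)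
  qed auto
  finally show ?thesis .
qed

text \<open>Slopes of at most exponential growth, represented by bounded continuous functions.\<close>
definition weighted :: "real \<Rightarrow> (real \<Rightarrow>\<^sub>C real) \<Rightarrow> real \<Rightarrow> real" where
  "weighted \<rho> v s = exp (lam \<rho> * s) * v s"

lemma weighted_continuous: "continuous_on UNIV (weighted \<rho> v)"
  unfolding weighted_def[abs_def] by (intro continuous_intros continuous_on_apply_bcontfun)

lemma weighted_diff_le: "\<bar>weighted \<rho> v1 r - weighted \<rho> v2 r\<bar> \<le> dist v1 v2 * exp (lam \<rho> * r)"
proof -
  have "\<bar>weighted \<rho> v1 r - weighted \<rho> v2 r\<bar> = dist (v1 r) (v2 r) * exp (lam \<rho> * r)"
    unfolding weighted_def dist_real_def by (simp add: right_diff_distrib[symmetric] abs_mult)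
  then show ?thesis using dist_bounded[of v1 r v2] by (simp add: mult_right_mono)
qed

definition Phi :: "real \<Rightarrow> real \<Rightarrow> (real \<Rightarrow>\<^sub>C real) \<Rightarrow> (real \<Rightarrow>\<^sub>C real)" where
  "Phi \<rho> A v = Bcontfun (\<lambda>\<eta>. exp (- lam \<rho> * \<eta>) * T \<rho> A (weighted \<rho> v) \<eta>)"

lemma T_nonpos_arg: "\<eta> \<le> 0 \<Longrightarrow> T \<rho> A w \<eta> = 0" by (simp add: T_def)

text \<open>Comparison with the zero solution at \<open>A = 0\<close> bounds the weighted image, so that \<open>Bcontfun\<close> is
applied to a bounded function only.\<close>
lemma Phi_apply:
  assumes "0 < \<rho>"
  shows "Phi \<rho> A v \<eta> = exp (- lam \<rho> * \<eta>) * T \<rho> A (weighted \<rho> v) \<eta>"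
proof -
  have T0: "\<bar>T \<rho> A (weighted \<rho> v) \<eta> - T \<rho> 0 (weighted \<rho> 0) \<eta>\<bar> \<le> (\<bar>A - 0\<bar> + dist v 0) / 2 * exp (lam \<rho> * \<eta>)"
    if "0 \<le> \<eta>" for \<eta>
    by (intro T_diff_le weighted_continuous weighted_diff_le assms that zero_le_dist)
  have z: "T \<rho> 0 (weighted \<rho> 0) \<eta> = 0" for \<eta>
    using cap(1)[OF assms] q by (simp add: T_def source_def weighted_def g_def min_def less_imp_le)
  have "(\<lambda>\<eta>. exp (- lam \<rho> * \<eta>) * T \<rho> A (weighted \<rho> v) \<eta>) \<in> bcontfun"
  proof (rule bcontfun_normI)
    show "continuous_on UNIV (\<lambda>\<eta>. exp (- lam \<rho> * \<eta>) * T \<rho> A (weighted \<rho> v) \<eta>)"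
      by (intro continuous_intros T_continuous weighted_continuous assms)
    show "norm (exp (- lam \<rho> * \<eta>) * T \<rho> A (weighted \<rho> v) \<eta>) \<le> (\<bar>A\<bar> + dist v 0) / 2" for \<eta>
    proof (cases "0 \<le> \<eta>")
      case True
      then show ?thesis using T0[OF True] z by (simp add: abs_mult exp_minus divide_simps mult_ac)
    next
      case False then show ?thesis by (simp add: T_nonpos_arg)
    qed
  qed
  then show ?thesis unfolding Phi_def by (simp add: Bcontfun_inverse)
qed

lemma Phi_diff_le:
  assumes "0 < \<rho>"
  shows "dist (Phi \<rho> A v1) (Phi \<rho> B v2) \<le> (\<bar>A - B\<bar> + dist v1 v2) / 2"
proof (rule dist_bound)
  fix \<eta>
  show "dist (Phi \<rho> A v1 \<eta>) (Phi \<rho> B v2 \<eta>) \<le> (\<bar>A - B\<bar> + dist v1 v2) / 2"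
  proof (cases "0 \<le> \<eta>")
    case True
    have "\<bar>T \<rho> A (weighted \<rho> v1) \<eta> - T \<rho> B (weighted \<rho> v2) \<eta>\<bar> \<le> (\<bar>A - B\<bar> + dist v1 v2) / 2 * exp (lam \<rho> * \<eta>)"
      using weighted_diff_le assms True by (intro T_diff_le weighted_continuous) auto
    then show ?thesis
      unfolding Phi_apply[OF assms] dist_real_def right_diff_distrib[symmetric] abs_mult
      by (simp add: exp_minus divide_simps mult_ac)
  next
    case False then show ?thesis by (simp add: Phi_apply[OF assms] T_nonpos_arg)
  qed
qed

text \<open>Estimating the maps for two values of \<open>A\<close> simultaneously gives, besides the fixed points, their Lipschitz
dependence on \<open>A\<close>: a distance \<open>D\<close> of two fixed points satisfies \<open>D \<le> (\<bar>A - B\<bar> + D) / 2\<close>.\<close>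
lemma shooting_family_exists:
  assumes "0 < \<rho>"
  obtains w :: "real \<Rightarrow> real \<Rightarrow> real" where
    "\<And>A. continuous_on UNIV (w A)" "\<And>A \<eta>. w A \<eta> = T \<rho> A (w A) \<eta>"
    "\<And>A B \<eta>. 0 \<le> \<eta> \<Longrightarrow> \<bar>w A \<eta> - w B \<eta>\<bar> \<le> \<bar>A - B\<bar> * exp (lam \<rho> * \<eta>)"
proof -
  have "\<exists>v. Phi \<rho> A v = v" for A
    using banach_fix_type[of "1/2" "Phi \<rho> A"] Phi_diff_le[OF assms, of A _ A] by auto
  then obtain v where v: "\<And>A. Phi \<rho> A (v A) = v A" by metis
  show ?thesis
  proof (rule that[of "\<lambda>A. weighted \<rho> (v A)"])
    show "weighted \<rho> (v A) \<eta> = T \<rho> A (weighted \<rho> (v A)) \<eta>" for A \<eta>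
    proof -
      have "weighted \<rho> (v A) \<eta> = exp (lam \<rho> * \<eta>) * Phi \<rho> A (v A) \<eta>" using v by (simp add: weighted_def)
      then show ?thesis by (simp add: Phi_apply[OF assms] exp_minus)
    qed
    show "\<bar>weighted \<rho> (v A) \<eta> - weighted \<rho> (v B) \<eta>\<bar> \<le> \<bar>A - B\<bar> * exp (lam \<rho> * \<eta>)" for A B \<eta>
    proof -
      have "dist (v A) (v B) \<le> \<bar>A - B\<bar>"
        using Phi_diff_le[OF assms, of A "v A" B "v B"] v by simp
      then show ?thesis by (intro order_trans[OF weighted_diff_le] mult_right_mono) auto
    qed
  qed (rule weighted_continuous)
qed

section \<open>Bounds for the shooting solutions\<close>

definition solves :: "real \<Rightarrow> real \<Rightarrow> (real \<Rightarrow> real) \<Rightarrow> bool" where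
  "solves \<rho> A w \<longleftrightarrow> 0 < \<rho> \<and> continuous_on UNIV w \<and> (\<forall>\<eta>. w \<eta> = T \<rho> A w \<eta>)"

lemma solvesD:
  assumes "solves \<rho> A w"
  shows "0 < \<rho>" "continuous_on UNIV w" "w \<eta> = T \<rho> A w \<eta>"
  using assms unfolding solves_def by blast+

definition primitive :: "real \<Rightarrow> (real \<Rightarrow> real) \<Rightarrow> real \<Rightarrow> real" where
  "primitive A w \<eta> = A + integral {0..max 0 \<eta>} w"

lemma primitive_0 [simp]: "primitive A w 0 = A"
  by (simp add: primitive_def)

lemma primitive_continuous: "continuous_on UNIV w \<Longrightarrow> continuous_on UNIV (primitive A w)"
  unfolding primitive_def[abs_def] by (intro continuous_intros continuous_on_integral_upto_pos_part)

lemma primitive_has_derivative: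
  assumes "continuous_on UNIV w" "0 < \<eta>"
  shows "(primitive A w has_real_derivative w \<eta>) (at \<eta>)"
proof -
  have "((\<lambda>\<eta>. A + integral {0..\<eta>} w) has_real_derivative w \<eta>) (at \<eta>)"
    using integral_upto_has_derivative[OF assms] by (auto intro!: derivative_eq_intros)
  then show ?thesis
    by (rule has_field_derivative_transform_within_open[where S="{0<..}"]) (use assms in \<open>auto simp: primitive_def\<close>)
qed

lemma source_lower_bound:
  assumes "solves \<rho> A w" "0 \<le> A" "0 \<le> s"
  shows "\<alpha> / 2 * A \<le> source \<rho> A w s"
proof -
  have "0 \<le> integral {0..s} (\<lambda>r. max 0 (w r))"
    using assms by (intro integral_nonneg integrable_continuous_interval continuous_intros)
      (auto intro: continuous_on_subset[OF solvesD(2)[OF assms(1)]])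
  then show ?thesis using assms(2,3) \<alpha> g_nonneg[of \<rho> s "w s"]
    by (auto simp: source_def max_absorb2 distrib_left intro!: add_nonneg_nonneg)
qed

text \<open>The source is at least \<open>\<alpha> / 2 * A\<close>, and \<open>P s \<ge> s ^ (N - 1)\<close>. The bound gives positivity of the slope, and
it forces the slope at \<open>1\<close> above \<open>V 1\<close> when \<open>A\<close> is large, uniformly in the truncation parameter.\<close>
lemma solution_lower_bound:
  assumes "solves \<rho> A w" "0 \<le> A" "0 \<le> \<eta>"
  shows "\<alpha> * A / (2 * real N) * \<eta> ^ N \<le> w \<eta> * P \<eta>"
proof (cases "\<eta> = 0")
  case True then show ?thesis using N by (simp add: P(4) power_0_left)
next
  case False
  then have \<eta>: "0 < \<eta>" using assms by simp
  have c: "continuous_on UNIV (source \<rho> A w)" using solvesD[OF assms(1)] by (intro source_continuous)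
  have "((\<lambda>s. \<alpha> / 2 * A * s ^ (N - 1)) has_integral (\<alpha> * A / (2 * real N) * \<eta> ^ N - \<alpha> * A / (2 * real N) * 0 ^ N)) {0..\<eta>}"
    using N \<eta> by (intro fundamental_theorem_of_calculus)
      (auto simp: has_real_derivative_iff_has_vector_derivative[symmetric] intro!: derivative_eq_intros)
  moreover have "\<alpha> * A / (2 * real N) * \<eta> ^ N - \<alpha> * A / (2 * real N) * 0 ^ N = \<alpha> * A / (2 * real N) * \<eta> ^ N"
    using N by (simp add: power_0_left)
  ultimately have "((\<lambda>s. \<alpha> / 2 * A * s ^ (N - 1)) has_integral (\<alpha> * A / (2 * real N) * \<eta> ^ N)) {0..\<eta>}" by (simp only:)
  from integral_unique[OF this, symmetric] have "\<alpha> * A / (2 * real N) * \<eta> ^ N = integral {0..\<eta>} (\<lambda>s. \<alpha> / 2 * A * s ^ (N - 1))" .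
  also have "\<dots> \<le> integral {0..\<eta>} (\<lambda>s. P s * source \<rho> A w s)"
  proof (rule integral_le)
    show "\<alpha> / 2 * A * s ^ (N - 1) \<le> P s * source \<rho> A w s" if "s \<in> {0..\<eta>}" for s
    proof -
      have 1: "s ^ (N - 1) \<le> P s" using that by (simp add: P_def mult_le_cancel_left1)
      have "s ^ (N - 1) * (\<alpha> / 2 * A) \<le> P s * source \<rho> A w s"
        using that assms \<alpha> P(2)[of s] by (intro mult_mono 1 source_lower_bound) auto
      then show ?thesis by (simp add: mult_ac)
    qed
  qed (intro integrable_continuous_interval continuous_intros continuous_on_subset[OF P(1)] continuous_on_subset[OF c]; simp)+
  also have "\<dots> = w \<eta> * P \<eta>"
  proof -
    have "w \<eta> = T \<rho> A w \<eta>" by (rule solvesD(3)[OF assms(1)])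
    also have "\<dots> = integral {0..\<eta>} (\<lambda>s. P s * source \<rho> A w s) / P \<eta>"
      using assms by (simp add: T_def max_absorb2)
    finally show ?thesis using P(3)[OF \<eta>] by simp
  qed
  finally show ?thesis .
qed

lemma solution_nonneg:
  assumes "solves \<rho> A w" "0 \<le> A"
  shows "0 \<le> w \<eta>"
proof (cases "0 < \<eta>")
  case True
  have "0 \<le> \<alpha> * A / (2 * real N) * \<eta> ^ N" using \<alpha> assms True by simp
  then have "0 \<le> w \<eta> * P \<eta>" using solution_lower_bound[OF assms, of \<eta>] True by linarith
  then show ?thesis using P(3)[OF True] by (simp add: zero_le_mult_iff)
next
  case False
  moreover have "w \<eta> = T \<rho> A w \<eta>" by (rule solvesD(3)[OF assms(1)])
  ultimately show ?thesis by (simp add: T_nonpos_arg)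
qed

lemma solution_has_derivative:
  assumes "solves \<rho> A w" "0 \<le> A" "0 < \<eta>"
  shows "(w has_real_derivative \<alpha> / 2 * primitive A w \<eta> + g \<rho> \<eta> (w \<eta>) - ((real N - 1) / \<eta> + \<eta> / 2) * w \<eta>) (at \<eta>)"
proof -
  have e: "w = T \<rho> A w" using solvesD(3)[OF assms(1)] by blast
  have "(\<lambda>r. max 0 (w r)) = w" using solution_nonneg[OF assms(1,2)] by (auto simp: max_absorb2)
  then have s: "source \<rho> A w \<eta> = \<alpha> / 2 * primitive A w \<eta> + g \<rho> \<eta> (w \<eta>)"
    by (simp add: source_def primitive_def)
  have "(T \<rho> A w has_real_derivative source \<rho> A w \<eta> - ((real N - 1) / \<eta> + \<eta> / 2) * T \<rho> A w \<eta>) (at \<eta>)"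
    by (intro T_has_derivative solvesD[OF assms(1)] assms(3))
  then show ?thesis unfolding e[symmetric] s .
qed

lemma primitive_mono:
  assumes "solves \<rho> A w" "0 \<le> A" "0 \<le> s" "s \<le> t"
  shows "primitive A w s \<le> primitive A w t"
proof (cases "s = t")
  case False
  have c: "continuous_on UNIV w" by (rule solvesD(2)[OF assms(1)])
  show ?thesis
  proof (rule DERIV_nonneg_imp_increasing_open[of s t])
    fix x assume "s < x" "x < t"
    then show "\<exists>y. (primitive A w has_real_derivative y) (at x) \<and> 0 \<le> y"
      using primitive_has_derivative[OF c, of x A] solution_nonneg[OF assms(1,2), of x] assms(3) by auto
  qed (use assms in \<open>auto intro!: continuous_on_subset[OF primitive_continuous[OF c]]\<close>)
qed simp

text \<open>The capped slope is at most \<open>V s\<close>, and \<open>V s powr (q - 1) = (N - 2 + \<alpha>) / s\<close> is below \<open>(N - 1) / s\<close>: the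
friction term absorbs the nonlinearity.\<close>
lemma g_le:
  assumes "0 < \<rho>" "0 < s" "0 \<le> y"
  shows "g \<rho> s y \<le> (real N - 1) / s * y"
proof -
  define m where "m = min y (cap \<rho> s)"
  have m: "0 \<le> m" "m \<le> y" "m \<le> V s" using assms cap(1,3)[OF assms(1), of s] by (auto simp: m_def)
  have "g \<rho> s y = m powr (1 + (q - 1))" using assms by (simp add: g_def m_def max_absorb2)
  also have "\<dots> = m * m powr (q - 1)" unfolding powr_add using m by simp
  also have "\<dots> \<le> y * V s powr (q - 1)" using m q assms by (intro mult_mono powr_mono2) auto
  also have "\<dots> \<le> y * ((real N - 1) / s)"
    unfolding V_powr[OF assms(2)] using assms \<alpha> by (intro mult_left_mono divide_right_mono) auto
  finally show ?thesis by (simp add: mult.commute)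
qed

text \<open>By \<open>g_le\<close> the derivative of the slope is at most \<open>\<alpha> / 2\<close> times the profile, which increases.\<close>
lemma solution_upper_bound:
  assumes "solves \<rho> A w" "0 \<le> A" "0 \<le> \<eta>"
  shows "w \<eta> \<le> \<alpha> / 2 * \<eta> * primitive A w \<eta>"
proof (cases "\<eta> = 0")
  case True
  have "w 0 = T \<rho> A w 0" by (rule solvesD(3)[OF assms(1)])
  then show ?thesis using True by (simp add: T_nonpos_arg)
next
  case False
  then have \<eta>: "0 < \<eta>" using assms by simp
  have w0: "w 0 = 0" using solvesD(3)[OF assms(1), of 0] T_nonpos_arg[of 0] by simp
  have \<rho>: "0 < \<rho>" by (rule solvesD(1)[OF assms(1)])
  have "\<exists>l z. 0 < z \<and> z < \<eta> \<and> (w has_real_derivative l) (at z) \<and> w \<eta> - w 0 = (\<eta> - 0) * l"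
    by (rule MVT[OF \<eta>])
      (use solution_has_derivative[OF assms(1,2)] in \<open>auto simp: real_differentiable_def intro: continuous_on_subset[OF solvesD(2)[OF assms(1)]]\<close>)
  then obtain l z where z: "0 < z" "z < \<eta>" "(w has_real_derivative l) (at z)" "w \<eta> = \<eta> * l" using w0 by auto
  have l: "l = \<alpha> / 2 * primitive A w z + g \<rho> z (w z) - ((real N - 1) / z + z / 2) * w z"
    using DERIV_unique[OF z(3) solution_has_derivative[OF assms(1,2) z(1)]] .
  have "0 \<le> z / 2 * w z" using z solution_nonneg[OF assms(1,2)] by simp
  then have "l \<le> \<alpha> / 2 * primitive A w z"
    using g_le[OF \<rho> z(1) solution_nonneg[OF assms(1,2), of z]] unfolding l distrib_right by linarith
  also have "\<dots> \<le> \<alpha> / 2 * primitive A w \<eta>"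
    using primitive_mono[OF assms(1,2), of z \<eta>] z \<alpha> by (intro mult_left_mono) auto
  finally show ?thesis using z(4) \<eta> by (simp add: mult_ac)
qed

text \<open>Gronwall's inequality for \<open>f' \<le> \<alpha> / 2 * \<eta> * f\<close>. The bound is independent of the truncation.\<close>
lemma primitive_upper_bound:
  assumes "solves \<rho> A w" "0 \<le> A" "0 \<le> \<eta>"
  shows "primitive A w \<eta> \<le> A * exp (\<alpha> * \<eta>\<^sup>2 / 4)"
proof (cases "\<eta> = 0")
  case False
  have c: "continuous_on UNIV w" by (rule solvesD(2)[OF assms(1)])
  have "primitive A w \<eta> * exp (- (\<alpha> * \<eta>\<^sup>2 / 4)) \<le> primitive A w 0 * exp (- (\<alpha> * 0\<^sup>2 / 4))"
  proof (rule DERIV_nonpos_imp_decreasing_open[of 0 \<eta>])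
    fix s assume s: "0 < s" "s < \<eta>"
    have "((\<lambda>s. primitive A w s * exp (- (\<alpha> * s\<^sup>2 / 4))) has_real_derivative
        (w s - \<alpha> / 2 * s * primitive A w s) * exp (- (\<alpha> * s\<^sup>2 / 4))) (at s)"
    proof -
      have "((\<lambda>s. exp (- (\<alpha> * s\<^sup>2 / 4))) has_real_derivative - (\<alpha> / 2 * s) * exp (- (\<alpha> * s\<^sup>2 / 4))) (at s)"
        by (auto intro!: derivative_eq_intros)
      note D = DERIV_mult[OF primitive_has_derivative[OF c s(1), of A] this]
      have "W * E + (- a * E) * F = (W - a * F) * E" for W E a F :: real by (simp add: algebra_simps)
      then show ?thesis by (rule DERIV_cong[OF D])
    qed
    moreover have "(w s - \<alpha> / 2 * s * primitive A w s) * exp (- (\<alpha> * s\<^sup>2 / 4)) \<le> 0"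
      using solution_upper_bound[OF assms(1,2), of s] s by (intro mult_nonpos_nonneg) auto
    ultimately show "\<exists>y. ((\<lambda>s. primitive A w s * exp (- (\<alpha> * s\<^sup>2 / 4))) has_real_derivative y) (at s) \<and> y \<le> 0" by blast
  qed (use assms in \<open>auto intro!: continuous_intros continuous_on_subset[OF primitive_continuous[OF c]]\<close>)
  then show ?thesis by (simp add: exp_minus divide_simps)
qed simp

end

section \<open>Selection of the profile\<close>

lemma continuous_pos_lower_bound:
  fixes h :: "real \<Rightarrow> real"
  assumes "continuous_on {a..b} h" "\<And>s. s \<in> {a..b} \<Longrightarrow> 0 < h s"
  obtains e where "0 < e" "\<And>s. s \<in> {a..b} \<Longrightarrow> e \<le> h s"
proof (cases "a \<le> b")
  case True
  then obtain x where "x \<in> {a..b}" "\<And>s. s \<in> {a..b} \<Longrightarrow> h x \<le> h s"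
    using continuous_attains_inf[OF compact_Icc _ assms(1)] by auto
  then show ?thesis using assms(2) that[of "h x"] by blast
next
  case False then show ?thesis using that[of 1] by auto
qed

text \<open>The condition involves finitely much of the trajectory: a compact time interval and one end point, hence it
survives small changes of the parameter.\<close>
lemma open_shooting_condition:
  fixes p r :: "real \<Rightarrow> real \<Rightarrow> real"
  assumes a: "0 \<le> a" and r: "\<And>A t. continuous_on {a..t} (r A)"
    and close: "\<And>A t e. 0 \<le> t \<Longrightarrow> 0 < e \<Longrightarrow> \<exists>\<delta>>0. \<forall>B. \<bar>A - B\<bar> < \<delta> \<longrightarrow>
      (\<forall>s. 0 \<le> s \<longrightarrow> s \<le> t \<longrightarrow> \<bar>p A s - p B s\<bar> < e \<and> \<bar>r A s - r B s\<bar> < e)"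
  shows "open {A. \<exists>t>0. 0 < p A t \<and> (\<forall>s\<in>{a..t}. 0 < r A s)}"
proof (rule openI)
  fix A assume "A \<in> {A. \<exists>t>0. 0 < p A t \<and> (\<forall>s\<in>{a..t}. 0 < r A s)}"
  then obtain t where t: "0 < t" "0 < p A t" "\<And>s. s \<in> {a..t} \<Longrightarrow> 0 < r A s" by blast
  from continuous_pos_lower_bound[OF r t(3)]
  obtain e where e: "0 < e" "\<And>s. s \<in> {a..t} \<Longrightarrow> e \<le> r A s" by blast
  define e' where "e' = min e (p A t)"
  have e': "0 < e'" "e' \<le> e" "e' \<le> p A t" using e t by (auto simp: e'_def)
  obtain \<delta> where \<delta>: "0 < \<delta>" "\<And>B s. \<bar>A - B\<bar> < \<delta> \<Longrightarrow> 0 \<le> s \<Longrightarrow> s \<le> t \<Longrightarrow>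
      \<bar>p A s - p B s\<bar> < e' \<and> \<bar>r A s - r B s\<bar> < e'"
    using close[of t e' A] t(1) e'(1) by auto
  have "\<exists>t>0. 0 < p B t \<and> (\<forall>s\<in>{a..t}. 0 < r B s)" if "B \<in> ball A \<delta>" for B
  proof (intro exI[of _ t] conjI ballI)
    have B: "\<bar>A - B\<bar> < \<delta>" using that by (simp add: dist_real_def)
    show "0 < p B t" using \<delta>(2)[OF B, of t] t(1) e' by linarith
    show "0 < r B s" if "s \<in> {a..t}" for s
      using \<delta>(2)[OF B, of s] e(2)[OF that] e' that a by auto
  qed (rule t(1))
  then show "\<exists>e>0. ball A e \<subseteq> {A. \<exists>t>0. 0 < p A t \<and> (\<forall>s\<in>{a..t}. 0 < r A s)}" using \<delta>(1) by blast
qed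

lemma square_has_derivative:
  fixes h :: "real \<Rightarrow> real"
  assumes "(h has_real_derivative D) (at x)"
  shows "((\<lambda>x. (h x)\<^sup>2) has_real_derivative 2 * h x * D) (at x)"
  using assms by (auto intro!: derivative_eq_intros)

context profile_equation begin

lemma U_continuous: "continuous_on {0..} U"
  unfolding U_def[abs_def] using \<alpha> by (intro continuous_intros continuous_on_powr') auto

lemma V_continuous: "continuous_on {0<..} V"
  unfolding V_def[abs_def] by (intro continuous_intros) auto

lemma V_antimono: "0 < s \<Longrightarrow> s \<le> t \<Longrightarrow> V t \<le> V s"
  unfolding V_def using \<kappa> \<alpha> by (intro mult_left_mono powr_mono2') auto

text \<open>Backward uniqueness. On \<open>{s..t0}\<close> the energy \<open>E = (f - U)\<^sup>2 + (w - V)\<^sup>2\<close> satisfies \<open>E' \<ge> - K * E\<close>, because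
both slopes stay below \<open>V s\<close>, where the power is Lipschitz. So \<open>exp (K x) * E x\<close> is nondecreasing, and it
vanishes at \<open>t0\<close>.\<close>
lemma no_tangential_contact:
  assumes t0: "0 < t0"
    and d: "\<And>s. 0 < s \<Longrightarrow> s \<le> t0 \<Longrightarrow> (f has_real_derivative w s) (at s)"
    and dw: "\<And>s. 0 < s \<Longrightarrow> s \<le> t0 \<Longrightarrow>
       (w has_real_derivative \<alpha> / 2 * f s + w s powr q - ((real N - 1) / s + s / 2) * w s) (at s)"
    and w: "\<And>s. 0 < s \<Longrightarrow> s \<le> t0 \<Longrightarrow> 0 \<le> w s \<and> w s \<le> V s"
    and eq: "f t0 = U t0" "w t0 = V t0" and s: "0 < s" "s < t0"
  shows "f s = U s"
proof -
  define L where "L = q * V s powr (q - 1)"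
  define M where "M = (real N - 1) / s + t0 / 2"
  define K where "K = 3 + 2 * L + 2 * M"
  define E where "E x = (f x - U x)\<^sup>2 + (w x - V x)\<^sup>2" for x
  define E' where "E' x = 2 * (f x - U x) * (w x - V x) + 2 * (w x - V x) *
     (\<alpha> / 2 * (f x - U x) + (w x powr q - V x powr q) - ((real N - 1) / x + x / 2) * (w x - V x))" for x
  have dE: "(E has_real_derivative E' x) (at x)" if x: "0 < x" "x \<le> t0" for x
  proof -
    have "((\<lambda>x. f x - U x) has_real_derivative w x - V x) (at x)"
      using d[OF x] U_has_derivative[OF x(1)] by (rule DERIV_diff)
    note 1 = square_has_derivative[OF this]
    have "(a * F + W - b * w') - (a * u + W' - b * v) = a * (F - u) + (W - W') - b * (w' - v)"
      for a F W b w' u W' v :: real by (simp add: algebra_simps)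
    note 2 = square_has_derivative[OF DERIV_cong[OF DERIV_diff[OF dw[OF x] V_has_derivative[OF x(1)]] this]]
    show ?thesis unfolding E_def[abs_def] E'_def by (rule DERIV_add[OF 1 2])
  qed
  have lower: "- K * E x \<le> E' x" if x: "s \<le> x" "x \<le> t0" for x
  proof -
    define D where "D = f x - U x"
    define Z where "Z = w x - V x"
    define B where "B = (real N - 1) / x + x / 2"
    define G where "G = w x powr q - V x powr q"
    have x0: "0 < x" using x s by simp
    have G: "\<bar>G\<bar> \<le> L * \<bar>Z\<bar>"
      unfolding G_def L_def Z_def
      using w[OF x0 x(2)] V_antimono[OF s(1) x(1)] V_pos[OF x0] q by (intro powr_lipschitz) auto
    have B: "B \<le> M"
      unfolding B_def M_def using x s N by (intro add_mono divide_left_mono) auto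
    have "\<bar>Z * G\<bar> \<le> \<bar>Z\<bar> * (L * \<bar>Z\<bar>)" unfolding abs_mult using G by (intro mult_left_mono) auto
    then have ZG: "- (L * Z\<^sup>2) \<le> Z * G" by (simp add: power2_eq_square mult_ac abs_mult_self_eq)
    have BZ: "B * Z\<^sup>2 \<le> M * Z\<^sup>2" using B by (intro mult_right_mono) auto
    have DZ: "- (D\<^sup>2 + Z\<^sup>2) \<le> 2 * (D * Z)" using zero_le_power2[of "D + Z"] by (simp add: power2_sum)
    have "E' x = (2 + \<alpha>) / 2 * (2 * (D * Z)) + 2 * (Z * G) - 2 * (B * Z\<^sup>2)"
      unfolding E'_def D_def[symmetric] Z_def[symmetric] B_def[symmetric] G_def[symmetric]
      by (simp add: algebra_simps power2_eq_square)
    moreover have "(2 + \<alpha>) / 2 * (2 * (D * Z)) \<ge> (2 + \<alpha>) / 2 * (- (D\<^sup>2 + Z\<^sup>2))"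
      using DZ \<alpha> by (intro mult_left_mono) auto
    moreover have "(2 + \<alpha>) / 2 * (D\<^sup>2 + Z\<^sup>2) \<le> 3 * (D\<^sup>2 + Z\<^sup>2)" using \<alpha> by (intro mult_right_mono) auto
    moreover have "K * E x = 3 * (D\<^sup>2 + Z\<^sup>2) + 2 * (L * Z\<^sup>2) + 2 * (M * Z\<^sup>2)
        + (2 * L + 2 * M) * D\<^sup>2"
      unfolding K_def E_def D_def[symmetric] Z_def[symmetric] by (simp add: algebra_simps)
    moreover have "0 \<le> (2 * L + 2 * M) * D\<^sup>2"
      using q N s by (intro mult_nonneg_nonneg add_nonneg_nonneg) (auto simp: L_def M_def)
    ultimately show ?thesis using ZG BZ by linarith
  qed
  have "exp (K * s) * E s \<le> exp (K * t0) * E t0"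
  proof (rule DERIV_nonneg_imp_nondecreasing[of s t0 "\<lambda>x. exp (K * x) * E x"])
    show "\<exists>y. ((\<lambda>x. exp (K * x) * E x) has_real_derivative y) (at x) \<and> 0 \<le> y" if x: "s \<le> x" "x \<le> t0" for x
    proof (intro exI conjI)
      have "((\<lambda>x. exp (K * x)) has_real_derivative exp (K * x) * K) (at x)"
        by (auto intro!: derivative_eq_intros)
      from DERIV_mult[OF this dE[of x]] show "((\<lambda>x. exp (K * x) * E x) has_real_derivative exp (K * x) * K * E x + E' x * exp (K * x)) (at x)"
        using x s by simp
      have "exp (K * x) * K * E x + E' x * exp (K * x) = exp (K * x) * (K * E x + E' x)" by (simp add: algebra_simps)
      then show "0 \<le> exp (K * x) * K * E x + E' x * exp (K * x)" using lower[OF x] by simp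
    qed
  qed (use s in simp)
  also have "\<dots> = 0" using eq by (simp add: E_def)
  finally have "E s \<le> 0" by (simp add: mult_le_0_iff)
  then show ?thesis unfolding E_def by (smt (verit) zero_le_power2 power2_less_eq_zero_iff)
qed

end

lemma isCont_pos_nearby:
  fixes h :: "real \<Rightarrow> real"
  assumes "isCont h x" "0 < h x"
  obtains e where "0 < e" "\<And>s. \<bar>s - x\<bar> < e \<Longrightarrow> 0 < h s"
proof -
  have "\<forall>\<^sub>F s in at x. 0 < h s"
    using assms unfolding isCont_def by (rule order_tendstoD)
  then obtain e where "0 < e" "\<And>s. s \<noteq> x \<Longrightarrow> \<bar>s - x\<bar> < e \<Longrightarrow> 0 < h s"
    unfolding eventually_at by (auto simp: dist_real_def)
  then show ?thesis using assms(2) by (intro that[of e]) (auto, metis)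
qed

context profile_equation begin

lemma primitive_diff_le:
  assumes "continuous_on UNIV w1" "continuous_on UNIV w2" "0 \<le> s" "s \<le> t"
    and "\<And>r. 0 \<le> r \<Longrightarrow> r \<le> t \<Longrightarrow> \<bar>w1 r - w2 r\<bar> \<le> D"
  shows "\<bar>primitive A w1 s - primitive B w2 s\<bar> \<le> \<bar>A - B\<bar> + D * t"
proof -
  have i: "w integrable_on {0..s}" if "continuous_on UNIV w" for w :: "real \<Rightarrow> real"
    by (intro integrable_continuous_interval continuous_on_subset[OF that]) auto
  have D: "0 \<le> D" using assms(5)[of 0] assms by fastforce
  have "norm (integral {0..s} (\<lambda>r. w1 r - w2 r)) \<le> D * (s - 0)"
    using assms by (intro integral_bound continuous_intros continuous_on_subset[OF assms(1)] continuous_on_subset[OF assms(2)]) auto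
  also have "\<dots> \<le> D * t" using D assms by (intro mult_left_mono) auto
  finally have "\<bar>integral {0..s} w1 - integral {0..s} w2\<bar> \<le> D * t"
    using i assms by (simp add: integral_diff)
  then show ?thesis using assms by (simp add: primitive_def max_absorb2)
qed

text \<open>The shooting argument. \<open>Up\<close> collects the \<open>A\<close> for which \<open>f - U\<close> turns to increase while it is still positive,
\<open>Down\<close> those for which it becomes negative while still decreasing; on \<open>{0<..\<rho>}\<close> the slope is below \<open>V\<close> for all
\<open>A\<close> in question. For \<open>A\<close> in neither set, the first time \<open>t0\<close> at which \<open>U < f\<close> or \<open>w < V\<close> fails would be a
tangential contact, or would put \<open>A\<close> into one of the two sets: if only \<open>f = U\<close> then \<open>f - U\<close> changes sign right
after \<open>t0\<close>, and if only \<open>w = V\<close> then \<open>(w - V)' = \<alpha> / 2 * (f - U) > 0\<close>.\<close>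
lemma connecting_profile_exists:
  obtains f w :: "real \<Rightarrow> real" and A where
    "0 < A" "f 0 = A" "continuous_on UNIV f"
    "\<And>\<eta>. 0 < \<eta> \<Longrightarrow> (f has_real_derivative w \<eta>) (at \<eta>)"
    "\<And>\<eta>. 0 < \<eta> \<Longrightarrow> (w has_real_derivative \<alpha> / 2 * f \<eta> + w \<eta> powr q - ((real N - 1) / \<eta> + \<eta> / 2) * w \<eta>) (at \<eta>)"
    "\<And>\<eta>. 0 < \<eta> \<Longrightarrow> 0 < w \<eta>" "\<And>\<eta>. 0 < \<eta> \<Longrightarrow> w \<eta> \<le> V \<eta>"
    "\<And>\<eta>. 0 \<le> \<eta> \<Longrightarrow> U \<eta> \<le> f \<eta>" "\<And>\<eta>. 0 \<le> \<eta> \<Longrightarrow> f \<eta> \<le> U \<eta> + A"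
proof -
  \<comment> \<open>For \<open>A = A1\<close> the slope at \<open>1\<close> exceeds \<open>V 1\<close> while the profile is still above \<open>U\<close>.\<close>
  obtain A1 where A1: "U 1 < A1" "V 1 * P 1 < \<alpha> * A1 / (2 * real N)"
  proof (rule that[of "max (U 1) (V 1 * P 1 * (2 * real N) / \<alpha>) + 1"])
    have "V 1 * P 1 * (2 * real N) / \<alpha> < max (U 1) (V 1 * P 1 * (2 * real N) / \<alpha>) + 1" by linarith
    then show "V 1 * P 1 < \<alpha> * (max (U 1) (V 1 * P 1 * (2 * real N) / \<alpha>) + 1) / (2 * real N)"
      using \<alpha> N by (simp add: field_simps)
  qed auto
  have A1pos: "0 < A1" using A1 U_nonneg[of 1] by linarith
  \<comment> \<open>Chosen after \<open>A1\<close>, so that the slopes for \<open>A \<le> A1\<close> stay below the cap on \<open>{0..\<rho>}\<close>.\<close>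
  define \<rho> where "\<rho> = min 1 (\<kappa> / (\<alpha> * A1 * exp (\<alpha> / 4)))"
  have \<rho>: "0 < \<rho>" "\<rho> \<le> 1" using \<kappa> \<alpha> A1pos by (auto simp: \<rho>_def)
  have \<rho>k: "\<alpha> / 2 * \<rho> * (A1 * exp (\<alpha> / 4)) < \<kappa>"
  proof -
    have "\<rho> * (\<alpha> * A1 * exp (\<alpha> / 4)) \<le> \<kappa>"
      using \<alpha> A1pos by (simp add: \<rho>_def min_def pos_le_divide_eq not_le)
    then show ?thesis using \<kappa>(1) by (simp add: mult_ac)
  qed
  obtain w where wc: "\<And>A. continuous_on UNIV (w A)" and wT: "\<And>A \<eta>. w A \<eta> = T \<rho> A (w A) \<eta>"
    and wL: "\<And>A B \<eta>. 0 \<le> \<eta> \<Longrightarrow> \<bar>w A \<eta> - w B \<eta>\<bar> \<le> \<bar>A - B\<bar> * exp (lam \<rho> * \<eta>)"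
    using shooting_family_exists[OF \<rho>(1)] by blast
  have sol: "solves \<rho> A (w A)" for A unfolding solves_def using \<rho>(1) wc wT by blast
  define F where "F A = primitive A (w A)" for A
  have Fc: "continuous_on S (F A)" for A S
    unfolding F_def by (rule continuous_on_subset[OF primitive_continuous[OF wc]]) simp
  have wc': "continuous_on S (w A)" for A S by (rule continuous_on_subset[OF wc]) simp
  have close: "\<exists>\<delta>>0. \<forall>B. \<bar>A - B\<bar> < \<delta> \<longrightarrow> (\<forall>s. 0 \<le> s \<longrightarrow> s \<le> t \<longrightarrow> \<bar>w A s - w B s\<bar> < e \<and> \<bar>F A s - F B s\<bar> < e)"
    if "0 \<le> t" "0 < e" for A t e
  proof -
    define G where "G = exp (lam \<rho> * t)"
    have G: "1 \<le> G" using that lam[of \<rho>] by (simp add: G_def)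
    have wG: "\<bar>w A s - w B s\<bar> \<le> \<bar>A - B\<bar> * G" if "0 \<le> s" "s \<le> t" for A B s
      using that lam[of \<rho>] unfolding G_def by (intro order_trans[OF wL] mult_left_mono) auto
    have FG: "\<bar>F A s - F B s\<bar> \<le> \<bar>A - B\<bar> * (1 + G * t)" if "0 \<le> s" "s \<le> t" for A B s
      using primitive_diff_le[OF wc wc that wG] unfolding F_def by (simp add: algebra_simps)
    define H where "H = G + (1 + G * t)"
    have H: "G \<le> H" "1 + G * t \<le> H" "0 < H" using G that mult_nonneg_nonneg[of G t] by (auto simp: H_def simp del: mult_nonneg_nonneg)
    show ?thesis
    proof (intro exI[of _ "e / H"] conjI allI impI)
      fix B s assume B: "\<bar>A - B\<bar> < e / H" and s: "0 \<le> s" "s \<le> t"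
      have AH: "\<bar>A - B\<bar> * H < e" using B H by (simp add: pos_less_divide_eq)
      show "\<bar>w A s - w B s\<bar> < e"
        using wG[OF s, of A B] mult_left_mono[OF H(1), of "\<bar>A - B\<bar>"] AH by linarith
      show "\<bar>F A s - F B s\<bar> < e"
        using FG[OF s, of A B] mult_left_mono[OF H(2), of "\<bar>A - B\<bar>"] AH by linarith
    qed (use that H in auto)
  qed
  have below: "w A s < cap \<rho> s \<and> w A s < V s" if "0 \<le> A" "A \<le> A1" "0 < s" "s \<le> \<rho>" for A s
  proof -
    have "s\<^sup>2 \<le> 1" using that \<rho> by (intro power_le_one) auto
    then have e: "exp (\<alpha> * s\<^sup>2 / 4) \<le> exp (\<alpha> / 4)" using \<alpha> by (simp add: mult_left_le)
    have "F A s \<le> A * exp (\<alpha> * s\<^sup>2 / 4)"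
      unfolding F_def using that by (intro primitive_upper_bound[OF sol]) auto
    also have "\<dots> \<le> A1 * exp (\<alpha> / 4)" using e that A1pos by (intro mult_mono) auto
    finally have F1: "F A s \<le> A1 * exp (\<alpha> / 4)" .
    have F0: "0 \<le> F A s" using primitive_mono[OF sol that(1), of 0 s] that unfolding F_def by simp
    have "w A s \<le> \<alpha> / 2 * s * F A s"
      unfolding F_def using that by (intro solution_upper_bound[OF sol]) auto
    also have "\<dots> \<le> \<alpha> / 2 * \<rho> * (A1 * exp (\<alpha> / 4))" using F0 F1 that \<alpha> by (intro mult_mono) auto
    also have "\<dots> < \<kappa>" by (rule \<rho>k)
    also have "\<kappa> \<le> cap \<rho> s"
    proof -
      have "1 \<le> \<rho> powr (\<alpha> - 1)" using \<rho> \<alpha> powr_mono2'[of "\<alpha> - 1" \<rho> 1] by simp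
      then show ?thesis using that \<kappa>(1) by (simp add: cap_def max_absorb2)
    qed
    finally show ?thesis using cap(3)[OF \<rho>(1) that(3)] by simp
  qed
  define Up where "Up = {A. \<exists>t>0. V t < w A t \<and> (\<forall>s\<in>{0..t}. U s < F A s)}"
  define Down where "Down = {A. \<exists>t>0. F A t < U t \<and> (\<forall>s\<in>{\<rho>..t}. w A s < V s)}"
  have "open {A. \<exists>t>0. 0 < w A t - V t \<and> (\<forall>s\<in>{0..t}. 0 < F A s - U s)}"
  proof (rule open_shooting_condition)
    show "continuous_on {0..t} (\<lambda>s. F A s - U s)" for A t
      by (intro continuous_intros Fc continuous_on_subset[OF U_continuous]) auto
  qed (use close in \<open>simp_all add: abs_minus_commute\<close>)
  then have "open Up" by (simp add: Up_def)
  moreover have "open Down"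
  proof -
    have "open {A. \<exists>t>0. 0 < U t - F A t \<and> (\<forall>s\<in>{\<rho>..t}. 0 < V s - w A s)}"
    proof (rule open_shooting_condition)
      show "continuous_on {\<rho>..t} (\<lambda>s. V s - w A s)" for A t
        using \<rho>(1) by (intro continuous_intros wc' continuous_on_subset[OF V_continuous]) auto
    qed (use close \<rho>(1) in \<open>simp_all add: abs_minus_commute conj_commute\<close>)
    then show ?thesis by (simp add: Down_def)
  qed
  moreover have "Up \<inter> Down \<inter> {0..A1} = {}"
  proof (rule ccontr)
    assume "Up \<inter> Down \<inter> {0..A1} \<noteq> {}"
    then obtain A where A: "0 \<le> A" "A \<le> A1" and "A \<in> Up" "A \<in> Down" by auto
    then obtain t t' where t: "0 < t" "V t < w A t" "\<forall>s\<in>{0..t}. U s < F A s"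
      and t': "0 < t'" "F A t' < U t'" "\<forall>s\<in>{\<rho>..t'}. w A s < V s"
      unfolding Up_def Down_def by blast
    have "t < t'"
    proof (rule ccontr)
      assume "\<not> t < t'"
      then show False using bspec[OF t(3), of t'] t'(1,2) by simp
    qed
    moreover have "\<rho> < t"
    proof (rule ccontr)
      assume "\<not> \<rho> < t"
      then show False using below[OF A t(1)] t(2) by simp
    qed
    ultimately show False using bspec[OF t'(3), of t] t(2) by auto
  qed
  moreover have "0 \<in> Down"
  proof -
    have "F 0 s \<le> 0" if "0 \<le> s" for s
      using primitive_upper_bound[OF sol[of 0], of s] that unfolding F_def by simp
    moreover have "0 \<le> F 0 s" if "0 \<le> s" for s
      using primitive_mono[OF sol[of 0], of 0 s] that unfolding F_def by simp
    ultimately have F0: "F 0 s = 0" if "0 \<le> s" for s using that by (meson antisym)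
    have "w 0 s \<le> 0" if "0 \<le> s" for s
      using solution_upper_bound[OF sol[of 0] _ that] F0[OF that] unfolding F_def by simp
    then have "w 0 s < V s" if "0 < s" for s using V_pos[OF that] that by (smt (verit))
    moreover have "0 < U 1" using C_tilde_pos by (simp add: U_def)
    ultimately show ?thesis unfolding Down_def using F0[of 1] \<rho>(1) by (auto intro!: exI[of _ 1])
  qed
  moreover have "A1 \<in> Up"
  proof -
    have "U s < F A1 s" if "s \<in> {0..1}" for s
    proof -
      have "U s \<le> U 1" using that \<alpha> C_tilde_pos unfolding U_def
        by (intro mult_left_mono powr_mono2) auto
      also have "\<dots> < A1" by (rule A1)
      also have "A1 \<le> F A1 s" using primitive_mono[OF sol[of A1], of 0 s] that A1pos unfolding F_def by simp
      finally show ?thesis .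
    qed
    moreover have "V 1 < w A1 1"
    proof -
      have "V 1 * P 1 < w A1 1 * P 1"
        using solution_lower_bound[OF sol[of A1], of 1] A1 A1pos by simp
      then show ?thesis using P(3)[of 1] by simp
    qed
    ultimately show ?thesis unfolding Up_def by (auto intro!: exI[of _ 1])
  qed
  ultimately obtain A where A: "0 \<le> A" "A \<le> A1" "A \<notin> Up" "A \<notin> Down"
    using connectedD[OF connected_Icc[of 0 A1], of Up Down] A1pos
    by (metis (no_types, lifting) atLeastAtMost_iff disjoint_iff less_imp_le order_refl subsetI Un_iff)
  have "A \<noteq> 0" using A \<open>0 \<in> Down\<close> by auto
  then have Apos: "0 < A" using A by simp
  have notUp: "\<exists>s\<in>{0..t}. F A s \<le> U s" if "0 < t" "V t < w A t" for t
    using A(3) that unfolding Up_def mem_Collect_eq by (meson not_le)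
  have notDown: "\<exists>s\<in>{\<rho>..t}. V s \<le> w A s" if "0 < t" "F A t < U t" for t
    using A(4) that unfolding Down_def mem_Collect_eq by (meson not_le)
  have F0: "F A 0 = A" by (simp add: F_def)
  have U0: "U 0 = 0" by (simp add: U_def)
  have dF: "(F A has_real_derivative w A s) (at s)" if "0 < s" for s
    unfolding F_def using primitive_has_derivative[OF wc that] .
  have dw: "(w A has_real_derivative \<alpha> / 2 * F A s + g \<rho> s (w A s) - ((real N - 1) / s + s / 2) * w A s) (at s)"
    if "0 < s" for s
    unfolding F_def using solution_has_derivative[OF sol A(1) that] .
  have w0: "0 \<le> w A s" for s using solution_nonneg[OF sol A(1)] .
  have gw: "g \<rho> s (w A s) = w A s powr q" if "0 < s" "w A s \<le> V s" for s
  proof -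
    have "w A s \<le> cap \<rho> s"
      using below[OF A(1,2) that(1)] that cap(4)[OF \<rho>(1), of s] by (cases "s \<le> \<rho>") auto
    then show ?thesis using w0 by (simp add: g_def)
  qed
  \<comment> \<open>The times at which one of the two strict inequalities fails; closedness provides a first one.\<close>
  define Z where "Z = {s. 0 \<le> s \<and> F A s - U s \<le> 0} \<union> {s. \<rho> \<le> s \<and> V s - w A s \<le> 0}"
  have "Z = {}"
  proof (rule ccontr)
    assume "Z \<noteq> {}"
    have "closed Z"
    proof -
      have "closed {s\<in>{0..}. F A s - U s \<le> 0}"
        by (intro continuous_on_closed_Collect_le continuous_intros Fc U_continuous)
      moreover have "closed {s\<in>{\<rho>..}. V s - w A s \<le> 0}"
      proof -
        have "continuous_on {\<rho>..} V" by (rule continuous_on_subset[OF V_continuous]) (use \<rho>(1) in auto)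
        then show ?thesis
          by (intro continuous_on_closed_Collect_le continuous_on_diff wc' continuous_on_const closed_atLeast)
      qed
      ultimately show ?thesis unfolding Z_def by (intro closed_Un) (simp_all only: atLeast_iff)
    qed
    have bdd: "bdd_below Z" unfolding Z_def using \<rho>(1) by (intro bdd_belowI[of _ 0]) auto
    define t0 where "t0 = Inf Z"
    have t0Z: "t0 \<in> Z" unfolding t0_def by (rule closed_contains_Inf[OF \<open>Z \<noteq> {}\<close> bdd \<open>closed Z\<close>])
    have before: "s \<notin> Z" if "s < t0" for s using cInf_lower[OF _ bdd, of s] that unfolding t0_def by force
    have t0: "0 < t0" using t0Z \<rho>(1) F0 U0 Apos unfolding Z_def by (auto simp: less_le)
    have dpos: "U s < F A s" if "0 \<le> s" "s < t0" for s using before[OF that(2)] that unfolding Z_def by auto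
    have dneg: "w A s < V s" if "0 < s" "s < t0" for s
      using before[OF that(2)] that below[OF A(1,2) that(1)] unfolding Z_def by (cases "s \<le> \<rho>") auto
    have d0: "U t0 \<le> F A t0"
    proof (rule ccontr)
      assume "\<not> U t0 \<le> F A t0"
      then obtain s where "s \<in> {\<rho>..t0}" "V s \<le> w A s" using notDown[OF t0] by auto
      then have s: "s = t0" "V t0 \<le> w A t0" "\<rho> \<le> t0" using dneg[of s] \<rho>(1) by (cases "s = t0"; force)+
      have "isCont (\<lambda>s. F A s - U s) t0"
        using DERIV_isCont[OF DERIV_diff[OF dF[OF t0] U_has_derivative[OF t0]]] .
      then have "((\<lambda>s. F A s - U s) \<longlongrightarrow> F A t0 - U t0) (at_left t0)"
        unfolding isCont_def by (rule tendsto_mono[rotated]) (simp add: at_le)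
      moreover have "\<forall>\<^sub>F s in at_left t0. 0 \<le> F A s - U s"
        unfolding eventually_at_left_field using t0 dpos by (intro exI[of _ 0]) (auto simp: less_imp_le)
      ultimately have "0 \<le> F A t0 - U t0" by (rule tendsto_lowerbound) simp
      then show False using \<open>\<not> U t0 \<le> F A t0\<close> by simp
    qed
    have d1: "w A t0 \<le> V t0"
    proof -
      have "((\<lambda>s. V s - w A s) \<longlongrightarrow> V t0 - w A t0) (at_left t0)"
        using DERIV_isCont[OF DERIV_diff[OF V_has_derivative[OF t0] dw[OF t0]]]
        unfolding isCont_def by (rule tendsto_mono[rotated]) (simp add: at_le)
      moreover have "\<forall>\<^sub>F s in at_left t0. 0 \<le> V s - w A s"
        unfolding eventually_at_left_field using t0 dneg by (intro exI[of _ 0]) (auto simp: less_imp_le)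
      ultimately have "0 \<le> V t0 - w A t0" by (rule tendsto_lowerbound) simp
      then show ?thesis by simp
    qed
    have wV: "0 \<le> w A s \<and> w A s \<le> V s" if "0 < s" "s \<le> t0" for s
      using w0 dneg[of s] d1 that by (cases "s = t0") auto
    consider "F A t0 = U t0" "w A t0 = V t0" | "F A t0 = U t0" "w A t0 < V t0" | "U t0 < F A t0" "w A t0 = V t0" "\<rho> \<le> t0"
      using d0 d1 t0Z unfolding Z_def by fastforce
    then show False
    proof cases
      case 1
      have "F A (t0 / 2) = U (t0 / 2)"
      proof (rule no_tangential_contact[OF t0 dF _ wV 1])
        show "(w A has_real_derivative \<alpha> / 2 * F A s + w A s powr q - ((real N - 1) / s + s / 2) * w A s) (at s)"
          if "0 < s" "s \<le> t0" for s
          using dw[OF that(1)] gw[OF that(1)] wV[OF that] by simp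
      qed (use t0 in auto)
      then show False using dpos[of "t0 / 2"] t0 by simp
    next
      case 2
      have dd: "((\<lambda>s. F A s - U s) has_real_derivative (w A t0 - V t0)) (at t0)"
        using DERIV_diff[OF dF[OF t0] U_has_derivative[OF t0]] .
      obtain e1 where e1: "0 < e1" "\<And>h. 0 < h \<Longrightarrow> h < e1 \<Longrightarrow> F A (t0 + h) - U (t0 + h) < F A t0 - U t0"
        using DERIV_neg_dec_right[OF dd] 2 by auto
      have "isCont (\<lambda>s. V s - w A s) t0"
        using DERIV_isCont[OF DERIV_diff[OF V_has_derivative[OF t0] dw[OF t0]]] .
      from isCont_pos_nearby[OF this] obtain e2 where e2: "0 < e2" "\<And>s. \<bar>s - t0\<bar> < e2 \<Longrightarrow> w A s < V s"
        using 2 by auto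
      define h where "h = min e1 e2 / 2"
      have h: "0 < h" "h < e1" "h < e2" using e1 e2 by (auto simp: h_def min_def)
      have "F A (t0 + h) < U (t0 + h)" using e1(2)[OF h(1,2)] 2 by simp
      then obtain s where s: "\<rho> \<le> s" "s \<le> t0 + h" "V s \<le> w A s" using notDown[of "t0 + h"] t0 h by auto
      show False using dneg[of s] e2(2)[of s] s h \<rho>(1) by (cases "s < t0") auto
    next
      case 3
      have "V t0 powr q = g \<rho> t0 (w A t0)" using gw[OF t0] 3 by simp
      then have dd: "((\<lambda>s. w A s - V s) has_real_derivative \<alpha> / 2 * (F A t0 - U t0)) (at t0)"
        using DERIV_diff[OF dw[OF t0] V_has_derivative[OF t0]] 3 by (simp add: right_diff_distrib)
      have "0 < \<alpha> / 2 * (F A t0 - U t0)" using \<alpha> 3 by simp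
      from DERIV_pos_inc_right[OF dd this]
      obtain e1 where e1: "0 < e1" "\<And>h. 0 < h \<Longrightarrow> h < e1 \<Longrightarrow> w A t0 - V t0 < w A (t0 + h) - V (t0 + h)" by auto
      have "isCont (\<lambda>s. F A s - U s) t0"
        using DERIV_isCont[OF DERIV_diff[OF dF[OF t0] U_has_derivative[OF t0]]] .
      from isCont_pos_nearby[OF this] obtain e2 where e2: "0 < e2" "\<And>s. \<bar>s - t0\<bar> < e2 \<Longrightarrow> U s < F A s"
        using 3 by auto
      define h where "h = min e1 e2 / 2"
      have h: "0 < h" "h < e1" "h < e2" using e1 e2 by (auto simp: h_def min_def)
      have "V (t0 + h) < w A (t0 + h)" using e1(2)[OF h(1,2)] 3 by simp
      then obtain s where s: "0 \<le> s" "s \<le> t0 + h" "F A s \<le> U s" using notUp[of "t0 + h"] t0 h by auto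
      show False using dpos[of s] e2(2)[of s] s h by (cases "s < t0") auto
    qed
  qed
  then have notZ: "s \<notin> Z" for s by simp
  have UF: "U s \<le> F A s" if "0 \<le> s" for s using notZ[of s] that unfolding Z_def by auto
  have wV: "w A s \<le> V s" if "0 < s" for s
    using notZ[of s] below[OF A(1,2) that] that unfolding Z_def by (cases "s \<le> \<rho>") auto
  show ?thesis
  proof (rule that[of A "F A" "w A"])
    show "(w A has_real_derivative \<alpha> / 2 * F A s + w A s powr q - ((real N - 1) / s + s / 2) * w A s) (at s)" if "0 < s" for s
      using dw[OF that] gw[OF that wV[OF that]] by simp
    show "0 < w A s" if "0 < s" for s
    proof -
      have "0 < \<alpha> * A / (2 * real N) * s ^ N" using \<alpha> Apos N that by simp
      then have "0 < w A s * P s" using solution_lower_bound[OF sol A(1), of s] that by linarith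
      then show ?thesis using P(3)[OF that] by (simp add: zero_less_mult_iff)
    qed
    show "F A s \<le> U s + A" if "0 \<le> s" for s
    proof (cases "s = 0")
      case False
      have "F A s - U s \<le> F A 0 - U 0"
      proof (rule DERIV_nonpos_imp_decreasing_open[of 0 s])
        fix x assume x: "0 < x" "x < s"
        show "\<exists>y. ((\<lambda>s. F A s - U s) has_real_derivative y) (at x) \<and> y \<le> 0"
          using DERIV_diff[OF dF[OF x(1)] U_has_derivative[OF x(1)]] wV[OF x(1)] by (intro exI conjI) auto
      qed (use that in \<open>auto intro!: continuous_intros Fc continuous_on_subset[OF U_continuous]\<close>)
      then show ?thesis using F0 U0 by simp
    qed (use F0 U0 in simp)
  qed (use Apos F0 Fc dF wV UF in auto)
qed

end

section \<open>Test functions and local integrability\<close>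

lemma partial_line_derivative:
  assumes "\<phi> differentiable (at z)"
  shows "((\<lambda>h. \<phi> (z + h *\<^sub>R b)) has_real_derivative partial b \<phi> z) (at 0)"
proof -
  have D: "(\<phi> has_derivative frechet_derivative \<phi> (at z)) (at (z + 0 *\<^sub>R b))"
    using assms by (simp add: frechet_derivative_works)
  have "((\<lambda>h. z + h *\<^sub>R b) has_derivative (\<lambda>h. h *\<^sub>R b)) (at 0)"
    by (auto intro!: derivative_eq_intros)
  from has_derivative_compose[OF this D]
  have "((\<lambda>h. \<phi> (z + h *\<^sub>R b)) has_derivative (\<lambda>h. frechet_derivative \<phi> (at z) (h *\<^sub>R b))) (at 0)" .
  moreover have "frechet_derivative \<phi> (at z) (h *\<^sub>R b) = partial b \<phi> z * h" for h
    using linear_cmul[OF linear_frechet_derivative[OF assms], of h b] by (simp add: partial_def)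
  ultimately show ?thesis by (simp add: has_field_derivative_def)
qed

lemma smooth_differentiable:
  assumes "smooth \<phi>" shows "\<phi> differentiable (at x)"
proof -
  have "C_k (Suc 0) \<phi>" using assms unfolding smooth_def by (rule spec)
  then show ?thesis by simp
qed

lemma smooth_partial:
  assumes "smooth \<phi>" "b \<in> Basis" shows "smooth (partial b \<phi>)"
  unfolding smooth_def
proof
  fix k
  have "C_k (Suc k) \<phi>" using assms(1) unfolding smooth_def by (rule spec)
  then show "C_k k (partial b \<phi>)" using assms(2) by simp
qed

lemma smooth_continuous:
  assumes "smooth \<phi>" shows "continuous_on S \<phi>"
proof -
  have "C_k 0 \<phi>" using assms unfolding smooth_def by (rule spec)
  then have "continuous_on UNIV \<phi>" by simp
  then show ?thesis by (rule continuous_on_subset) simp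
qed

lemma supp_vanish:
  assumes "x \<notin> supp \<phi>" shows "\<phi> x = 0"
proof (rule ccontr)
  assume "\<phi> x \<noteq> 0"
  then have "x \<in> closure {x. \<phi> x \<noteq> 0}" using closure_subset[of "{x. \<phi> x \<noteq> 0}"] by blast
  then show False using assms by (simp add: supp_def)
qed

lemma compact_norm_bound:
  assumes "compact (supp \<psi>)" obtains R where "1 \<le> R" "\<And>x. R < norm x \<Longrightarrow> \<psi> x = 0"
proof -
  obtain R where R: "\<And>x. x \<in> supp \<psi> \<Longrightarrow> norm x \<le> R" using compact_imp_bounded[OF assms] by (auto simp: bounded_iff)
  show ?thesis
  proof (rule that[of "max 1 R"])
    show "\<psi> x = 0" if "max 1 R < norm x" for x using supp_vanish[of x \<psi>] R[of x] that by force
  qed simp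
qed

text \<open>Lets integrability be read off from bounds and continuity away from the singular set, on which the
gradients below carry junk values.\<close>
lemma absolutely_integrable_off_negligible:
  fixes h :: "'a::euclidean_space \<Rightarrow> 'b::euclidean_space"
  assumes S: "closed S" "negligible S" and K: "compact K" and h: "continuous_on (K - S) h"
    and B: "integrable lborel B" "\<And>z. z \<in> K - S \<Longrightarrow> norm (h z) \<le> B z"
  shows "h absolutely_integrable_on K"
proof (rule absolutely_integrable_spike[OF _ S(2)])
  have KS: "K - S \<in> sets borel" using S(1) compact_imp_closed[OF K] by auto
  have m: "(\<lambda>z. indicator (K - S) z *\<^sub>R h z) \<in> borel_measurable borel"
    by (rule borel_measurable_continuous_on_indicator[OF KS h])
  have "integrable lborel (\<lambda>z. indicator (K - S) z *\<^sub>R h z)"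
    by (rule Bochner_Integration.integrable_bound[OF B(1)])
      (use m order_trans[OF B(2) abs_ge_self] in \<open>auto simp: indicator_def\<close>)
  then have "integrable lebesgue (\<lambda>z. indicator (K - S) z *\<^sub>R h z)"
    using m by (simp add: integrable_completion)
  also have "(\<lambda>z. indicator (K - S) z *\<^sub>R h z) = (\<lambda>z. indicator K z *\<^sub>R (indicator (- S) z *\<^sub>R h z))"
    by (auto simp: indicator_def)
  finally show "(\<lambda>z. indicator (- S) z *\<^sub>R h z) absolutely_integrable_on K"
    unfolding set_integrable_def .
qed auto

lemma integrable_lborel_tensor:
  fixes p :: "'a::euclidean_space \<Rightarrow> real" and r :: "real \<Rightarrow> real"
  assumes p: "integrable lborel p" and r: "integrable lborel r"
  shows "integrable lborel (\<lambda>z. p (fst z) * r (snd z))"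
proof -
  have [measurable]: "p \<in> borel_measurable lborel" "r \<in> borel_measurable lborel" using assms by auto
  have "integrable (lborel \<Otimes>\<^sub>M lborel) (\<lambda>z. p (fst z) * r (snd z))"
  proof (rule lborel_pair.Fubini_integrable)
    show "integrable lborel (\<lambda>x. LINT y|lborel. norm (p (fst (x, y)) * r (snd (x, y))))"
      using p by (simp add: abs_mult)
    show "AE x in lborel. integrable lborel (\<lambda>y. p (fst (x, y)) * r (snd (x, y)))"
      using r by simp
  qed measurable
  then show ?thesis by (simp add: lborel_prod)
qed

lemma integrable_indicator_compact:
  "compact K \<Longrightarrow> integrable lborel (indicator K :: 'a::euclidean_space \<Rightarrow> real)"
  using emeasure_bounded_finite[of K] compact_imp_bounded[of K] borel_compact[of K]
  by (subst integrable_indicator_iff) auto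

lemma continuous_locally_integrable:
  fixes h :: "'a::euclidean_space \<Rightarrow> real"
  assumes "continuous_on UNIV h"
  shows "locally_integrable_on h UNIV"
  unfolding locally_integrable_on_def
proof (intro allI impI)
  fix K :: "'a set" assume "compact K \<and> K \<subseteq> UNIV"
  then have K: "compact K" by simp
  then have "compact (h ` K)" by (intro compact_continuous_image continuous_on_subset[OF assms]) auto
  then obtain B where "\<And>x. x \<in> K \<Longrightarrow> \<bar>h x\<bar> \<le> B"
    using compact_imp_bounded[of "h ` K"] by (auto simp: bounded_iff)
  then show "h absolutely_integrable_on K"
    using integrable_indicator_compact[OF K]
    by (intro absolutely_integrable_off_negligible[where S="{}" and B="\<lambda>x. B * indicator K x"])
      (auto intro: K continuous_on_subset[OF assms])
qed

lemma negligible_axis: "negligible ({0::'a::euclidean_space} \<times> (UNIV :: real set))"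
proof -
  obtain b :: 'a where b: "b \<in> Basis" using nonempty_Basis by blast
  have "negligible {z :: 'a \<times> real. (b, 0) \<bullet> z = 0}"
    using b by (intro negligible_hyperplane) (auto simp: zero_prod_def nonzero_Basis)
  then show ?thesis by (rule negligible_subset) (auto simp: inner_prod_def)
qed

lemma absolutely_integrable_point_singularity:
  fixes h :: "'a::euclidean_space \<Rightarrow> 'b::euclidean_space" and \<gamma> C :: real
  assumes "0 \<le> \<gamma>" "\<gamma> < DIM('a)" "compact K" "continuous_on (K - {0}) h"
    and B: "\<And>x. x \<in> K \<Longrightarrow> x \<noteq> 0 \<Longrightarrow> norm (h x) \<le> C * norm x powr - \<gamma>"
  shows "h absolutely_integrable_on K"
proof -
  obtain R where R: "\<And>x. x \<in> K \<Longrightarrow> norm x \<le> R"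
    using compact_imp_bounded[OF assms(3)] by (auto simp: bounded_iff)
  show ?thesis
  proof (rule absolutely_integrable_off_negligible[where S="{0}"])
    show "integrable lborel (\<lambda>x::'a. C * (indicator (cball 0 R) x * norm x powr - \<gamma>))"
      using integrable_norm_powr_cball[OF assms(1,2)] by simp
    show "norm (h x) \<le> C * (indicator (cball 0 R) x * norm x powr - \<gamma>)" if "x \<in> K - {0}" for x
      using B[of x] R[of x] that by simp
  qed (simp_all add: assms)
qed

text \<open>The space-time version: a function singular on the time axis, with a bound by a power of the distance
to the axis that is integrable over space.\<close>
lemma absolutely_integrable_axis_singularity:
  fixes h :: "'a::euclidean_space \<times> real \<Rightarrow> 'b::euclidean_space" and \<gamma> C :: real
  assumes "0 \<le> \<gamma>" "\<gamma> < DIM('a)" "compact K" "continuous_on (K - {0} \<times> UNIV) h"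
    and B: "\<And>x t. (x, t) \<in> K \<Longrightarrow> x \<noteq> 0 \<Longrightarrow> norm (h (x, t)) \<le> C * norm x powr - \<gamma>"
  shows "h absolutely_integrable_on K"
proof -
  have "bounded (fst ` K)" "bounded (snd ` K)"
    using compact_imp_bounded[OF assms(3)] by (auto intro: bounded_fst bounded_snd)
  then obtain R T where R: "\<And>x t. (x, t) \<in> K \<Longrightarrow> norm x \<le> R" "\<And>x t. (x, t) \<in> K \<Longrightarrow> \<bar>t\<bar> \<le> T"
    by (fastforce simp: bounded_iff)
  show ?thesis
  proof (rule absolutely_integrable_off_negligible[where S="{0} \<times> UNIV"])
    show "integrable lborel (\<lambda>z::'a \<times> real. (C * (indicator (cball 0 R) (fst z) * norm (fst z) powr - \<gamma>)) * indicator {-T..T} (snd z))"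
      using integrable_norm_powr_cball[OF assms(1,2)]
      by (intro integrable_lborel_tensor integrable_indicator_compact) auto
    show "norm (h z) \<le> (C * (indicator (cball 0 R) (fst z) * norm (fst z) powr - \<gamma>)) * indicator {-T..T} (snd z)"
      if "z \<in> K - {0} \<times> UNIV" for z
    proof -
      obtain x t where z: "z = (x, t)" by force
      then have "x \<noteq> 0" "(x, t) \<in> K" using that by auto
      then show ?thesis using B[of x t] R[of x t] z by (auto simp: abs_le_iff)
    qed
  qed (simp_all add: assms negligible_axis closed_Times)
qed

section \<open>Radial functions\<close>

lemma radial_line_derivatives:
  fixes x b :: "'a::euclidean_space" and F G H :: "real \<Rightarrow> real"
  assumes x: "x \<noteq> 0" and b: "b \<in> Basis"
    and F: "(F has_real_derivative G (norm x)) (at (norm x))"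
    and G: "(G has_real_derivative H (norm x)) (at (norm x))"
  shows "((\<lambda>h. F (norm (x + h *\<^sub>R b))) has_real_derivative G (norm x) * ((x \<bullet> b) / norm x)) (at 0)"
    "((\<lambda>h. G (norm (x + h *\<^sub>R b)) * (((x + h *\<^sub>R b) \<bullet> b) / norm (x + h *\<^sub>R b))) has_real_derivative
       H (norm x) * ((x \<bullet> b) / norm x)\<^sup>2 + G (norm x) / norm x * (1 - ((x \<bullet> b) / norm x)\<^sup>2)) (at 0)"
proof -
  note n = norm_has_line_derivative[OF x, of b]
  have F': "(F has_real_derivative G (norm x)) (at (norm (x + 0 *\<^sub>R b)))" using F by simp
  have G': "(G has_real_derivative H (norm x)) (at (norm (x + 0 *\<^sub>R b)))" using G by simp
  show "((\<lambda>h. F (norm (x + h *\<^sub>R b))) has_real_derivative G (norm x) * ((x \<bullet> b) / norm x)) (at 0)"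
    using DERIV_chain2[OF F' n] .
  have 1: "((\<lambda>h. G (norm (x + h *\<^sub>R b))) has_real_derivative H (norm x) * ((x \<bullet> b) / norm x)) (at 0)"
    using DERIV_chain2[OF G' n] .
  have "((\<lambda>h. (x + h *\<^sub>R b) \<bullet> b) has_real_derivative 1) (at 0)"
    using b by (auto intro!: derivative_eq_intros simp: inner_add_left)
  moreover have "norm (x + 0 *\<^sub>R b) \<noteq> 0" using x by simp
  ultimately have 2: "((\<lambda>h. ((x + h *\<^sub>R b) \<bullet> b) / norm (x + h *\<^sub>R b)) has_real_derivative
      (1 * norm (x + 0 *\<^sub>R b) - ((x + 0 *\<^sub>R b) \<bullet> b) * ((x \<bullet> b) / norm x)) / (norm (x + 0 *\<^sub>R b) * norm (x + 0 *\<^sub>R b))) (at 0)"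
    using DERIV_divide[OF _ n] by blast
  define c where "c = (x \<bullet> b) / norm x"
  have xb: "x \<bullet> b = norm x * c" using x by (simp add: c_def)
  have "1 * norm x - (x \<bullet> b) * c = norm x * (1 - c\<^sup>2)"
    unfolding xb by (simp add: algebra_simps power2_eq_square)
  then have e: "(1 * norm x - (x \<bullet> b) * c) / (norm x * norm x) = (1 - c\<^sup>2) / norm x" using x by simp
  have 3: "((\<lambda>h. ((x + h *\<^sub>R b) \<bullet> b) / norm (x + h *\<^sub>R b)) has_real_derivative (1 - c\<^sup>2) / norm x) (at 0)"
    using 2 unfolding c_def[symmetric] scaleR_zero_left add_0_right e .
  have cong: "a * c * c + (1 - c\<^sup>2) / n * g = a * c\<^sup>2 + g / n * (1 - c\<^sup>2)" for a n g :: real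
    by (simp add: power2_eq_square mult.commute)
  have "((\<lambda>h. G (norm (x + h *\<^sub>R b)) * (((x + h *\<^sub>R b) \<bullet> b) / norm (x + h *\<^sub>R b))) has_real_derivative
       H (norm x) * c * c + (1 - c\<^sup>2) / norm x * G (norm x)) (at 0)"
    using DERIV_mult[OF 1 3] by (simp only: scaleR_zero_left add_0_right c_def)
  then show "((\<lambda>h. G (norm (x + h *\<^sub>R b)) * (((x + h *\<^sub>R b) \<bullet> b) / norm (x + h *\<^sub>R b))) has_real_derivative
       H (norm x) * ((x \<bullet> b) / norm x)\<^sup>2 + G (norm x) / norm x * (1 - ((x \<bullet> b) / norm x)\<^sup>2)) (at 0)"
    unfolding cong unfolding c_def .
qed

lemma sum_direction_cosines:
  fixes x :: "'a::euclidean_space"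
  assumes "x \<noteq> 0"
  shows "(\<Sum>b\<in>Basis. ((x \<bullet> b) / norm x)\<^sup>2) = 1"
proof -
  have "(\<Sum>b\<in>Basis. (x \<bullet> b)\<^sup>2) = x \<bullet> x"
    by (subst euclidean_inner) (simp add: power2_eq_square)
  also have "\<dots> = (norm x)\<^sup>2" by (rule power2_norm_eq_inner[symmetric])
  finally have "(\<Sum>b\<in>Basis. (x \<bullet> b)\<^sup>2) = (norm x)\<^sup>2" .
  then show ?thesis using assms by (simp add: power_divide sum_divide_distrib[symmetric])
qed

text \<open>A radial function \<open>F (norm x)\<close> with \<open>F' = G\<close> and \<open>G' = H\<close>, and with growth at the origin just mild enough for
integrating by parts twice. The bounds are only required up to the radius \<open>R\<close> that contains the support
of the test function.\<close>
locale radial_profile =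
  fixes F G H :: "real \<Rightarrow> real" and \<gamma> C R :: real and dim :: "'a::euclidean_space itself"
  assumes \<gamma>: "1 \<le> \<gamma>" "\<gamma> < DIM('a)"
    and F: "\<And>r. 0 < r \<Longrightarrow> (F has_real_derivative G r) (at r)"
    and G: "\<And>r. 0 < r \<Longrightarrow> (G has_real_derivative H r) (at r)"
    and H: "continuous_on {0<..} H"
    and bF: "\<And>r. 0 < r \<Longrightarrow> r \<le> R \<Longrightarrow> \<bar>F r\<bar> \<le> C * r powr (1 - \<gamma>)"
    and bG: "\<And>r. 0 < r \<Longrightarrow> r \<le> R \<Longrightarrow> \<bar>G r\<bar> \<le> C * r powr (1 - \<gamma>)"
    and bG': "\<And>r. 0 < r \<Longrightarrow> r \<le> R \<Longrightarrow> \<bar>G r\<bar> \<le> C * r powr - \<gamma>"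
    and bH: "\<And>r. 0 < r \<Longrightarrow> r \<le> R \<Longrightarrow> \<bar>H r\<bar> \<le> C * r powr - \<gamma>"
begin

lemma radial_continuous:
  "continuous_on (-{0::'a}) (\<lambda>x. F (norm x))" "continuous_on (-{0::'a}) (\<lambda>x. G (norm x))" "continuous_on (-{0::'a}) (\<lambda>x. H (norm x))"
proof -
  have "continuous_on {0<..} F" "continuous_on {0<..} G"
    using DERIV_isCont[OF F] DERIV_isCont[OF G] by (auto intro!: continuous_at_imp_continuous_on)
  then show "continuous_on (-{0::'a}) (\<lambda>x. F (norm x))" "continuous_on (-{0::'a}) (\<lambda>x. G (norm x))" "continuous_on (-{0::'a}) (\<lambda>x. H (norm x))"
    using H by (auto intro!: continuous_on_compose2[where f=norm] continuous_intros)
qed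

lemma cosine_le: "b \<in> Basis \<Longrightarrow> \<bar>(x \<bullet> b) / norm x\<bar> \<le> 1" for x b :: 'a
  using Basis_le_norm[of b x] by (cases "x = 0") (auto simp: abs_divide)

lemma gradient_by_parts:
  fixes \<psi> d :: "'a \<Rightarrow> real"
  assumes b: "b \<in> Basis" and \<psi>: "continuous_on UNIV \<psi>" "continuous_on UNIV d"
    and d: "\<And>x. ((\<lambda>h. \<psi> (x + h *\<^sub>R b)) has_real_derivative d x) (at 0)"
    and supp: "\<And>x. norm x > R \<Longrightarrow> \<psi> x = 0"
  shows "integrable lborel (\<lambda>x. F (norm x) * d x)"
    "(LINT x|lborel. F (norm x) * d x) = - (LINT x|lborel. G (norm x) * ((x \<bullet> b) / norm x) * \<psi> x)"
proof -
  have "\<bar>G (norm x) * ((x \<bullet> b) / norm x)\<bar> \<le> C * norm x powr - \<gamma>" if "x \<noteq> 0" "norm x \<le> R" for x :: 'a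
  proof -
    have "\<bar>G (norm x) * ((x \<bullet> b) / norm x)\<bar> \<le> \<bar>G (norm x)\<bar> * 1"
      unfolding abs_mult using cosine_le[OF b] by (intro mult_left_mono) auto
    also have "\<dots> \<le> C * norm x powr - \<gamma>" using bG'[of "norm x"] that by simp
    finally show ?thesis .
  qed
  note dG = this
  have c: "continuous_on (-{0::'a}) (\<lambda>x. G (norm x) * ((x \<bullet> b) / norm x))"
    using radial_continuous by (auto intro!: continuous_intros)
  have ld: "((\<lambda>h. F (norm (x + h *\<^sub>R b))) has_real_derivative G (norm x) * ((x \<bullet> b) / norm x)) (at 0)" if "x \<noteq> 0" for x
    using radial_line_derivatives(1)[OF that b, of F G H] F[of "norm x"] G[of "norm x"] that by simp
  have bv: "\<bar>F (norm x)\<bar> \<le> C * norm x powr (1 - \<gamma>)" if "x \<noteq> 0" "norm x \<le> R" for x :: 'a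
    using bF that by simp
  have nb: "norm b \<le> 1" using b by simp
  note * = integral_by_parts_singular[OF \<gamma> nb radial_continuous(1) c \<psi> ld d bv dG supp]
  show "integrable lborel (\<lambda>x. F (norm x) * d x)" by (rule *(1)) auto
  show "(LINT x|lborel. F (norm x) * d x) = - (LINT x|lborel. G (norm x) * ((x \<bullet> b) / norm x) * \<psi> x)"
    by (rule *(3)) auto
qed

text \<open>Two integrations by parts in each coordinate direction; summing the second derivatives over the
directions leaves \<open>H + (N - 1) / r * G\<close>, since the squared direction cosines add up to \<open>1\<close>.\<close>
lemma laplacian_by_parts:
  fixes \<psi> :: "'a \<Rightarrow> real" and d dd :: "'a \<Rightarrow> 'a \<Rightarrow> real"
  assumes \<psi>: "continuous_on UNIV \<psi>" "\<And>b. b \<in> Basis \<Longrightarrow> continuous_on UNIV (d b)" "\<And>b. b \<in> Basis \<Longrightarrow> continuous_on UNIV (dd b)"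
    and d: "\<And>x b. b \<in> Basis \<Longrightarrow> ((\<lambda>h. \<psi> (x + h *\<^sub>R b)) has_real_derivative d b x) (at 0)"
    and dd: "\<And>x b. b \<in> Basis \<Longrightarrow> ((\<lambda>h. d b (x + h *\<^sub>R b)) has_real_derivative dd b x) (at 0)"
    and supp: "\<And>x. norm x > R \<Longrightarrow> \<psi> x = 0"
  shows "integrable lborel (\<lambda>x. F (norm x) * (\<Sum>b\<in>Basis. dd b x))"
    "integrable lborel (\<lambda>x. (H (norm x) + (real DIM('a) - 1) / norm x * G (norm x)) * \<psi> x)"
    "(LINT x|lborel. F (norm x) * (\<Sum>b\<in>Basis. dd b x)) =
       (LINT x|lborel. (H (norm x) + (real DIM('a) - 1) / norm x * G (norm x)) * \<psi> x)"
proof -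
  define W where "W b x = H (norm x) * ((x \<bullet> b) / norm x)\<^sup>2 + G (norm x) / norm x * (1 - ((x \<bullet> b) / norm x)\<^sup>2)" for b x :: 'a
  have supp': "d b x = 0" if "b \<in> Basis" "norm x > R" for b x
    using line_derivative_vanish[OF supp that(2) d[OF that(1)]] .
  have 1: "integrable lborel (\<lambda>x. F (norm x) * dd b x)"
    "(LINT x|lborel. F (norm x) * dd b x) = - (LINT x|lborel. G (norm x) * ((x \<bullet> b) / norm x) * d b x)" if b: "b \<in> Basis" for b
    using gradient_by_parts[OF b \<psi>(2,3)[OF b] dd[OF b] supp'[OF b]] by auto
  have 2: "integrable lborel (\<lambda>x. W b x * \<psi> x)"
    "(LINT x|lborel. G (norm x) * ((x \<bullet> b) / norm x) * d b x) = - (LINT x|lborel. W b x * \<psi> x)" if b: "b \<in> Basis" for b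
  proof -
    have bd1: "\<bar>G (norm x) * ((x \<bullet> b) / norm x)\<bar> \<le> (2 * \<bar>C\<bar>) * norm x powr (1 - \<gamma>)" if "x \<noteq> 0" "norm x \<le> R" for x :: 'a
    proof -
      have "\<bar>G (norm x) * ((x \<bullet> b) / norm x)\<bar> \<le> \<bar>G (norm x)\<bar> * 1"
        unfolding abs_mult using cosine_le[OF b] by (intro mult_left_mono) auto
      also have "\<dots> \<le> C * norm x powr (1 - \<gamma>)" using bG[of "norm x"] that by simp
      also have "\<dots> \<le> (2 * \<bar>C\<bar>) * norm x powr (1 - \<gamma>)" by (intro mult_right_mono) auto
      finally show ?thesis .
    qed
    have bd2: "\<bar>W b x\<bar> \<le> (2 * \<bar>C\<bar>) * norm x powr - \<gamma>" if "x \<noteq> 0" "norm x \<le> R" for x :: 'a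
    proof -
      have c2: "((x \<bullet> b) / norm x)\<^sup>2 \<le> 1" using cosine_le[OF b, of x] by (simp add: abs_square_le_1)
      have "\<bar>G (norm x)\<bar> / norm x \<le> C * norm x powr (1 - \<gamma>) / norm x"
        using bG[of "norm x"] that by (intro divide_right_mono) auto
      also have "\<dots> = C * norm x powr - \<gamma>" using that by (simp add: powr_diff powr_minus divide_simps)
      finally have g: "\<bar>G (norm x) / norm x\<bar> \<le> C * norm x powr - \<gamma>" by (simp add: abs_divide)
      have "\<bar>H (norm x) * ((x \<bullet> b) / norm x)\<^sup>2\<bar> \<le> \<bar>H (norm x)\<bar>"
        unfolding abs_mult using c2 by (intro mult_left_le) auto
      moreover have "\<bar>G (norm x) / norm x * (1 - ((x \<bullet> b) / norm x)\<^sup>2)\<bar> \<le> \<bar>G (norm x) / norm x\<bar>"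
        unfolding abs_mult[of "G (norm x) / norm x"] using c2 by (intro mult_left_le) auto
      ultimately have "\<bar>W b x\<bar> \<le> \<bar>H (norm x)\<bar> + \<bar>G (norm x) / norm x\<bar>"
        unfolding W_def by linarith
      also have "\<dots> \<le> (2 * C) * norm x powr - \<gamma>" using g bH[of "norm x"] that by simp
      also have "\<dots> \<le> (2 * \<bar>C\<bar>) * norm x powr - \<gamma>" by (intro mult_right_mono) auto
      finally show ?thesis .
    qed
    have c: "continuous_on (-{0::'a}) (\<lambda>x. G (norm x) * ((x \<bullet> b) / norm x))" "continuous_on (-{0::'a}) (W b)"
      unfolding W_def using radial_continuous by (auto intro!: continuous_intros)
    have ld: "((\<lambda>h. G (norm (x + h *\<^sub>R b)) * (((x + h *\<^sub>R b) \<bullet> b) / norm (x + h *\<^sub>R b))) has_real_derivative W b x) (at 0)"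
      if "x \<noteq> 0" for x
      unfolding W_def using radial_line_derivatives(2)[OF that b, of F G H] F[of "norm x"] G[of "norm x"] that by simp
    note * = integral_by_parts_singular[OF \<gamma> _ c \<psi>(1) \<psi>(2)[OF b] ld d[OF b] bd1 bd2 supp]
    show "integrable lborel (\<lambda>x. W b x * \<psi> x)" by (rule *(2)) (use b in auto)
    show "(LINT x|lborel. G (norm x) * ((x \<bullet> b) / norm x) * d b x) = - (LINT x|lborel. W b x * \<psi> x)"
      by (rule *(3)) (use b in auto)
  qed
  have ae: "AE x::'a in lborel. x \<noteq> 0" by (rule AE_lborel_singleton)
  have W: "(\<Sum>b\<in>Basis. W b x) = H (norm x) + (real DIM('a) - 1) / norm x * G (norm x)" if "x \<noteq> 0" for x :: 'a
  proof -
    have "(\<Sum>b\<in>Basis. W b x) = H (norm x) * (\<Sum>b\<in>Basis. ((x \<bullet> b) / norm x)\<^sup>2)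
        + G (norm x) / norm x * (\<Sum>b\<in>Basis. 1 - ((x \<bullet> b) / norm x)\<^sup>2)"
      by (simp only: W_def sum.distrib sum_distrib_left)
    then show ?thesis using sum_direction_cosines[OF that] by (simp add: sum_subtractf mult.commute)
  qed
  have WS: "(\<Sum>b\<in>Basis. W b x * \<psi> x) = (H (norm x) + (real DIM('a) - 1) / norm x * G (norm x)) * \<psi> x" if "x \<noteq> 0" for x :: 'a
    using W[OF that] by (simp add: sum_distrib_right[symmetric])
  have intW: "integrable lborel (\<lambda>x. \<Sum>b\<in>Basis. W b x * \<psi> x)" using 2 by (intro Bochner_Integration.integrable_sum) auto
  have [measurable]: "(\<lambda>x::'a. F (norm x)) \<in> borel_measurable borel" "(\<lambda>x::'a. G (norm x)) \<in> borel_measurable borel"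
    "(\<lambda>x::'a. H (norm x)) \<in> borel_measurable borel"
    using radial_continuous by (auto intro: borel_measurable_continuous_countable_exceptions[of "{0}"])
  have [measurable]: "\<psi> \<in> borel_measurable borel" using \<psi>(1) by (rule borel_measurable_continuous_onI)
  show "integrable lborel (\<lambda>x. F (norm x) * (\<Sum>b\<in>Basis. dd b x))"
    unfolding sum_distrib_left using 1 by (intro Bochner_Integration.integrable_sum) auto
  show "integrable lborel (\<lambda>x. (H (norm x) + (real DIM('a) - 1) / norm x * G (norm x)) * \<psi> x)"
    by (rule integrable_cong_AE_imp[OF intW]) (use ae WS in \<open>auto elim!: eventually_mono\<close>)
  have "(LINT x|lborel. F (norm x) * (\<Sum>b\<in>Basis. dd b x)) = (\<Sum>b\<in>Basis. LINT x|lborel. F (norm x) * dd b x)"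
    unfolding sum_distrib_left using 1 by (intro Bochner_Integration.integral_sum) auto
  also have "\<dots> = (\<Sum>b\<in>Basis. LINT x|lborel. W b x * \<psi> x)"
    using 1 2 by (intro sum.cong) auto
  also have "\<dots> = (LINT x|lborel. (\<Sum>b\<in>Basis. W b x * \<psi> x))"
    using 2 by (intro Bochner_Integration.integral_sum[symmetric]) auto
  also have "\<dots> = (LINT x|lborel. (H (norm x) + (real DIM('a) - 1) / norm x * G (norm x)) * \<psi> x)"
    by (rule integral_cong_AE) (use ae WS intW in \<open>auto elim!: eventually_mono\<close>)
  finally show "(LINT x|lborel. F (norm x) * (\<Sum>b\<in>Basis. dd b x)) =
       (LINT x|lborel. (H (norm x) + (real DIM('a) - 1) / norm x * G (norm x)) * \<psi> x)" .
qed

end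

section \<open>From profiles to functions of space and time\<close>

text \<open>Covers both solutions: \<open>f = U\<close>, \<open>w = V\<close>, \<open>A = 0\<close> is the stationary one.\<close>
locale self_similar_profile = profile_equation q N for q :: real and N :: nat +
  fixes f w :: "real \<Rightarrow> real" and A :: real and space_type :: "'a::euclidean_space itself"
  assumes dim: "DIM('a) = N" and A: "0 \<le> A"
    and fc: "continuous_on {0..} f"
    and df: "\<And>\<eta>. 0 < \<eta> \<Longrightarrow> (f has_real_derivative w \<eta>) (at \<eta>)"
    and dw: "\<And>\<eta>. 0 < \<eta> \<Longrightarrow>
      (w has_real_derivative \<alpha> / 2 * f \<eta> + w \<eta> powr q - ((real N - 1) / \<eta> + \<eta> / 2) * w \<eta>) (at \<eta>)"
    and w: "\<And>\<eta>. 0 < \<eta> \<Longrightarrow> 0 \<le> w \<eta>" "\<And>\<eta>. 0 < \<eta> \<Longrightarrow> w \<eta> \<le> V \<eta>"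
    and f: "\<And>\<eta>. 0 \<le> \<eta> \<Longrightarrow> U \<eta> \<le> f \<eta>" "\<And>\<eta>. 0 \<le> \<eta> \<Longrightarrow> f \<eta> \<le> U \<eta> + A"
begin

definition \<gamma> :: real where "\<gamma> = 2 - \<alpha>"

text \<open>At time \<open>t\<close> the solution is \<open>F t (norm x)\<close>, with radial derivatives \<open>G t\<close> and \<open>H t\<close> and time derivative \<open>Ft t\<close>.
The formula for \<open>H\<close> is the equation itself, solved for the second radial derivative.\<close>
definition F :: "real \<Rightarrow> real \<Rightarrow> real" where "F t r = t powr (\<alpha> / 2) * f (r / sqrt t)"
definition G :: "real \<Rightarrow> real \<Rightarrow> real" where "G t r = t powr ((\<alpha> - 1) / 2) * w (r / sqrt t)"
definition Ft :: "real \<Rightarrow> real \<Rightarrow> real" where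
  "Ft t r = t powr (\<alpha> / 2 - 1) * (\<alpha> / 2 * f (r / sqrt t) - (r / sqrt t) / 2 * w (r / sqrt t))"
definition H :: "real \<Rightarrow> real \<Rightarrow> real" where "H t r = Ft t r + G t r powr q - (real N - 1) / r * G t r"

lemma \<gamma>: "1 \<le> \<gamma>" "\<gamma> < DIM('a)" "0 \<le> \<gamma>"
  using \<alpha> N dim by (auto simp: \<gamma>_def)

lemma sqrt_powr: "0 < t \<Longrightarrow> sqrt t = t powr (1/2)"
  by (simp add: powr_half_sqrt)

lemma F_has_derivative:
  assumes "0 < t" "0 < r"
  shows "(F t has_real_derivative G t r) (at r)"
proof -
  have 1: "((\<lambda>r. r / sqrt t) has_real_derivative 1 / sqrt t) (at r)"
    using DERIV_cdivide[OF DERIV_ident] .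
  have 2: "(f has_real_derivative w (r / sqrt t)) (at (r / sqrt t))"
    using assms by (intro df) auto
  have "t powr (\<alpha> / 2) * (w (r / sqrt t) * (1 / sqrt t)) = G t r"
    using assms by (simp add: G_def sqrt_powr diff_divide_distrib powr_diff)
  then show ?thesis unfolding F_def[abs_def]
    using DERIV_cmult[OF DERIV_chain2[OF 2 1], of "t powr (\<alpha> / 2)"] by (simp only:)
qed

lemma G_nonneg: "0 < t \<Longrightarrow> 0 < r \<Longrightarrow> 0 \<le> G t r"
  unfolding G_def using w(1)[of "r / sqrt t"] by auto

text \<open>The stationary profile is invariant under the self-similar scaling, so bounds of the profile by \<open>U\<close> and \<open>V\<close>
become bounds in \<open>norm x\<close> that are uniform in time.\<close>
lemma V_scaling:
  assumes "0 < t" "0 \<le> r" shows "t powr ((\<alpha> - 1) / 2) * V (r / sqrt t) = V r"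
  using assms by (simp add: V_def powr_divide sqrt_powr powr_powr)

lemma U_scaling:
  assumes "0 < t" "0 \<le> r" shows "t powr (\<alpha> / 2) * U (r / sqrt t) = U r"
  using assms by (simp add: U_def powr_divide sqrt_powr powr_powr)

lemma G_le: assumes "0 < t" "0 < r" shows "G t r \<le> V r"
proof -
  have "G t r \<le> t powr ((\<alpha> - 1) / 2) * V (r / sqrt t)"
    unfolding G_def using assms w(2)[of "r / sqrt t"] by (intro mult_left_mono) auto
  then show ?thesis using V_scaling assms by simp
qed

lemma F_bounds:
  assumes "0 < t" "0 \<le> r" shows "U r \<le> F t r" "F t r \<le> U r + A * t powr (\<alpha> / 2)"
proof -
  have "t powr (\<alpha> / 2) * U (r / sqrt t) \<le> F t r" "F t r \<le> t powr (\<alpha> / 2) * (U (r / sqrt t) + A)"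
    unfolding F_def using assms f[of "r / sqrt t"] by (auto intro!: mult_left_mono)
  then show "U r \<le> F t r" "F t r \<le> U r + A * t powr (\<alpha> / 2)"
    unfolding distrib_left U_scaling[OF assms] by (auto simp: mult.commute)
qed

lemma F_nonneg: "0 < t \<Longrightarrow> 0 \<le> r \<Longrightarrow> 0 \<le> F t r"
  using F_bounds(1)[of t r] U_nonneg[of r] by linarith

lemma U_mono: "0 \<le> r \<Longrightarrow> r \<le> R \<Longrightarrow> U r \<le> U R"
  unfolding U_def using C_tilde_pos \<alpha> by (intro mult_left_mono powr_mono2) auto

lemma powr_pred: "0 < t \<Longrightarrow> t powr (\<beta> - 1) = t powr \<beta> / t" for t \<beta> :: real
  by (simp add: powr_diff)

lemma Ft_le:
  assumes "0 < t" "0 < r" shows "\<bar>Ft t r\<bar> \<le> (\<alpha> * U r + \<alpha> * A * t powr (\<alpha> / 2)) / t"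
proof -
  define \<eta> where "\<eta> = r / sqrt t"
  have \<eta>: "0 < \<eta>" using assms by (simp add: \<eta>_def)
  have VU: "\<eta> * V \<eta> = \<alpha> * U \<eta>"
    using \<eta> \<alpha> by (simp add: V_def U_def \<kappa>(3) powr_diff)
  have "0 \<le> \<eta> * w \<eta>" "\<eta> * w \<eta> \<le> \<alpha> * U \<eta>"
    using w[OF \<eta>] \<eta> unfolding VU[symmetric] by (auto intro: mult_left_mono)
  moreover have "0 \<le> \<alpha> * f \<eta>" "\<alpha> * f \<eta> \<le> \<alpha> * U \<eta> + \<alpha> * A"
    using f[of \<eta>] \<eta> U_nonneg[of \<eta>] \<alpha> unfolding distrib_left[symmetric] by (auto intro!: mult_left_mono mult_nonneg_nonneg)
  moreover have "0 \<le> \<alpha> * A" using \<alpha> A by simp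
  ultimately have "\<bar>\<alpha> / 2 * f \<eta> - \<eta> / 2 * w \<eta>\<bar> \<le> \<alpha> * U \<eta> + \<alpha> * A" by linarith
  then have "\<bar>Ft t r\<bar> \<le> t powr (\<alpha> / 2 - 1) * (\<alpha> * U \<eta> + \<alpha> * A)"
    unfolding Ft_def \<eta>_def[symmetric] abs_mult by (simp add: mult_left_mono)
  also have "\<dots> = (\<alpha> * (t powr (\<alpha> / 2) * U \<eta>) + \<alpha> * A * t powr (\<alpha> / 2)) / t"
    unfolding powr_pred[OF assms(1)] by (simp add: distrib_left add_divide_distrib mult_ac)
  finally show ?thesis using U_scaling[of t r] assms by (simp add: \<eta>_def)
qed

lemma G_has_derivative:
  assumes "0 < t" "0 < r"
  shows "(G t has_real_derivative H t r) (at r)"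
proof -
  define \<eta> where "\<eta> = r / sqrt t"
  have \<eta>: "0 < \<eta>" using assms by (simp add: \<eta>_def)
  have 1: "((\<lambda>r. r / sqrt t) has_real_derivative 1 / sqrt t) (at r)"
    using DERIV_cdivide[OF DERIV_ident] .
  have 2: "(w has_real_derivative \<alpha> / 2 * f \<eta> + w \<eta> powr q - ((real N - 1) / \<eta> + \<eta> / 2) * w \<eta>) (at (r / sqrt t))"
    using dw[OF \<eta>] by (simp add: \<eta>_def)
  have e1: "t powr ((\<alpha> - 1) / 2) / sqrt t = t powr (\<alpha> / 2 - 1)"
    using assms by (simp add: sqrt_powr powr_diff[symmetric] diff_divide_distrib)
  have e2: "t powr (\<alpha> / 2 - 1) * w \<eta> powr q = G t r powr q"
  proof -
    have "(\<alpha> - 1) / 2 * q = \<alpha> / 2 - 1" using \<alpha>(4) by (simp add: field_simps)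
    moreover have "G t r powr q = (t powr ((\<alpha> - 1) / 2)) powr q * w \<eta> powr q"
      using w(1)[OF \<eta>] assms by (simp add: G_def \<eta>_def[symmetric] powr_mult)
    ultimately show ?thesis by (simp only: powr_powr)
  qed
  have e3: "t powr (\<alpha> / 2 - 1) * ((real N - 1) / \<eta> * w \<eta>) = (real N - 1) / r * G t r"
    using assms e1 by (simp add: G_def \<eta>_def field_simps)
  have "t powr ((\<alpha> - 1) / 2) * ((\<alpha> / 2 * f \<eta> + w \<eta> powr q - ((real N - 1) / \<eta> + \<eta> / 2) * w \<eta>) * (1 / sqrt t))
     = t powr (\<alpha> / 2 - 1) * (\<alpha> / 2 * f \<eta> + w \<eta> powr q - ((real N - 1) / \<eta> + \<eta> / 2) * w \<eta>)"
    unfolding e1[symmetric] by simp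
  also have "\<dots> = t powr (\<alpha> / 2 - 1) * (\<alpha> / 2 * f \<eta> - \<eta> / 2 * w \<eta>) + t powr (\<alpha> / 2 - 1) * w \<eta> powr q
      - t powr (\<alpha> / 2 - 1) * ((real N - 1) / \<eta> * w \<eta>)"
    by (simp only: left_diff_distrib right_diff_distrib distrib_left distrib_right)
  also have "\<dots> = H t r" unfolding e2 e3 H_def Ft_def \<eta>_def[symmetric] ..
  finally show ?thesis unfolding G_def[abs_def]
    using DERIV_cmult[OF DERIV_chain2[OF 2 1], of "t powr ((\<alpha> - 1) / 2)"] by (simp only:)
qed

lemma F_has_time_derivative:
  assumes "0 < t" "0 < r"
  shows "((\<lambda>t. F t r) has_real_derivative Ft t r) (at t)"
proof -
  define \<eta> where "\<eta> = r / sqrt t"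
  have \<eta>: "0 < \<eta>" using assms by (simp add: \<eta>_def)
  have 1: "((\<lambda>t. r / sqrt t) has_real_derivative - \<eta> / (2 * t)) (at t)"
    using assms by (auto intro!: derivative_eq_intros simp: \<eta>_def divide_simps)
  have 2: "(f has_real_derivative w \<eta>) (at (r / sqrt t))" using df[OF \<eta>] by (simp add: \<eta>_def)
  have 3: "((\<lambda>t. t powr (\<alpha> / 2)) has_real_derivative \<alpha> / 2 * t powr (\<alpha> / 2 - 1)) (at t)"
    using assms by (auto intro!: derivative_eq_intros)
  have "\<alpha> / 2 * t powr (\<alpha> / 2 - 1) * f (r / sqrt t) + w \<eta> * (- \<eta> / (2 * t)) * t powr (\<alpha> / 2) = Ft t r"
    unfolding Ft_def \<eta>_def[symmetric] powr_pred[OF assms(1)] by (simp add: right_diff_distrib mult_ac)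
  then show ?thesis unfolding F_def[abs_def] using DERIV_mult[OF 3 DERIV_chain2[OF 2 1]] by (simp only:)
qed

lemma w_continuous: "continuous_on {0<..} w"
  using DERIV_isCont[OF dw] by (auto intro!: continuous_at_imp_continuous_on)

lemma spacetime_continuous:
  fixes S :: "('a \<times> real) set"
  shows "S \<subseteq> UNIV \<times> {0<..} \<Longrightarrow> continuous_on S (\<lambda>z. F (snd z) (norm (fst z)))"
    and "S \<subseteq> (-{0}) \<times> {0<..} \<Longrightarrow> continuous_on S (\<lambda>z. G (snd z) (norm (fst z)))"
    and "S \<subseteq> (-{0}) \<times> {0<..} \<Longrightarrow> continuous_on S (\<lambda>z. Ft (snd z) (norm (fst z)))"
proof -
  have \<eta>: "continuous_on S (\<lambda>z. norm (fst z) / sqrt (snd z))" if "S \<subseteq> UNIV \<times> {0<..}" for S :: "('a \<times> real) set"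
    using that by (intro continuous_intros) auto
  have p: "continuous_on S (\<lambda>z. snd z powr \<beta>)" if "S \<subseteq> UNIV \<times> {0<..}" for S :: "('a \<times> real) set" and \<beta>
    using that by (intro continuous_intros) auto
  have f: "continuous_on S (\<lambda>z. f (norm (fst z) / sqrt (snd z)))" if "S \<subseteq> UNIV \<times> {0<..}" for S :: "('a \<times> real) set"
    by (rule continuous_on_compose2[OF fc \<eta>[OF that]]) (use that in auto)
  have w: "continuous_on S (\<lambda>z. w (norm (fst z) / sqrt (snd z)))" if "S \<subseteq> (-{0}) \<times> {0<..}" for S :: "('a \<times> real) set"
  proof (rule continuous_on_compose2[OF w_continuous \<eta>])
    have pos: "fst z \<noteq> 0 \<and> 0 < snd z" if "z \<in> S" for z
      using that \<open>S \<subseteq> (-{0}) \<times> {0<..}\<close> by auto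
    show "(\<lambda>z. norm (fst z) / sqrt (snd z)) ` S \<subseteq> {0<..}" using pos by fastforce
    show "S \<subseteq> UNIV \<times> {0<..}" using that by auto
  qed
  show "S \<subseteq> UNIV \<times> {0<..} \<Longrightarrow> continuous_on S (\<lambda>z. F (snd z) (norm (fst z)))"
    unfolding F_def by (intro continuous_on_mult p f)
  show "continuous_on S (\<lambda>z. G (snd z) (norm (fst z)))" if S: "S \<subseteq> (-{0}) \<times> {0<..}"
  proof -
    have S': "S \<subseteq> UNIV \<times> {0<..}" using S by auto
    show ?thesis unfolding G_def by (intro continuous_on_mult p w S S')
  qed
  show "continuous_on S (\<lambda>z. Ft (snd z) (norm (fst z)))" if S: "S \<subseteq> (-{0}) \<times> {0<..}"
  proof -
    have S': "S \<subseteq> UNIV \<times> {0<..}" using S by auto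
    show ?thesis unfolding Ft_def
      by (intro continuous_on_mult continuous_on_diff continuous_on_const p f w \<eta> S S' continuous_on_divide) auto
  qed
qed

text \<open>Absorbs bounded terms into the singular bound on a ball of radius \<open>R\<close>.\<close>
lemma const_le_singular:
  fixes r R M \<beta> :: real
  assumes "0 < r" "r \<le> R" "0 \<le> M" "0 \<le> \<beta>" shows "M \<le> M * R powr \<beta> * r powr - \<beta>"
proof -
  have "r powr \<beta> \<le> R powr \<beta>" using assms by (intro powr_mono2) auto
  then have "1 \<le> R powr \<beta> * r powr - \<beta>" using assms by (simp add: powr_minus divide_simps)
  then show ?thesis using mult_left_mono[of 1 "R powr \<beta> * r powr - \<beta>" M] assms by (simp add: mult_ac)
qed

lemma V_le_singular: assumes "0 < r" "r \<le> R" shows "V r \<le> \<kappa> * R * r powr - \<gamma>"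
proof -
  have "V r = \<kappa> * (r * r powr - \<gamma>)" using assms powr_add[of r 1 "- \<gamma>"] by (simp add: V_def \<gamma>_def)
  also have "\<dots> \<le> \<kappa> * (R * r powr - \<gamma>)" using assms \<kappa>(1) by (intro mult_left_mono mult_right_mono) auto
  finally show ?thesis by simp
qed

lemma G_powr_le: assumes "0 < t" "0 < r" shows "G t r powr q \<le> \<kappa> powr q * r powr - \<gamma>"
proof -
  have "G t r powr q \<le> V r powr q" using G_le[OF assms] G_nonneg[OF assms] q by (intro powr_mono2) auto
  then show ?thesis unfolding V_powr_q[OF assms(2)] by (simp add: \<gamma>_def)
qed

lemma radial_profile_at_time:
  assumes t: "0 < t" and R: "0 < R"
  obtains C where "radial_profile TYPE('a) (F t) (G t) (H t) \<gamma> C R"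
proof -
  define M where "M = U R + A * t powr (\<alpha> / 2)"
  define M' where "M' = (\<alpha> * U R + \<alpha> * A * t powr (\<alpha> / 2)) / t"
  have M0: "0 \<le> M" "0 \<le> M'" using U_nonneg[of R] A \<alpha> t by (auto simp: M_def M'_def)
  define c1 where "c1 = M * R powr (\<gamma> - 1)"
  define c2 where "c2 = \<kappa> * R"
  define c3 where "c3 = M' * R powr \<gamma> + \<kappa> powr q + (real N - 1) * \<kappa>"
  define C where "C = c1 + \<kappa> + c2 + c3"
  have c: "0 \<le> c1" "0 \<le> c2" "0 \<le> c3" "0 \<le> \<kappa>" using M0 R \<kappa>(1) N by (auto simp: c1_def c2_def c3_def)
  have g1: "1 - \<gamma> = - (\<gamma> - 1)" "\<alpha> - 1 = 1 - \<gamma>" by (auto simp: \<gamma>_def)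
  show ?thesis
  proof (rule that[of C], unfold_locales)
    show "continuous_on {0<..} (H t)"
    proof -
      have "continuous_on {0<..} (G t)" using DERIV_isCont[OF G_has_derivative[OF t]] by (auto intro!: continuous_at_imp_continuous_on)
      moreover have "continuous_on {0<..} (Ft t)"
        unfolding Ft_def using t by (intro continuous_intros continuous_on_compose2[OF fc] continuous_on_compose2[OF w_continuous]) auto
      ultimately show ?thesis unfolding H_def[abs_def]
        using G_nonneg[OF t] q by (intro continuous_intros continuous_on_powr') auto
    qed
  next
    fix r assume r: "0 < r" "r \<le> R"
    have "\<bar>F t r\<bar> \<le> M"
      using F_bounds(2)[OF t, of r] F_nonneg[OF t, of r] U_mono[of r R] r by (simp add: M_def)
    also have "M \<le> c1 * r powr (1 - \<gamma>)"
      unfolding c1_def g1(1) using r M0 \<gamma> by (intro const_le_singular) auto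
    also have "\<dots> \<le> C * r powr (1 - \<gamma>)" using c by (intro mult_right_mono) (auto simp: C_def)
    finally show "\<bar>F t r\<bar> \<le> C * r powr (1 - \<gamma>)" .
    have Gb: "\<bar>G t r\<bar> \<le> V r" using G_le[OF t r(1)] G_nonneg[OF t r(1)] by simp
    also have "\<dots> \<le> C * r powr (1 - \<gamma>)" unfolding V_def g1(2) using c by (intro mult_right_mono) (auto simp: C_def)
    finally show "\<bar>G t r\<bar> \<le> C * r powr (1 - \<gamma>)" .
    have "V r \<le> c2 * r powr - \<gamma>" unfolding c2_def by (rule V_le_singular[OF r])
    also have "\<dots> \<le> C * r powr - \<gamma>" using c by (intro mult_right_mono) (auto simp: C_def)
    finally show "\<bar>G t r\<bar> \<le> C * r powr - \<gamma>" using Gb by simp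
    have "\<bar>Ft t r\<bar> \<le> (\<alpha> * U r + \<alpha> * A * t powr (\<alpha> / 2)) / t" by (rule Ft_le[OF t r(1)])
    also have "\<dots> \<le> M'" unfolding M'_def using U_mono[of r R] r t \<alpha> by (intro divide_right_mono add_right_mono mult_left_mono) auto
    also have "M' \<le> M' * R powr \<gamma> * r powr - \<gamma>" using r M0 \<gamma> by (intro const_le_singular) auto
    finally have h1: "\<bar>Ft t r\<bar> \<le> M' * R powr \<gamma> * r powr - \<gamma>" .
    have h2: "\<bar>G t r powr q\<bar> \<le> \<kappa> powr q * r powr - \<gamma>" using G_powr_le[OF t r(1)] by simp
    have "\<bar>(real N - 1) / r * G t r\<bar> \<le> (real N - 1) / r * V r"
      using Gb N r unfolding abs_mult by (intro mult_mono) auto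
    also have "\<dots> = (real N - 1) * \<kappa> * r powr - \<gamma>"
      using r powr_diff[of r "\<alpha> - 1" 1] by (simp add: V_def \<gamma>_def)
    finally have h3: "\<bar>(real N - 1) / r * G t r\<bar> \<le> (real N - 1) * \<kappa> * r powr - \<gamma>" .
    have "\<bar>H t r\<bar> \<le> c3 * r powr - \<gamma>"
      unfolding c3_def distrib_right H_def using h1 h2 h3 by linarith
    also have "\<dots> \<le> C * r powr - \<gamma>" using c by (intro mult_right_mono) (auto simp: C_def)
    finally show "\<bar>H t r\<bar> \<le> C * r powr - \<gamma>" .
  qed (use \<gamma> F_has_derivative[OF t] G_has_derivative[OF t] in auto)
qed

end

section \<open>The weak formulation\<close>

lemma compact_subset_Q_bounds:
  fixes K :: "('a::euclidean_space \<times> real) set"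
  assumes "compact K" "K \<subseteq> Q"
  obtains R a b where "1 \<le> R" "0 < a" "a \<le> b" "\<And>x t. (x, t) \<in> K \<Longrightarrow> norm x \<le> R \<and> a \<le> t \<and> t \<le> b"
proof (cases "K = {}")
  case True then show ?thesis using that[of 1 1 1] by simp
next
  case False
  have "bounded (fst ` K)" using compact_imp_bounded[OF assms(1)] by (rule bounded_fst)
  then obtain R where R: "\<And>z. z \<in> K \<Longrightarrow> norm (fst z) \<le> R" by (auto simp: bounded_iff)
  have c: "continuous_on K snd" by (intro continuous_intros)
  obtain z1 where z1: "z1 \<in> K" "\<And>z. z \<in> K \<Longrightarrow> snd z1 \<le> snd z"
    using continuous_attains_inf[OF assms(1) False c] by blast
  obtain z2 where z2: "z2 \<in> K" "\<And>z. z \<in> K \<Longrightarrow> snd z \<le> snd z2"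
    using continuous_attains_sup[OF assms(1) False c] by blast
  have "0 < snd z1" using z1(1) assms(2) by (auto simp: Q_def)
  show ?thesis
  proof (rule that[of "max 1 R" "snd z1" "snd z2"])
    show "norm x \<le> max 1 R \<and> snd z1 \<le> t \<and> t \<le> snd z2" if "(x, t) \<in> K" for x t
      using R[OF that] z1(2)[OF that] z2(2)[OF that] by simp
  qed (use \<open>0 < snd z1\<close> z1 z2 in auto)
qed

lemma partial_vanish_off_supp:
  assumes "z \<notin> supp \<phi>" "\<phi> differentiable (at z)"
  shows "partial b \<phi> z = 0"
proof -
  have o: "open (- supp \<phi>)" unfolding supp_def by (intro open_Compl closed_closure)
  have "((\<lambda>h. 0) has_real_derivative partial b \<phi> z) (at 0)"
  proof (rule has_field_derivative_transform_within_open[OF partial_line_derivative[OF assms(2)], where S="(\<lambda>h. z + h *\<^sub>R b) -` (- supp \<phi>)"])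
    show "open ((\<lambda>h. z + h *\<^sub>R b) -` (- supp \<phi>))"
      by (intro open_vimage o continuous_intros)
    show "\<phi> (z + h *\<^sub>R b) = 0" if "h \<in> (\<lambda>h. z + h *\<^sub>R b) -` (- supp \<phi>)" for h
      using that by (intro supp_vanish) auto
  qed (use assms in auto)
  then show ?thesis using DERIV_unique[OF _ DERIV_const[of 0]] by blast
qed

lemma integrable_bounded_compact_support:
  fixes h :: "'a::euclidean_space \<Rightarrow> real"
  assumes "h \<in> borel_measurable borel" "compact K" "\<And>x. \<bar>h x\<bar> \<le> M * indicator K x"
  shows "integrable lborel h"
proof (rule Bochner_Integration.integrable_bound)
  show "integrable lborel (\<lambda>x. M * indicator K x)" using integrable_indicator_compact[OF assms(2)] by simp
  show "AE x in lborel. norm (h x) \<le> norm (M * indicator K x)"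
    using order_trans[OF assms(3) abs_ge_self] by (intro AE_I2) (simp only: real_norm_def)
qed (use assms(1) in simp)

context self_similar_profile begin

definition u :: "'a \<Rightarrow> real \<Rightarrow> real" where "u x t = F t (norm x)"
definition grad :: "'a \<Rightarrow> real \<Rightarrow> 'a" where "grad x t = (G t (norm x) / norm x) *\<^sub>R x"

lemma norm_grad: "0 < t \<Longrightarrow> x \<noteq> 0 \<Longrightarrow> norm (grad x t) = G t (norm x)"
  using G_nonneg[of t "norm x"] by (simp add: grad_def)

lemma grad_inner: "grad x t \<bullet> b = G t (norm x) * ((x \<bullet> b) / norm x)"
  by (simp add: grad_def)

lemma u_continuous_space: "0 < t \<Longrightarrow> continuous_on S (\<lambda>x. u x t)"
  unfolding u_def F_def by (intro continuous_intros continuous_on_compose2[OF fc]) auto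

lemma G_continuous_space: "0 < t \<Longrightarrow> continuous_on (-{0}) (\<lambda>x::'a. G t (norm x))"
  unfolding G_def by (intro continuous_intros continuous_on_compose2[OF w_continuous]) (auto intro!: divide_pos_pos)

lemma Ft_continuous_space: "0 < t \<Longrightarrow> continuous_on (-{0}) (\<lambda>x::'a. Ft t (norm x))"
  unfolding Ft_def
  by (intro continuous_intros continuous_on_compose2[OF w_continuous] continuous_on_compose2[OF fc]) (auto intro!: divide_pos_pos)

lemma space_measurable:
  assumes "0 < t"
  shows "(\<lambda>x. u x t) \<in> borel_measurable borel" "(\<lambda>x::'a. G t (norm x)) \<in> borel_measurable borel"
    "(\<lambda>x::'a. Ft t (norm x)) \<in> borel_measurable borel" "(\<lambda>x. grad x t) \<in> borel_measurable borel"
proof -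
  show "(\<lambda>x. u x t) \<in> borel_measurable borel" using u_continuous_space[OF assms] by (rule borel_measurable_continuous_onI)
  show [measurable]: "(\<lambda>x::'a. G t (norm x)) \<in> borel_measurable borel"
    using G_continuous_space[OF assms] by (intro borel_measurable_continuous_countable_exceptions[of "{0}"]) auto
  show "(\<lambda>x::'a. Ft t (norm x)) \<in> borel_measurable borel"
    using Ft_continuous_space[OF assms] by (intro borel_measurable_continuous_countable_exceptions[of "{0}"]) auto
  show "(\<lambda>x. grad x t) \<in> borel_measurable borel" unfolding grad_def by measurable
qed

lemma u_bounds:
  assumes "0 < t" shows "U (norm x) \<le> u x t" "u x t \<le> U (norm x) + A * t powr (\<alpha> / 2)"
  using F_bounds[OF assms, of "norm x"] by (auto simp: u_def)

lemma u_nonneg: "0 < t \<Longrightarrow> 0 \<le> u x t"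
  using F_nonneg[of t "norm x"] by (simp add: u_def)

lemma u_bounded:
  assumes "0 < t" "t \<le> t1" "norm x \<le> R"
  shows "\<bar>u x t\<bar> \<le> U R + A * t1 powr (\<alpha> / 2)"
proof -
  have "A * t powr (\<alpha> / 2) \<le> A * t1 powr (\<alpha> / 2)" using A assms \<alpha> by (intro mult_left_mono powr_mono2) auto
  then show ?thesis using u_bounds(2)[OF assms(1), of x] u_nonneg[OF assms(1), of x] U_mono[of "norm x" R] assms by simp
qed

lemma u_locally_integrable: "0 < t \<Longrightarrow> locally_integrable_on (\<lambda>x. u x t) UNIV"
  by (intro continuous_locally_integrable u_continuous_space)

lemma u_continuous_L1: "continuous_L1_loc u"
  unfolding continuous_L1_loc_def
proof (intro conjI allI impI)
  show "locally_integrable_on (\<lambda>x. u x t) UNIV" if "0 < t" for t using u_locally_integrable[OF that] .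
  fix K :: "'a set" and t :: real assume K: "compact K" and t: "0 < t"
  obtain R where R: "\<And>x. x \<in> K \<Longrightarrow> norm x \<le> R" using compact_imp_bounded[OF K] by (auto simp: bounded_iff)
  define M where "M = U R + A * (2 * t) powr (\<alpha> / 2)"
  have Kb: "K \<in> sets borel" using K by (rule borel_compact)
  show "((\<lambda>s. LINT x:K|lebesgue. \<bar>u x s - u x t\<bar>) \<longlongrightarrow> 0) (at t)"
    unfolding tendsto_at_iff_sequentially comp_def
  proof (intro allI impI)
    fix s :: "nat \<Rightarrow> real" assume "s \<longlonglongrightarrow> t"
    then have "\<forall>\<^sub>F n in sequentially. 0 < s n \<and> s n < 2 * t"
      using t by (intro eventually_conj order_tendstoD[of s t sequentially]) simp_all
    then obtain n0 where n0: "\<And>n. n \<ge> n0 \<Longrightarrow> 0 < s n \<and> s n < 2 * t" unfolding eventually_sequentially by blast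
    have "(\<lambda>n. LINT x:K|lebesgue. \<bar>u x (s (n + n0)) - u x t\<bar>) \<longlonglongrightarrow> (LINT x:K|lebesgue. 0)"
      unfolding set_lebesgue_integral_def
    proof (rule integral_dominated_convergence)
      have "integrable lborel (\<lambda>x. (2 * M) * indicator K x)" using integrable_indicator_compact[OF K] by simp
      then show "integrable lebesgue (\<lambda>x. (2 * M) * indicator K x)"
        using Kb by (subst integrable_completion) auto
      show "AE x in lebesgue. norm (indicat_real K x *\<^sub>R \<bar>u x (s (n + n0)) - u x t\<bar>) \<le> 2 * M * indicator K x" for n
      proof (rule AE_I2)
        fix x
        show "norm (indicat_real K x *\<^sub>R \<bar>u x (s (n + n0)) - u x t\<bar>) \<le> 2 * M * indicator K x"
        proof (cases "x \<in> K")
          case True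
          have "0 < s (n + n0)" "s (n + n0) \<le> 2 * t" using n0[of "n + n0"] by auto
          then have "\<bar>u x (s (n + n0))\<bar> \<le> M" unfolding M_def by (rule u_bounded) (rule R[OF True])
          moreover have "\<bar>u x t\<bar> \<le> M" unfolding M_def by (rule u_bounded[OF t _ R[OF True]]) (use t in simp)
          ultimately have "\<bar>u x (s (n + n0)) - u x t\<bar> \<le> 2 * M" by linarith
          then show ?thesis using True by simp
        qed simp
      qed
      show "AE x in lebesgue. (\<lambda>n. indicat_real K x *\<^sub>R \<bar>u x (s (n + n0)) - u x t\<bar>) \<longlonglongrightarrow> indicat_real K x *\<^sub>R 0"
      proof (rule AE_I2)
        fix x
        have s': "(\<lambda>n. s (n + n0)) \<longlonglongrightarrow> t" using \<open>s \<longlonglongrightarrow> t\<close> by (rule LIMSEQ_ignore_initial_segment)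
        have cu: "continuous_on {0<..} (\<lambda>t. u x t)"
          unfolding u_def F_def by (intro continuous_intros continuous_on_compose2[OF fc]) auto
        have ev: "\<forall>\<^sub>F n in sequentially. s (n + n0) \<in> {0<..}" using n0 by (intro always_eventually) simp
        have "(\<lambda>n. u x (s (n + n0))) \<longlonglongrightarrow> u x t"
          by (rule continuous_on_tendsto_compose[OF cu s' _ ev]) (use t in simp)
        then have "(\<lambda>n. indicat_real K x *\<^sub>R \<bar>u x (s (n + n0)) - u x t\<bar>) \<longlonglongrightarrow> indicat_real K x *\<^sub>R \<bar>u x t - u x t\<bar>"
          by (intro tendsto_intros)
        then show "(\<lambda>n. indicat_real K x *\<^sub>R \<bar>u x (s (n + n0)) - u x t\<bar>) \<longlonglongrightarrow> indicat_real K x *\<^sub>R 0" by simp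
      qed
      have [measurable]: "(\<lambda>x. u x t) \<in> borel_measurable borel" "(\<lambda>x. u x (s (n + n0))) \<in> borel_measurable borel" "K \<in> sets borel" for n
        by (rule space_measurable(1)[OF t], rule space_measurable(1), use n0[of "n + n0"] in simp, rule Kb)
      have "(\<lambda>x. indicat_real K x *\<^sub>R \<bar>u x (s (n + n0)) - u x t\<bar>) \<in> borel_measurable lborel" for n
        by measurable
      then show "(\<lambda>x. indicat_real K x *\<^sub>R \<bar>u x (s (n + n0)) - u x t\<bar>) \<in> borel_measurable lebesgue" for n
        by (rule measurable_completion)
    qed simp
    then have "(\<lambda>n. LINT x:K|lebesgue. \<bar>u x (s (n + n0)) - u x t\<bar>) \<longlonglongrightarrow> 0"
      by (simp add: set_lebesgue_integral_def)
    then show "(\<lambda>n. LINT x:K|lebesgue. \<bar>u x (s n) - u x t\<bar>) \<longlonglongrightarrow> 0"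
      by (rule LIMSEQ_offset[of "\<lambda>n. LINT x:K|lebesgue. \<bar>u x (s n) - u x t\<bar>" n0])
  qed
qed

lemma grad_continuous: "S \<subseteq> (-{0}) \<times> {0<..} \<Longrightarrow> continuous_on S (\<lambda>z. grad (fst z) (snd z))"
  unfolding grad_def by (intro continuous_intros spacetime_continuous) auto

lemma spacetime_integrability:
  "locally_integrable_on (\<lambda>(x, t). u x t) Q" "locally_integrable_on (\<lambda>(x, t). grad x t) Q"
  "locally_integrable_on (\<lambda>(x, t). norm (grad x t) powr q) Q"
proof -
  have "(\<lambda>(x, t). u x t) absolutely_integrable_on K \<and> (\<lambda>(x, t). grad x t) absolutely_integrable_on K \<and>
      (\<lambda>(x, t). norm (grad x t) powr q) absolutely_integrable_on K"
    if K: "compact K" "K \<subseteq> Q" for K :: "('a \<times> real) set"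
  proof -
    obtain R a b where R: "1 \<le> R" "0 < a" "a \<le> b" "\<And>x t. (x, t) \<in> K \<Longrightarrow> norm x \<le> R \<and> a \<le> t \<and> t \<le> b"
      using compact_subset_Q_bounds[OF K] by blast
    have sub: "K - {0} \<times> UNIV \<subseteq> (-{0}) \<times> {0<..}" "K - {0} \<times> UNIV \<subseteq> UNIV \<times> {0<..}" using K(2) by (auto simp: Q_def)
    define M where "M = U R + A * b powr (\<alpha> / 2)"
    have M0: "0 \<le> M" using U_nonneg[of R] A by (simp add: M_def)
    have tx: "0 < t \<and> 0 < norm x \<and> norm x \<le> R \<and> t \<le> b" if "(x, t) \<in> K" "x \<noteq> 0" for x t
      using R(2) R(4)[OF that(1)] that(2) by auto
    note ac = absolutely_integrable_axis_singularity[OF \<gamma>(3,2) K(1)]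
    have "(\<lambda>z. u (fst z) (snd z)) absolutely_integrable_on K"
    proof (rule ac)
      show "continuous_on (K - {0} \<times> UNIV) (\<lambda>z. u (fst z) (snd z))" unfolding u_def by (rule spacetime_continuous(1)[OF sub(2)])
      show "norm (u (fst (x, t)) (snd (x, t))) \<le> (M * R powr \<gamma>) * norm x powr - \<gamma>" if "(x, t) \<in> K" "x \<noteq> 0" for x t
        using u_bounded[of t b x R] const_le_singular[of "norm x" R M \<gamma>] tx[OF that] M0 \<gamma> by (auto simp: M_def)
    qed
    moreover have "(\<lambda>z. grad (fst z) (snd z)) absolutely_integrable_on K"
    proof (rule ac)
      show "continuous_on (K - {0} \<times> UNIV) (\<lambda>z. grad (fst z) (snd z))" by (rule grad_continuous[OF sub(1)])
      show "norm (grad (fst (x, t)) (snd (x, t))) \<le> (\<kappa> * R) * norm x powr - \<gamma>" if "(x, t) \<in> K" "x \<noteq> 0" for x t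
        using G_le[of t "norm x"] V_le_singular[of "norm x" R] norm_grad[of t x] tx[OF that] that by auto
    qed
    moreover have "(\<lambda>z. norm (grad (fst z) (snd z)) powr q) absolutely_integrable_on K"
    proof (rule ac)
      show "continuous_on (K - {0} \<times> UNIV) (\<lambda>z. norm (grad (fst z) (snd z)) powr q)"
        using q by (intro continuous_on_powr' continuous_on_norm grad_continuous[OF sub(1)] continuous_on_const) auto
      show "norm (norm (grad (fst (x, t)) (snd (x, t))) powr q) \<le> \<kappa> powr q * norm x powr - \<gamma>" if "(x, t) \<in> K" "x \<noteq> 0" for x t
        using G_powr_le[of t "norm x"] norm_grad[of t x] tx[OF that] that by auto
    qed
    ultimately show ?thesis unfolding case_prod_beta' by blast
  qed
  note * = this
  show "locally_integrable_on (\<lambda>(x, t). u x t) Q" unfolding locally_integrable_on_def using * by simp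
  show "locally_integrable_on (\<lambda>(x, t). grad x t) Q" unfolding locally_integrable_on_def using * by simp
  show "locally_integrable_on (\<lambda>(x, t). norm (grad x t) powr q) Q" unfolding locally_integrable_on_def using * by simp
qed

lemma u_weak_gradient:
  assumes t: "0 < t"
  shows "has_weak_gradient (\<lambda>x. u x t) (\<lambda>x. grad x t)"
  unfolding has_weak_gradient_def
proof (intro conjI ballI)
  show "locally_integrable_on (\<lambda>x. u x t) UNIV" by (rule u_locally_integrable[OF t])
  show "locally_integrable_on (\<lambda>x. grad x t) UNIV"
    unfolding locally_integrable_on_def
  proof (intro allI impI)
    fix K :: "'a set" assume "compact K \<and> K \<subseteq> UNIV"
    then have K: "compact K" by simp
    obtain R where R: "0 < R" "\<And>x. x \<in> K \<Longrightarrow> norm x \<le> R" using compact_imp_bounded[OF K] by (auto simp: bounded_pos)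
    show "(\<lambda>x. grad x t) absolutely_integrable_on K"
    proof (rule absolutely_integrable_point_singularity[OF \<gamma>(3,2) K])
      show "continuous_on (K - {0}) (\<lambda>x. grad x t)"
        unfolding grad_def by (intro continuous_intros continuous_on_subset[OF G_continuous_space[OF t]]) auto
      show "norm (grad x t) \<le> (\<kappa> * R) * norm x powr - \<gamma>" if "x \<in> K" "x \<noteq> 0" for x
        using G_le[OF t, of "norm x"] V_le_singular[of "norm x" R] norm_grad[OF t, of x] R(2) that by auto
    qed
  qed
  fix \<psi> :: "'a \<Rightarrow> real" and b :: 'a assume \<psi>: "\<psi> \<in> test_functions UNIV" and b: "b \<in> Basis"
  then have sm: "smooth \<psi>" and co: "compact (supp \<psi>)" by (auto simp: test_functions_def)
  obtain R where R: "1 \<le> R" "\<And>x. R < norm x \<Longrightarrow> \<psi> x = 0" using compact_norm_bound[OF co] by blast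
  obtain C where "radial_profile TYPE('a) (F t) (G t) (H t) \<gamma> C R" using radial_profile_at_time[OF t, of R] R by auto
  then interpret rp: radial_profile "F t" "G t" "H t" \<gamma> C R "TYPE('a)" .
  have c: "continuous_on UNIV \<psi>" "continuous_on UNIV (partial b \<psi>)"
    using smooth_continuous[OF sm] smooth_continuous[OF smooth_partial[OF sm b]] by auto
  note [measurable] = borel_measurable_continuous_onI[OF c(1)] borel_measurable_continuous_onI[OF c(2)] space_measurable[OF t]
  have "(LINT x|lebesgue. u x t * partial b \<psi> x) = (LINT x|lborel. F t (norm x) * partial b \<psi> x)"
    by (subst integral_completion) (simp_all add: u_def[symmetric])
  also have "\<dots> = - (LINT x|lborel. G t (norm x) * ((x \<bullet> b) / norm x) * \<psi> x)"
    by (rule rp.gradient_by_parts(2)[OF b c partial_line_derivative[OF smooth_differentiable[OF sm]] R(2)])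
  also have "\<dots> = - (LINT x|lebesgue. (grad x t \<bullet> b) * \<psi> x)"
  proof -
    have "(\<lambda>x. (grad x t \<bullet> b) * \<psi> x) \<in> borel_measurable lborel" by measurable
    from integral_completion[OF this] show ?thesis unfolding grad_inner by simp
  qed
  finally show "(LINT x|lebesgue. u x t * partial b \<psi> x) = - (LINT x|lebesgue. (grad x t \<bullet> b) * \<psi> x)" .
qed

text \<open>The sandwich \<open>U \<le> f \<le> U + A\<close> scales to \<open>\<bar>u x t - U (norm x)\<bar> \<le> A * t powr (\<alpha> / 2)\<close>, uniformly in space.\<close>
lemma u_trace:
  assumes c0: "\<And>x::'a. u0 x = U (norm x)"
  shows "has_trace u u0"
proof -
  have u0: "u0 = (\<lambda>x::'a. U (norm x))" using c0 by auto
  have u0c: "continuous_on S u0" for S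
    unfolding u0 by (intro continuous_on_compose2[OF U_continuous] continuous_intros) auto
  have L: "locally_integrable_on u0 UNIV" by (rule continuous_locally_integrable[OF u0c])
  have "((\<lambda>t. LINT x|lebesgue. u x t * \<psi> x) \<longlongrightarrow> (LINT x|lebesgue. \<psi> x * u0 x)) (at_right 0)"
    if \<psi>: "continuous_on UNIV \<psi>" "compact (supp \<psi>)" for \<psi> :: "'a \<Rightarrow> real"
  proof -
    have [measurable]: "\<psi> \<in> borel_measurable borel" "u0 \<in> borel_measurable borel"
      using \<psi>(1) u0c by (auto intro: borel_measurable_continuous_onI)
    have z: "\<psi> x = 0" if "x \<notin> supp \<psi>" for x using supp_vanish[OF that] .
    have sub: "integrable lborel h" if "continuous_on UNIV h" "\<And>x. x \<notin> supp \<psi> \<Longrightarrow> h x = 0" for h :: "'a \<Rightarrow> real"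
    proof -
      have "integrable lborel (\<lambda>x. indicator (supp \<psi>) x *\<^sub>R h x)"
        by (rule borel_integrable_compact[OF \<psi>(2)]) (rule continuous_on_subset[OF that(1)], simp)
      also have "(\<lambda>x. indicator (supp \<psi>) x *\<^sub>R h x) = h"
        by (intro ext) (use that(2) in \<open>auto simp: indicator_def\<close>)
      finally show ?thesis .
    qed
    have i\<psi>: "integrable lborel (\<lambda>x. \<bar>\<psi> x\<bar>)" using \<psi>(1) z by (intro sub continuous_intros) auto
    have i0: "integrable lborel (\<lambda>x. \<psi> x * u0 x)" using \<psi>(1) z u0c by (intro sub continuous_intros) auto
    define J where "J = (LINT x|lborel. \<bar>\<psi> x\<bar>)"
    have "((\<lambda>t. (LINT x|lebesgue. u x t * \<psi> x) - (LINT x|lebesgue. \<psi> x * u0 x)) \<longlongrightarrow> 0) (at_right 0)"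
    proof (rule Lim_null_comparison)
      show "\<forall>\<^sub>F t in at_right 0. norm ((LINT x|lebesgue. u x t * \<psi> x) - (LINT x|lebesgue. \<psi> x * u0 x)) \<le> t powr (\<alpha> / 2) * (A * J)"
      proof (rule eventually_at_right_less[THEN eventually_mono])
        fix t :: real assume t: "0 < t"
        note [measurable] = space_measurable(1)[OF t]
        have iu: "integrable lborel (\<lambda>x. u x t * \<psi> x)" using \<psi>(1) z u_continuous_space[OF t] by (intro sub continuous_intros) auto
        have "(LINT x|lebesgue. u x t * \<psi> x) - (LINT x|lebesgue. \<psi> x * u0 x)
            = (LINT x|lborel. u x t * \<psi> x) - (LINT x|lborel. \<psi> x * u0 x)"
          by (simp add: integral_completion)
        also have "\<dots> = (LINT x|lborel. u x t * \<psi> x - \<psi> x * u0 x)" using iu i0 by simp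
        also have "norm \<dots> \<le> (LINT x|lborel. A * t powr (\<alpha> / 2) * \<bar>\<psi> x\<bar>)"
        proof (rule Bochner_Integration.integral_norm_bound_integral)
          show "norm (u x t * \<psi> x - \<psi> x * u0 x) \<le> A * t powr (\<alpha> / 2) * \<bar>\<psi> x\<bar>" for x
          proof -
            have "u x t * \<psi> x - \<psi> x * u0 x = (u x t - u0 x) * \<psi> x" by (simp add: algebra_simps)
            moreover have "\<bar>u x t - u0 x\<bar> \<le> A * t powr (\<alpha> / 2)" using u_bounds[OF t, of x] by (simp add: u0)
            ultimately show ?thesis by (simp add: abs_mult mult_right_mono)
          qed
        qed (use iu i0 i\<psi> in auto)
        also have "\<dots> = t powr (\<alpha> / 2) * (A * J)" by (simp add: J_def)
        finally show "norm ((LINT x|lebesgue. u x t * \<psi> x) - (LINT x|lebesgue. \<psi> x * u0 x)) \<le> t powr (\<alpha> / 2) * (A * J)" .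
      qed
      have nonneg: "\<forall>\<^sub>F t in at_right 0. 0 \<le> (t::real)"
        by (rule eventually_mono[OF eventually_at_right_less]) simp
      have "((\<lambda>t. t powr (\<alpha> / 2)) \<longlongrightarrow> 0 powr (\<alpha> / 2)) (at_right (0::real))"
        using \<alpha> by (intro tendsto_powr' tendsto_ident_at tendsto_const disjI2 conjI nonneg) simp
      then show "((\<lambda>t. t powr (\<alpha> / 2) * (A * J)) \<longlongrightarrow> 0) (at_right 0)" by (intro tendsto_mult_left_zero) simp
    qed
    then show ?thesis by (rule LIM_zero_cancel)
  qed
  then show ?thesis using L unfolding has_trace_def by blast
qed

text \<open>At fixed time, moving the Laplacian onto \<open>u\<close> and inserting the equation turns the weak formulation into
the spatial integral of \<open>- (u * \<phi>)\<close> differentiated in time.\<close>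
lemma spatial_integral_identity:
  fixes \<phi> :: "'a \<times> real \<Rightarrow> real"
  assumes sm: "smooth \<phi>" and t: "0 < t" and R: "1 \<le> R" "\<And>x. R < norm x \<Longrightarrow> (x, t) \<notin> supp \<phi>"
  shows "(LINT x|lebesgue. - u x t * time_deriv \<phi> (x, t) - u x t * space_laplacian \<phi> (x, t) + norm (grad x t) powr q * \<phi> (x, t))
    = (LINT x|lborel. - (u x t * time_deriv \<phi> (x, t) + Ft t (norm x) * \<phi> (x, t)))"
proof -
  define \<psi> where "\<psi> x = \<phi> (x, t)" for x
  define d where "d b x = partial (b, 0) \<phi> (x, t)" for b x
  define dd where "dd b x = partial (b, 0) (partial (b, 0) \<phi>) (x, t)" for b x
  define \<tau> where "\<tau> x = time_deriv \<phi> (x, t)" for x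
  define L where "L x = (\<Sum>b\<in>Basis. dd b x)" for x
  have e: "space_laplacian \<phi> (x, t) = L x" for x by (simp add: space_laplacian_def L_def dd_def)
  have slice: "continuous_on UNIV (\<lambda>x. h (x, t))" if "smooth h" for h :: "'a \<times> real \<Rightarrow> real"
    by (rule continuous_on_compose2[OF smooth_continuous[OF that, of UNIV]]) (auto intro!: continuous_intros)
  have b0: "(b, 0) \<in> (Basis :: ('a \<times> real) set)" if "b \<in> Basis" for b using that by (simp add: Basis_prod_def)
  have t0: "(0, 1) \<in> (Basis :: ('a \<times> real) set)" by (simp add: Basis_prod_def)
  have c1: "continuous_on UNIV \<psi>" unfolding \<psi>_def by (rule slice[OF sm])
  have c2: "continuous_on UNIV \<tau>" unfolding \<tau>_def time_deriv_def by (rule slice[OF smooth_partial[OF sm t0]])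
  have c3: "continuous_on UNIV (d b)" if "b \<in> Basis" for b
    unfolding d_def by (rule slice[OF smooth_partial[OF sm b0[OF that]]])
  have c4: "continuous_on UNIV (dd b)" if "b \<in> Basis" for b
    unfolding dd_def by (rule slice[OF smooth_partial[OF smooth_partial[OF sm b0[OF that]] b0[OF that]]])
  have ld: "((\<lambda>h. \<psi> (x + h *\<^sub>R b)) has_real_derivative d b x) (at 0)" for x b
    using partial_line_derivative[OF smooth_differentiable[OF sm], of "(x, t)" "(b, 0)"] by (simp add: \<psi>_def d_def)
  have ldd: "((\<lambda>h. d b (x + h *\<^sub>R b)) has_real_derivative dd b x) (at 0)" if "b \<in> Basis" for x b
    using partial_line_derivative[OF smooth_differentiable[OF smooth_partial[OF sm b0[OF that]]], of "(x, t)" "(b, 0)"]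
    by (simp add: d_def dd_def)
  have supp: "\<psi> x = 0" "\<tau> x = 0" if "R < norm x" for x
    using supp_vanish[OF R(2)[OF that]] partial_vanish_off_supp[OF R(2)[OF that] smooth_differentiable[OF sm]]
    by (auto simp: \<psi>_def \<tau>_def time_deriv_def)
  obtain C where "radial_profile TYPE('a) (F t) (G t) (H t) \<gamma> C R" using radial_profile_at_time[OF t, of R] R by auto
  then interpret rp: radial_profile "F t" "G t" "H t" \<gamma> C R "TYPE('a)" .
  note lap = rp.laplacian_by_parts[OF c1 c3 c4 ld ldd supp(1), folded L_def]
  note [measurable] = space_measurable[OF t] borel_measurable_continuous_onI[OF c1] borel_measurable_continuous_onI[OF c2]
  have [measurable]: "L \<in> borel_measurable borel"
    unfolding L_def[abs_def] using c4 by (intro borel_measurable_sum borel_measurable_continuous_onI) auto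
  have bdd: "\<exists>B. \<forall>x. \<bar>h x\<bar> \<le> B" if h: "continuous_on UNIV h" "\<And>x. R < norm x \<Longrightarrow> h x = 0" for h :: "'a \<Rightarrow> real"
  proof -
    have "compact (h ` cball 0 R)" by (intro compact_continuous_image continuous_on_subset[OF h(1)]) auto
    then obtain B where B: "0 < B" "\<And>x. norm x \<le> R \<Longrightarrow> \<bar>h x\<bar> \<le> B" using compact_imp_bounded[of "h ` cball 0 R"] by (auto simp: bounded_pos)
    have "\<bar>h x\<bar> \<le> B" for x using B h(2)[of x] by (cases "norm x \<le> R") auto
    then show ?thesis by blast
  qed
  obtain B1 B2 where B: "\<And>x. \<bar>\<psi> x\<bar> \<le> B1" "\<And>x. \<bar>\<tau> x\<bar> \<le> B2"
    using bdd[OF c1 supp(1)] bdd[OF c2 supp(2)] by blast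
  define M where "M = U R + A * t powr (\<alpha> / 2)"
  define M' where "M' = (\<alpha> * U R + \<alpha> * A * t powr (\<alpha> / 2)) / t"
  have iu: "integrable lborel (\<lambda>x. u x t * \<tau> x)"
  proof (rule integrable_bounded_compact_support[of _ "cball 0 R"])
    show "\<bar>u x t * \<tau> x\<bar> \<le> (M * B2) * indicator (cball 0 R) x" for x
    proof (cases "norm x \<le> R")
      case True
      have "\<bar>u x t\<bar> * \<bar>\<tau> x\<bar> \<le> M * B2"
        using u_bounded[OF t order_refl True] B(2)[of x] unfolding M_def by (intro mult_mono) (auto intro: order_trans[OF abs_ge_zero])
      then show ?thesis using True by (simp add: abs_mult)
    qed (simp add: supp)
    show "(\<lambda>x. u x t * \<tau> x) \<in> borel_measurable borel" by measurable
  qed simp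
  have iF: "integrable lborel (\<lambda>x. indicator (-{0}) x * (Ft t (norm x) * \<psi> x))"
  proof (rule integrable_bounded_compact_support[of _ "cball 0 R"])
    show "\<bar>indicator (-{0}) x * (Ft t (norm x) * \<psi> x)\<bar> \<le> (M' * B1) * indicator (cball 0 R) x" for x
    proof (cases "norm x \<le> R \<and> x \<noteq> 0")
      case True
      have "\<bar>Ft t (norm x)\<bar> \<le> (\<alpha> * U (norm x) + \<alpha> * A * t powr (\<alpha> / 2)) / t" using True by (intro Ft_le[OF t]) auto
      also have "\<dots> \<le> M'" unfolding M'_def using U_mono[of "norm x" R] True t \<alpha> by (intro divide_right_mono add_right_mono mult_left_mono) auto
      finally have "\<bar>Ft t (norm x)\<bar> * \<bar>\<psi> x\<bar> \<le> M' * B1"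
        using B(1)[of x] by (intro mult_mono) (auto intro: order_trans[OF abs_ge_zero])
      then show ?thesis using True by (simp add: abs_mult)
    next
      case False
      have "0 \<le> M'" using U_nonneg[of R] A \<alpha> t by (auto simp: M'_def)
      moreover have "0 \<le> B1" using B(1)[of 0] by linarith
      ultimately show ?thesis using False by (auto simp: supp indicator_def)
    qed
    show "(\<lambda>x. indicator (-{0}) x * (Ft t (norm x) * \<psi> x)) \<in> borel_measurable borel" by measurable
  qed simp
  have ae: "AE x::'a in lborel. x \<noteq> 0" by (rule AE_lborel_singleton)
  have iF': "integrable lborel (\<lambda>x. Ft t (norm x) * \<psi> x)"
    by (rule integrable_cong_AE_imp[OF iF]) (use ae in \<open>auto elim!: eventually_mono\<close>)
  \<comment> \<open>The equation off the origin.\<close>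
  have split: "norm (grad x t) powr q * \<psi> x = (H t (norm x) + (real DIM('a) - 1) / norm x * G t (norm x)) * \<psi> x - Ft t (norm x) * \<psi> x"
    if "x \<noteq> 0" for x
    using norm_grad[OF t that] by (simp add: H_def dim algebra_simps)
  have ig: "integrable lborel (\<lambda>x. norm (grad x t) powr q * \<psi> x)"
    by (rule integrable_cong_AE_imp[OF Bochner_Integration.integrable_diff[OF lap(2) iF']])
      (use ae split in \<open>auto elim!: eventually_mono\<close>)
  have eg: "(LINT x|lborel. norm (grad x t) powr q * \<psi> x) = (LINT x|lborel. F t (norm x) * L x) - (LINT x|lborel. Ft t (norm x) * \<psi> x)"
  proof -
    have "(LINT x|lborel. norm (grad x t) powr q * \<psi> x) = (LINT x|lborel. (H t (norm x) + (real DIM('a) - 1) / norm x * G t (norm x)) * \<psi> x - Ft t (norm x) * \<psi> x)"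
      by (rule integral_cong_AE) (use ae split ig lap(2) iF' in \<open>auto elim!: eventually_mono\<close>)
    then show ?thesis using lap(2,3) iF' by simp
  qed
  have iL: "integrable lborel (\<lambda>x. u x t * L x)" using lap(1) by (simp add: u_def)
  have "(LINT x|lebesgue. - u x t * time_deriv \<phi> (x, t) - u x t * space_laplacian \<phi> (x, t) + norm (grad x t) powr q * \<phi> (x, t))
     = (LINT x|lebesgue. - (u x t * \<tau> x) - u x t * L x + norm (grad x t) powr q * \<psi> x)"
    by (simp add: e \<psi>_def \<tau>_def)
  also have "\<dots> = (LINT x|lborel. - (u x t * \<tau> x) - u x t * L x + norm (grad x t) powr q * \<psi> x)"
  proof (rule integral_completion)
    show "(\<lambda>x. - (u x t * \<tau> x) - u x t * L x + norm (grad x t) powr q * \<psi> x) \<in> borel_measurable lborel" by measurable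
  qed
  also have "\<dots> = - (LINT x|lborel. u x t * \<tau> x) - (LINT x|lborel. u x t * L x) + (LINT x|lborel. norm (grad x t) powr q * \<psi> x)"
    using iu iL ig by simp
  also have "\<dots> = - (LINT x|lborel. u x t * \<tau> x) - (LINT x|lborel. Ft t (norm x) * \<psi> x)"
    unfolding eg by (simp add: u_def)
  also have "\<dots> = (LINT x|lborel. - (u x t * \<tau> x + Ft t (norm x) * \<psi> x))"
    using iu iF' by simp
  finally show ?thesis by (simp add: \<psi>_def \<tau>_def)
qed

text \<open>By \<open>spatial_integral_identity\<close> the double integral is that of \<open>- (u * \<phi>)\<close> differentiated in time. By Fubini it
may be integrated in time first, for fixed \<open>x \<noteq> 0\<close>, where the fundamental theorem of calculus gives zero
because \<open>\<phi>\<close> has compact support in positive times.\<close>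
lemma weak_equation:
  assumes \<phi>: "\<phi> \<in> test_functions (Q :: ('a \<times> real) set)"
  shows "(LINT t:{0<..}|lebesgue. (LINT x|lebesgue.
       - u x t * time_deriv \<phi> (x, t) - u x t * space_laplacian \<phi> (x, t) + norm (grad x t) powr q * \<phi> (x, t))) = 0"
proof -
  have sm: "smooth \<phi>" and K: "compact (supp \<phi>)" "supp \<phi> \<subseteq> Q" using \<phi> by (auto simp: test_functions_def)
  obtain R a b where R: "1 \<le> R" "0 < a" "a \<le> b" "\<And>x t. (x, t) \<in> supp \<phi> \<Longrightarrow> norm x \<le> R \<and> a \<le> t \<and> t \<le> b"
    using compact_subset_Q_bounds[OF K] by blast
  have off: "\<phi> (x, t) = 0" "time_deriv \<phi> (x, t) = 0" if "\<not> (norm x \<le> R \<and> a \<le> t \<and> t \<le> b)" for x t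
  proof -
    have "(x, t) \<notin> supp \<phi>" using R(4) that by blast
    then show "\<phi> (x, t) = 0" "time_deriv \<phi> (x, t) = 0"
      unfolding time_deriv_def by (rule supp_vanish, rule partial_vanish_off_supp[OF _ smooth_differentiable[OF sm]])
  qed
  have t0: "(0, 1) \<in> (Basis :: ('a \<times> real) set)" by (simp add: Basis_prod_def)
  have c\<phi>: "continuous_on S \<phi>" "continuous_on S (time_deriv \<phi>)" for S
    using smooth_continuous[OF sm] smooth_continuous[OF smooth_partial[OF sm t0]] by (auto simp: time_deriv_def)
  define S :: "('a \<times> real) set" where "S = (-{0}) \<times> {0<..}"
  have S: "open S" unfolding S_def by (intro open_Times) auto
  define D where "D z = - (u (fst z) (snd z) * time_deriv \<phi> z + Ft (snd z) (norm (fst z)) * \<phi> z)" for z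
  have cD: "continuous_on S D"
    unfolding D_def[abs_def] u_def
    by (intro continuous_on_minus continuous_on_add continuous_on_mult spacetime_continuous c\<phi>) (auto simp: S_def)
  \<comment> \<open>Cutting off the time axis and nonpositive times makes the integrand Borel measurable on all of space-time.\<close>
  define E where "E z = indicator S z *\<^sub>R D z" for z
  have Em: "E \<in> borel_measurable borel"
    unfolding E_def[abs_def] by (rule borel_measurable_continuous_on_indicator[OF _ cD]) (use S in simp)
  define Kc where "Kc = cball (0::'a) R \<times> {a..b}"
  have Kc: "compact Kc" unfolding Kc_def by (intro compact_Times) auto
  have Eoff: "E z = 0" if "z \<notin> Kc" for z
    using off[of "fst z" "snd z"] that by (auto simp: E_def D_def Kc_def mem_Times_iff)
  have "compact (\<phi> ` Kc)" "compact (time_deriv \<phi> ` Kc)" using c\<phi> Kc by (auto intro: compact_continuous_image)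
  then obtain B1 B2 where B: "0 < B1" "0 < B2" "\<And>z. z \<in> Kc \<Longrightarrow> \<bar>\<phi> z\<bar> \<le> B1" "\<And>z. z \<in> Kc \<Longrightarrow> \<bar>time_deriv \<phi> z\<bar> \<le> B2"
    using compact_imp_bounded[of "\<phi> ` Kc"] compact_imp_bounded[of "time_deriv \<phi> ` Kc"] by (auto simp: bounded_pos)
  define M where "M = U R + A * b powr (\<alpha> / 2)"
  define M' where "M' = (\<alpha> * U R + \<alpha> * A * b powr (\<alpha> / 2)) / a"
  have M0: "0 \<le> M" "0 \<le> M'" using U_nonneg[of R] A \<alpha> R by (auto simp: M_def M'_def)
  have Eb: "\<bar>E z\<bar> \<le> (M * B2 + M' * B1) * indicator Kc z" for z
  proof (cases "z \<in> Kc \<and> z \<in> S")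
    case True
    obtain x t where z: "z = (x, t)" by force
    have xt: "x \<noteq> 0" "0 < t" "norm x \<le> R" "a \<le> t" "t \<le> b" using True by (auto simp: z S_def Kc_def)
    have "\<bar>u x t * time_deriv \<phi> z\<bar> \<le> M * B2"
      unfolding abs_mult M_def using u_bounded[OF xt(2,5,3)] B(4)[of z] True M0 by (intro mult_mono) (auto simp: M_def)
    moreover have "\<bar>Ft t (norm x) * \<phi> z\<bar> \<le> M' * B1"
    proof -
      have "t powr (\<alpha> / 2) \<le> b powr (\<alpha> / 2)" using xt \<alpha> by (intro powr_mono2) auto
      then have "\<alpha> * U (norm x) + \<alpha> * A * t powr (\<alpha> / 2) \<le> \<alpha> * U R + \<alpha> * A * b powr (\<alpha> / 2)"
        using U_mono[of "norm x" R] xt \<alpha> A by (intro add_mono mult_left_mono) auto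
      then have "(\<alpha> * U (norm x) + \<alpha> * A * t powr (\<alpha> / 2)) / t \<le> M'"
        unfolding M'_def using xt R U_nonneg[of R] A \<alpha> by (intro frac_le) auto
      then have "\<bar>Ft t (norm x)\<bar> \<le> M'" using Ft_le[OF xt(2), of "norm x"] xt(1) by simp
      then show ?thesis unfolding abs_mult using B(3)[of z] True M0 by (intro mult_mono) auto
    qed
    ultimately show ?thesis using True by (simp add: E_def D_def z)
  next
    case False
    have "E z = 0"
    proof (cases "z \<in> Kc")
      case True
      then have "z \<notin> S" using False by simp
      then show ?thesis by (simp add: E_def)
    qed (rule Eoff)
    then show ?thesis using M0 B by simp
  qed
  have iE: "integrable (lborel \<Otimes>\<^sub>M lborel) (case_prod (\<lambda>x t. E (x, t)))"
    using integrable_bounded_compact_support[OF Em Kc Eb] by (simp add: lborel_prod)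
  have inner0: "(LINT t|lborel. E (x, t)) = 0" if x: "x \<noteq> 0" for x
  proof -
    define h where "h t = u x t * time_deriv \<phi> (x, t) + Ft t (norm x) * \<phi> (x, t)" for t
    have hc: "continuous_on {0<..} h"
    proof -
      have "continuous_on {0<..} (\<lambda>t. D (x, t))"
        by (rule continuous_on_compose2[OF cD]) (use x in \<open>auto simp: S_def intro!: continuous_intros\<close>)
      then have "continuous_on {0<..} (\<lambda>t. - D (x, t))" by (rule continuous_on_minus)
      then show ?thesis by (simp add: D_def h_def add.commute)
    qed
    have E: "E (x, t) = - (h t * indicator {a/2..b+1} t)" for t
      using off[of x t] x R by (auto simp: E_def S_def D_def h_def indicator_def)
    have "(LINT t|lborel. h t * indicator {a/2..b+1} t) = u x (b+1) * \<phi> (x, b+1) - u x (a/2) * \<phi> (x, a/2)"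
    proof (rule integral_FTC_Icc_real)
      show "((\<lambda>t. u x t * \<phi> (x, t)) has_real_derivative h t) (at t)" if "a/2 \<le> t" "t \<le> b+1" for t
      proof -
        have t: "0 < t" using that R by simp
        have 1: "((\<lambda>t. u x t) has_real_derivative Ft t (norm x)) (at t)"
          unfolding u_def using F_has_time_derivative[OF t, of "norm x"] x by simp
        have "((\<lambda>s. \<phi> (x, t + s)) has_real_derivative time_deriv \<phi> (x, t)) (at 0)"
          using partial_line_derivative[OF smooth_differentiable[OF sm], of "(x, t)" "(0, 1)"] by (simp add: time_deriv_def)
        then have 2: "((\<lambda>t. \<phi> (x, t)) has_real_derivative time_deriv \<phi> (x, t)) (at t)"
          using DERIV_shift[of "\<lambda>t. \<phi> (x, t)" "time_deriv \<phi> (x, t)" 0 t] by (simp add: add.commute)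
        show ?thesis by (rule DERIV_cong[OF DERIV_mult[OF 1 2]]) (simp add: h_def)
      qed
      show "isCont h t" if "a/2 \<le> t" "t \<le> b+1" for t
        using hc that R continuous_on_eq_continuous_at[of "{0<..}" h] by auto
    qed (use R in auto)
    also have "\<dots> = 0" using off(1)[of x "b+1"] off(1)[of x "a/2"] R by simp
    finally show ?thesis unfolding E by simp
  qed
  have ae: "AE x::'a in lborel. x \<noteq> 0" by (rule AE_lborel_singleton)
  have Em2: "(\<lambda>t. LINT x|lborel. E (x, t)) \<in> borel_measurable lborel"
  proof -
    have [measurable]: "case_prod (\<lambda>t x. E (x, t)) \<in> borel_measurable (lborel \<Otimes>\<^sub>M lborel)"
    proof -
      have "(\<lambda>z. E (snd z, fst z)) \<in> borel_measurable borel"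
        by (rule measurable_compose[OF _ Em]) (intro borel_measurable_continuous_onI continuous_intros)
      then show ?thesis by (simp add: lborel_prod case_prod_beta')
    qed
    show ?thesis by measurable
  qed
  have pt: "indicator {0<..} t *\<^sub>R (LINT x|lebesgue. - u x t * time_deriv \<phi> (x, t) - u x t * space_laplacian \<phi> (x, t) + norm (grad x t) powr q * \<phi> (x, t))
     = (LINT x|lborel. E (x, t))" for t
  proof (cases "0 < t")
    case True
    have "(LINT x|lborel. - (u x t * time_deriv \<phi> (x, t) + Ft t (norm x) * \<phi> (x, t))) = (LINT x|lborel. E (x, t))"
    proof (rule integral_cong_AE)
      note [measurable] = space_measurable[OF True]
      have [measurable]: "(\<lambda>x. \<phi> (x, t)) \<in> borel_measurable borel" "(\<lambda>x. time_deriv \<phi> (x, t)) \<in> borel_measurable borel"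
        using c\<phi> by (auto intro!: borel_measurable_continuous_onI continuous_on_compose2[where f="\<lambda>x. (x, t)" and t=UNIV] continuous_intros)
      show "(\<lambda>x. - (u x t * time_deriv \<phi> (x, t) + Ft t (norm x) * \<phi> (x, t))) \<in> borel_measurable lborel" by measurable
      have "(\<lambda>x. E (x, t)) \<in> borel_measurable borel"
        by (rule measurable_compose[OF _ Em]) (intro borel_measurable_continuous_onI continuous_intros)
      then show "(\<lambda>x. E (x, t)) \<in> borel_measurable lborel" by simp
      show "AE x in lborel. - (u x t * time_deriv \<phi> (x, t) + Ft t (norm x) * \<phi> (x, t)) = E (x, t)"
        using ae by eventually_elim (use True in \<open>simp add: E_def D_def S_def\<close>)
    qed
    moreover have "(x, t) \<notin> supp \<phi>" if "R < norm x" for x using R(4)[of x t] that by auto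
    ultimately show ?thesis using spatial_integral_identity[OF sm True R(1)] True by simp
  next
    case False
    then show ?thesis by (simp add: E_def S_def)
  qed
  have "(LINT t:{0<..}|lebesgue. (LINT x|lebesgue.
       - u x t * time_deriv \<phi> (x, t) - u x t * space_laplacian \<phi> (x, t) + norm (grad x t) powr q * \<phi> (x, t)))
     = (LINT t|lebesgue. (LINT x|lborel. E (x, t)))"
    unfolding set_lebesgue_integral_def pt ..
  also have "\<dots> = (LINT t|lborel. (LINT x|lborel. E (x, t)))" by (rule integral_completion[OF Em2])
  also have "\<dots> = (LINT x|lborel. (LINT t|lborel. E (x, t)))" by (rule lborel_pair.Fubini_integral[OF iE])
  also have "\<dots> = (LINT x::'a|lborel. 0)"
  proof (rule integral_cong_AE)
    show "(\<lambda>x. LINT t|lborel. E (x, t)) \<in> borel_measurable lborel"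
      using iE by (intro lborel.borel_measurable_lebesgue_integral borel_measurable_integrable)
    show "AE x in lborel. (LINT t|lborel. E (x, t)) = 0" using ae by eventually_elim (rule inner0)
  qed simp
  finally show ?thesis by simp
qed

lemma u_cauchy_weak_solution: "cauchy_weak_solution q (U_tilde q :: 'a \<Rightarrow> real) u"
proof -
  have "has_trace u (U_tilde q :: 'a \<Rightarrow> real)"
    by (rule u_trace) (simp add: U_tilde_def U_def dim \<alpha>_def)
  moreover have "L1_loc_W11_loc u grad"
    unfolding L1_loc_W11_loc_def using u_weak_gradient spacetime_integrability(1,2) by (simp add: AE_I2)
  ultimately show ?thesis
    unfolding cauchy_weak_solution_def weak_solution_def
    using u_nonneg u_continuous_L1 spacetime_integrability(3) weak_equation by blast
qed

end

section \<open>Two weak solutions\<close>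

text \<open>Needed for the stationary solution: it agrees with the self-similar formula at positive times, but
not at \<open>t \<le> 0\<close>, where \<open>t powr (\<alpha> / 2)\<close> is \<open>0\<close> or a junk value.\<close>
lemma cauchy_weak_solution_cong:
  fixes u v :: "'a::euclidean_space \<Rightarrow> real \<Rightarrow> real"
  assumes u: "cauchy_weak_solution q u0 u" and eq: "\<And>x t. 0 < t \<Longrightarrow> v x t = u x t"
  shows "cauchy_weak_solution q u0 v"
proof -
  obtain g where nn: "\<And>x t. 0 < t \<Longrightarrow> 0 \<le> u x t" and c: "continuous_L1_loc u" and tr: "has_trace u u0"
    and g: "L1_loc_W11_loc u g" "locally_integrable_on (\<lambda>(x, t). norm (g x t) powr q) Q"
    and we: "\<And>\<phi>. \<phi> \<in> test_functions Q \<Longrightarrow> (LINT t:{0<..}|lebesgue. (LINT x|lebesgue.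
              - u x t * time_deriv \<phi> (x, t) - u x t * space_laplacian \<phi> (x, t) + norm (g x t) powr q * \<phi> (x, t))) = 0"
    using u unfolding cauchy_weak_solution_def weak_solution_def by blast
  have "continuous_L1_loc v"
    unfolding continuous_L1_loc_def
  proof (intro conjI allI impI)
    show "locally_integrable_on (\<lambda>x. v x t) UNIV" if "0 < t" for t
      using c that unfolding continuous_L1_loc_def by (simp add: eq)
    fix K :: "'a set" and t :: real assume K: "compact K" and t: "0 < t"
    have "((\<lambda>s. LINT x:K|lebesgue. \<bar>u x s - u x t\<bar>) \<longlongrightarrow> 0) (at t)"
      using c K t unfolding continuous_L1_loc_def by simp
    moreover have "\<forall>\<^sub>F s in at t. (LINT x:K|lebesgue. \<bar>u x s - u x t\<bar>) = (LINT x:K|lebesgue. \<bar>v x s - v x t\<bar>)"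
    proof -
      have "\<forall>\<^sub>F s in at t. 0 < s" using t by (intro order_tendstoD(1)[OF tendsto_ident_at])
      then show ?thesis by eventually_elim (simp add: eq t)
    qed
    ultimately show "((\<lambda>s. LINT x:K|lebesgue. \<bar>v x s - v x t\<bar>) \<longlongrightarrow> 0) (at t)" by (rule Lim_transform_eventually)
  qed
  moreover have "L1_loc_W11_loc v g"
    unfolding L1_loc_W11_loc_def
  proof (intro conjI)
    show "AE t in lebesgue. 0 < t \<longrightarrow> has_weak_gradient (\<lambda>x. v x t) (\<lambda>x. g x t)"
      using g(1) unfolding L1_loc_W11_loc_def by (auto simp: eq elim!: eventually_mono)
    show "locally_integrable_on (\<lambda>(x, t). v x t) Q"
      unfolding locally_integrable_on_def
    proof (intro allI impI)
      fix K :: "('a \<times> real) set" assume K: "compact K \<and> K \<subseteq> Q"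
      then have "(\<lambda>(x, t). u x t) absolutely_integrable_on K"
        using g(1) unfolding L1_loc_W11_loc_def locally_integrable_on_def by blast
      then show "(\<lambda>(x, t). v x t) absolutely_integrable_on K"
        by (rule absolutely_integrable_spike[OF _ negligible_empty]) (use K in \<open>auto simp: Q_def eq\<close>)
    qed
  qed (use g(1) in \<open>auto simp: L1_loc_W11_loc_def\<close>)
  moreover have "(LINT t:{0<..}|lebesgue. (LINT x|lebesgue.
       - v x t * time_deriv \<phi> (x, t) - v x t * space_laplacian \<phi> (x, t) + norm (g x t) powr q * \<phi> (x, t))) = 0"
    if "\<phi> \<in> test_functions Q" for \<phi>
  proof (rule trans[OF _ we[OF that]])
    show "(LINT t:{0<..}|lebesgue. (LINT x|lebesgue.
       - v x t * time_deriv \<phi> (x, t) - v x t * space_laplacian \<phi> (x, t) + norm (g x t) powr q * \<phi> (x, t)))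
      = (LINT t:{0<..}|lebesgue. (LINT x|lebesgue.
       - u x t * time_deriv \<phi> (x, t) - u x t * space_laplacian \<phi> (x, t) + norm (g x t) powr q * \<phi> (x, t)))"
      unfolding set_lebesgue_integral_def
      by (rule Bochner_Integration.integral_cong[OF refl]) (simp add: indicator_def eq)
  qed
  moreover have "has_trace v u0"
    unfolding has_trace_def
  proof (intro conjI allI impI)
    show "locally_integrable_on u0 UNIV" using tr by (simp add: has_trace_def)
    fix \<psi> :: "'a \<Rightarrow> real" assume "continuous_on UNIV \<psi> \<and> compact (supp \<psi>)"
    then have "((\<lambda>t. LINT x|lebesgue. u x t * \<psi> x) \<longlongrightarrow> (LINT x|lebesgue. \<psi> x * u0 x)) (at_right 0)"
      using tr unfolding has_trace_def by blast
    moreover have "\<forall>\<^sub>F t in at_right 0. (LINT x|lebesgue. u x t * \<psi> x) = (LINT x|lebesgue. v x t * \<psi> x)"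
      by (rule eventually_mono[OF eventually_at_right_less]) (simp add: eq)
    ultimately show "((\<lambda>t. LINT x|lebesgue. v x t * \<psi> x) \<longlongrightarrow> (LINT x|lebesgue. \<psi> x * u0 x)) (at_right 0)"
      by (rule Lim_transform_eventually)
  qed
  ultimately show ?thesis
    unfolding cauchy_weak_solution_def weak_solution_def using nn g(2) by (auto simp: eq)
qed

theorem theorem1p5:
  fixes q :: real
  assumes "q > 2" and "CARD('n::finite) \<ge> 2"
  shows "continuous_on UNIV (U_tilde q :: real ^ 'n \<Rightarrow> real) \<and>
    cauchy_weak_solution q (U_tilde q :: real ^ 'n \<Rightarrow> real) (\<lambda>x t. U_tilde q x) \<and>
    (\<exists>f :: real \<Rightarrow> real.
       strict_mono_on {0..} f \<and>
       f 0 > 0 \<and>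
       ((\<lambda>\<eta>. \<eta> powr (- abs_a q) * f \<eta>) \<longlongrightarrow> C_tilde CARD('n) q) at_top \<and>
       cauchy_weak_solution q (U_tilde q :: real ^ 'n \<Rightarrow> real) (self_similar q f) \<and>
       \<not> (AE z in lebesgue. z \<in> Q \<longrightarrow>
            self_similar q f (fst z :: real ^ 'n) (snd z) = U_tilde q (fst z)))"
proof -
  interpret profile_equation q "CARD('n)" by unfold_locales (use assms in auto)
  have dim: "DIM(real ^ 'n) = CARD('n)" by simp
  have Ut: "U_tilde q x = U (norm x)" for x :: "real ^ 'n" by (simp add: U_tilde_def U_def \<alpha>_def)
  have cont: "continuous_on S (U_tilde q :: real ^ 'n \<Rightarrow> real)" for S
    unfolding Ut[abs_def] by (intro continuous_on_compose2[OF U_continuous] continuous_intros) auto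
  interpret stat: self_similar_profile q "CARD('n)" U V 0 "TYPE(real ^ 'n)"
    by unfold_locales
      (use U_continuous U_has_derivative V_has_derivative V_pos in \<open>auto intro: less_imp_le\<close>)
  have stationary: "cauchy_weak_solution q (U_tilde q :: real ^ 'n \<Rightarrow> real) (\<lambda>x t. U_tilde q x)"
  proof (rule cauchy_weak_solution_cong[OF stat.u_cauchy_weak_solution])
    show "U_tilde q x = stat.u x t" if "0 < t" for x :: "real ^ 'n" and t
      using stat.F_bounds[OF that, of "norm x"] by (simp add: Ut stat.u_def)
  qed
  obtain f w A where A: "0 < A" "f 0 = A" and fc: "continuous_on UNIV f"
    and df: "\<And>\<eta>. 0 < \<eta> \<Longrightarrow> (f has_real_derivative w \<eta>) (at \<eta>)"
    and dw: "\<And>\<eta>. 0 < \<eta> \<Longrightarrow> (w has_real_derivative \<alpha> / 2 * f \<eta> + w \<eta> powr q - ((real CARD('n) - 1) / \<eta> + \<eta> / 2) * w \<eta>) (at \<eta>)"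
    and w: "\<And>\<eta>. 0 < \<eta> \<Longrightarrow> 0 < w \<eta>" "\<And>\<eta>. 0 < \<eta> \<Longrightarrow> w \<eta> \<le> V \<eta>"
    and f: "\<And>\<eta>. 0 \<le> \<eta> \<Longrightarrow> U \<eta> \<le> f \<eta>" "\<And>\<eta>. 0 \<le> \<eta> \<Longrightarrow> f \<eta> \<le> U \<eta> + A"
    by (rule connecting_profile_exists, rule that)
  interpret ss: self_similar_profile q "CARD('n)" f w A "TYPE(real ^ 'n)"
    by unfold_locales (use A fc df dw w f in \<open>auto intro: less_imp_le continuous_on_subset\<close>)
  have su: "self_similar q f = (ss.u :: real ^ 'n \<Rightarrow> real \<Rightarrow> real)"
    by (intro ext) (simp add: self_similar_def ss.u_def ss.F_def \<alpha>_def)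
  have mono: "strict_mono_on {0..} f"
  proof (rule strict_mono_onI)
    fix r s :: real assume rs: "r \<in> {0..}" "s \<in> {0..}" "r < s"
    show "f r < f s"
    proof (rule DERIV_pos_imp_increasing_open[OF rs(3)])
      show "\<exists>y. (f has_real_derivative y) (at x) \<and> 0 < y" if "r < x" "x < s" for x
        using df[of x] w(1)[of x] that rs by auto
      show "continuous_on {r..s} f" by (rule continuous_on_subset[OF fc]) simp
    qed
  qed
  have lim: "((\<lambda>\<eta>. \<eta> powr (- abs_a q) * f \<eta>) \<longlongrightarrow> C_tilde CARD('n) q) at_top"
  proof (rule tendsto_sandwich)
    have key: "\<eta> powr - \<alpha> * U \<eta> = C_tilde CARD('n) q" if "0 < \<eta>" for \<eta>
      using that by (simp add: U_def powr_minus field_simps)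
    have pos: "\<forall>\<^sub>F \<eta>::real in at_top. 0 < \<eta>" by (rule eventually_gt_at_top)
    show "\<forall>\<^sub>F \<eta> in at_top. C_tilde CARD('n) q \<le> \<eta> powr (- abs_a q) * f \<eta>"
      using pos
    proof eventually_elim
      case (elim \<eta>)
      have "\<eta> powr - \<alpha> * U \<eta> \<le> \<eta> powr - \<alpha> * f \<eta>" using f(1)[of \<eta>] elim by (intro mult_left_mono) auto
      then show ?case using key[OF elim] by (simp add: \<alpha>_def)
    qed
    show "\<forall>\<^sub>F \<eta> in at_top. \<eta> powr (- abs_a q) * f \<eta> \<le> C_tilde CARD('n) q + A * \<eta> powr - \<alpha>"
      using pos
    proof eventually_elim
      case (elim \<eta>)
      have "\<eta> powr - \<alpha> * f \<eta> \<le> \<eta> powr - \<alpha> * (U \<eta> + A)" using f(2)[of \<eta>] elim by (intro mult_left_mono) auto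
      then show ?case using key[OF elim] by (simp add: \<alpha>_def distrib_left mult.commute)
    qed
    have "((\<lambda>\<eta>::real. \<eta> powr - \<alpha>) \<longlongrightarrow> 0) at_top"
      using \<alpha>(1) by (intro tendsto_neg_powr filterlim_ident) auto
    from tendsto_add[OF tendsto_const tendsto_mult_right_zero[OF this, of A], of "C_tilde CARD('n) q"]
    show "((\<lambda>\<eta>. C_tilde CARD('n) q + A * \<eta> powr - \<alpha>) \<longlongrightarrow> C_tilde CARD('n) q) at_top" by simp
  qed (rule tendsto_const)
  \<comment> \<open>At \<open>(0, 1)\<close> the two solutions take the values \<open>A\<close> and \<open>0\<close>, so by continuity they differ on an open set.\<close>
  have differ: "\<not> (AE z in lebesgue. z \<in> Q \<longrightarrow> self_similar q f (fst z :: real ^ 'n) (snd z) = U_tilde q (fst z))"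
  proof
    assume ae: "AE z in lebesgue. z \<in> Q \<longrightarrow> self_similar q f (fst z :: real ^ 'n) (snd z) = U_tilde q (fst z)"
    define W where "W = {z \<in> (Q :: ((real ^ 'n) \<times> real) set). ss.u (fst z) (snd z) - U_tilde q (fst z) \<noteq> 0}"
    have oQ: "open (Q :: ((real ^ 'n) \<times> real) set)" unfolding Q_def by (intro open_Times) auto
    have "continuous_on (Q :: ((real ^ 'n) \<times> real) set) (\<lambda>z. ss.u (fst z) (snd z))"
      unfolding ss.u_def by (rule ss.spacetime_continuous(1)) (simp add: Q_def)
    moreover have "continuous_on Q (\<lambda>z. U_tilde q (fst z :: real ^ 'n))"
      by (rule continuous_on_compose2[OF cont[of UNIV]]) (auto intro!: continuous_intros)
    ultimately have "continuous_on Q (\<lambda>z. ss.u (fst z) (snd z) - U_tilde q (fst z :: real ^ 'n))" by (rule continuous_on_diff)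
    then have "open ((\<lambda>z. ss.u (fst z) (snd z) - U_tilde q (fst z :: real ^ 'n)) -` (-{0}) \<inter> Q)"
      using continuous_on_open_vimage[OF oQ] by blast
    moreover have "(\<lambda>z. ss.u (fst z) (snd z) - U_tilde q (fst z :: real ^ 'n)) -` (-{0}) \<inter> Q = W" by (auto simp: W_def)
    ultimately have "open W" by simp
    moreover have "(0, 1) \<in> W"
      using A \<alpha>(1) by (simp add: W_def Q_def Ut U_def ss.u_def ss.F_def)
    ultimately have "\<not> negligible W" using open_not_negligible by blast
    moreover have "negligible W"
    proof -
      have "AE z in lebesgue. z \<notin> W" using ae by eventually_elim (auto simp: W_def su)
      moreover have "W \<in> sets lebesgue" using \<open>open W\<close> by simp
      ultimately show ?thesis by (simp add: negligible_iff_null_sets AE_iff_null_sets)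
    qed
    ultimately show False by blast
  qed
  have "cauchy_weak_solution q (U_tilde q :: real ^ 'n \<Rightarrow> real) (self_similar q f)"
    unfolding su by (rule ss.u_cauchy_weak_solution)
  moreover have "f 0 > 0" using A by simp
  ultimately show ?thesis
    using mono lim differ by (intro conjI exI[of _ f] cont stationary)
qed

end
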